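(* Fix a real number $c>1$ and let $\operatorname{Riesz}_c(x) = \sum_{k=1}^\infty \frac{(-1)^{k+1}x^k}{(k-1)!\,\zeta(ck)}$. Then the Riemann hypothesis holds if and only if for every $\epsilon>0$, $$\operatorname{Riesz}_c(x) = O\big(x^{\frac{1}{2c}+\epsilon}\big) \quad \text{as } x \to +\infty \text{ through real values}.$$
   Context: $\zeta$ denotes the Riemann zeta function; the Riemann hypothesis is the statement that all nontrivial zeros of $\zeta$ have real part $1/2$. For $c=2$, $\operatorname{Riesz}_2$ is the Riesz function $\sum_{k\ge1}\frac{(-1)^{k+1}x^k}{(k-1)!\zeta(2k)}$. *)

theory Defs
  imports "HOL-Analysis.Analysis" "HOL-Library.Landau_Symbols"
begin

text \<open>The Riemann zeta function on all of C minus the pole, via the globally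
convergent Hasse--Sondow series
  zeta(s) = 1/(s-1) * sum_{n>=0} 1/(n+1) * sum_{k=0}^n (-1)^k (n choose k) (k+1)^(1-s).
At s = 1 (the pole) the value is junk (0, since 1/0 = 0 in HOL).\<close>
definition zeta :: "complex \<Rightarrow> complex" where
  "zeta s = (1 / (s - 1)) *
     (\<Sum>n. (1 / of_nat (Suc n)) *
        (\<Sum>k\<le>n. (-1) ^ k * of_nat (n choose k) * (of_nat (Suc k)) powr (1 - s)))"

definition riemann_hypothesis :: bool where
  "riemann_hypothesis \<longleftrightarrow>
     (\<forall>s. s \<noteq> 1 \<and> zeta s = 0 \<and> (\<forall>n::nat. s \<noteq> - 2 * of_nat (Suc n)) \<longrightarrow> Re s = 1 / 2)"

text \<open>Riesz_c(x) = sum_{k>=1} (-1)^(k+1) x^k / ((k-1)! zeta(c k)); here k = n + 1.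
For c > 1, zeta(c k) is real, so we take the real part.\<close>
definition Riesz :: "real \<Rightarrow> real \<Rightarrow> real" where
  "Riesz c x = (\<Sum>n. (-1) ^ n * x ^ Suc n /
       (fact n * Re (zeta (complex_of_real (c * real (Suc n))))))"

end

theory Submission
  imports Defs "HOL-Complex_Analysis.Complex_Analysis" "HOL-Real_Asymp.Real_Asymp"
    "HOL-Probability.Sinc_Integral"
begin

text \<open>
  Both directions rest on Mellin transforms of the Riesz function.

  If zeta has no zeros with real part greater than 1/2, the partial sums of the Riesz series are
  the residues of Gamma(1-s) x^s / zeta(c s) at s = 1, 2, ...; collecting them expresses the
  Riesz function as 1/(2 pi) times the integral of that function over the line
  Re s = 1/(2c) + epsilon. The Borel--Caratheodory theorem bounds 1/zeta polynomially there, Gamma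
  decays faster than any power of Im s, and x^s has absolute value x^(1/(2c) + epsilon).

  Conversely, the sum over m of Riesz(x / m^c) is x exp(-x), so the Mellin transform F(s) of the
  Riesz function at -s satisfies Gamma(1-s) = zeta(c s) F(s) for 1/c < Re s < 1. The growth bound
  makes F holomorphic on 1/(2c) < Re s < 1, where the identity persists; as Gamma has no zeros,
  neither has zeta(c s). The functional equation takes care of zeros with real part below 1/2.
\<close>

section \<open>Mellin transforms\<close>

text \<open>The strips come from three constraints. \<open>Riesz c x\<close> is O(x) at 0, so its
  transform at -s converges at 0 for Re s < 1; the growth bound gives convergence at infinity for Re
  s > 1/(2c), which is Re w > 1/2 under w = c s; and the Dirichlet series of zeta(c s) needs Re s >
  1/c. As c > 1, the last half-plane overlaps the first. Zeros with Re w >= c would have Re s >= 1,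
  outside the strip, and are excluded by a sieve instead. In the other direction, absence of zeros
  alone gives no lower bound for zeta: the bound comes from holomorphic logarithms on discs touching
  the line Re = 1/2, whose real parts are controlled by the polynomial growth of zeta. The lines of
  integration are pushed to the right through half-integers, where 1/zeta is bounded and Gamma(1 -
  s) is of size 2^N / N!, which beats x^N. As zeta is given by the Hasse series, its continuation,
  Dirichlet series and functional equation are derived here, through Mellin transforms of kernels
  built from exp. The pole is avoided by working with (s - 1) zeta(s).\<close>

definition mellin_integrable :: "(real \<Rightarrow> real) \<Rightarrow> real \<Rightarrow> bool" where
  "mellin_integrable f a \<longleftrightarrow> set_integrable lborel {0<..} (\<lambda>x. f x * x powr (a - 1))"

definition mellin :: "(real \<Rightarrow> real) \<Rightarrow> complex \<Rightarrow> complex" where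
  "mellin f s = (LINT x:{0<..}|lborel. of_real (f x) * of_real x powr (s - 1))"

text \<open>Multiplying the integrand by x^(1-a) recovers f itself, so integrability at one exponent
  gives measurability of the integrand at every complex s.\<close>

lemma mellin_integrable_measurable:
  assumes "mellin_integrable f a"
  shows "(\<lambda>x. indicator {0<..} x * f x) \<in> borel_measurable borel"
proof -
  have "(\<lambda>x. indicator {0<..} x *\<^sub>R (f x * x powr (a - 1))) \<in> borel_measurable borel"
    using borel_measurable_integrable[OF assms[unfolded mellin_integrable_def set_integrable_def]] by simp
  hence "(\<lambda>x. (indicator {0<..} x *\<^sub>R (f x * x powr (a - 1))) * x powr (1 - a)) \<in> borel_measurable borel"
    by measurable
  also have "(\<lambda>x. (indicator {0<..} x *\<^sub>R (f x * x powr (a - 1))) * x powr (1 - a)) = (\<lambda>x. indicator {0<..} x * f x)"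
    by (auto simp: fun_eq_iff indicator_def mult.assoc powr_add[symmetric])
  finally show ?thesis .
qed

text \<open>The two exponents let the majorant absorb a power of x: a bound f = O(x^(a-b) g) is used
  in one step.\<close>

lemma mellin_integrable_bound:
  assumes "mellin_integrable g a" "(\<lambda>x. indicator {0<..} x * f x) \<in> borel_measurable borel"
    and "\<And>x. x > 0 \<Longrightarrow> \<bar>f x\<bar> * x powr (b - 1) \<le> C * (\<bar>g x\<bar> * x powr (a - 1))"
  shows "mellin_integrable f b"
  unfolding mellin_integrable_def set_integrable_def
proof (rule Bochner_Integration.integrable_bound)
  show "integrable lborel (\<lambda>x. C * (indicator {0<..} x *\<^sub>R (g x * x powr (a - 1))))"
    using assms(1) unfolding mellin_integrable_def set_integrable_def by (intro integrable_mult_right) auto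
  have "(\<lambda>x. (indicator {0<..} x * f x) * x powr (b - 1)) \<in> borel_measurable borel"
    using assms(2) by measurable
  thus "(\<lambda>x. indicator {0<..} x *\<^sub>R (f x * x powr (b - 1))) \<in> borel_measurable lborel"
    by (simp add: mult_ac)
  show "AE x in lborel. norm (indicator {0<..} x *\<^sub>R (f x * x powr (b - 1)))
          \<le> norm (C * (indicator {0<..} x *\<^sub>R (g x * x powr (a - 1))))"
  proof (rule AE_I2)
    fix x :: real
    show "norm (indicator {0<..} x *\<^sub>R (f x * x powr (b - 1)))
          \<le> norm (C * (indicator {0<..} x *\<^sub>R (g x * x powr (a - 1))))"
    proof (cases "x > 0")
      case True
      have "\<bar>f x\<bar> * x powr (b - 1) \<le> \<bar>C\<bar> * (\<bar>g x\<bar> * x powr (a - 1))"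
        using assms(3)[OF True] by (rule order_trans) (intro mult_right_mono, auto)
      thus ?thesis using True by (simp add: abs_mult)
    qed auto
  qed
qed

lemma mellin_integrable_abs:
  "mellin_integrable f a \<Longrightarrow> mellin_integrable (\<lambda>x. \<bar>f x\<bar>) a"
  unfolding mellin_integrable_def
  by (drule set_integrable_abs) (simp add: abs_mult)

lemma mellin_integrand_measurable:
  assumes "mellin_integrable f a"
  shows "(\<lambda>x. indicator {0<..} x *\<^sub>R (of_real (f x) * of_real x powr (s - 1) :: complex)) \<in> borel_measurable borel"
proof -
  note [measurable] = mellin_integrable_measurable[OF assms]
  have "(\<lambda>x. of_real (indicator {0<..} x * f x) * (of_real x powr (s - 1) :: complex)) \<in> borel_measurable borel"
    by measurable
  thus ?thesis by (simp add: scaleR_conv_of_real mult_ac)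
qed

lemma mellin_integrand_integrable:
  assumes "mellin_integrable f (Re s)"
  shows "set_integrable lborel {0<..} (\<lambda>x. of_real (f x) * of_real x powr (s - 1) :: complex)"
  unfolding set_integrable_def
proof (rule Bochner_Integration.integrable_bound)
  show "integrable lborel (\<lambda>x. indicator {0<..} x *\<^sub>R (f x * x powr (Re s - 1)))"
    using assms unfolding mellin_integrable_def set_integrable_def .
  show "(\<lambda>x. indicator {0<..} x *\<^sub>R (of_real (f x) * of_real x powr (s - 1) :: complex)) \<in> borel_measurable lborel"
    using mellin_integrand_measurable[OF assms] by simp
  show "AE x in lborel. norm (indicator {0<..} x *\<^sub>R (of_real (f x) * of_real x powr (s - 1) :: complex))
          \<le> norm (indicator {0<..} x *\<^sub>R (f x * x powr (Re s - 1)))"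
    by (intro AE_I2) (auto simp: indicator_def norm_mult norm_powr_real_powr abs_mult)
qed

lemma norm_mellin_le:
  assumes "mellin_integrable f (Re s)"
  shows "norm (mellin f s) \<le> (LINT x:{0<..}|lborel. \<bar>f x\<bar> * x powr (Re s - 1))"
proof -
  have "norm (mellin f s) \<le> (LINT x:{0<..}|lborel. norm (of_real (f x) * of_real x powr (s - 1) :: complex))"
    unfolding mellin_def by (rule set_integral_norm_bound[OF mellin_integrand_integrable[OF assms]])
  also have "\<dots> = (LINT x:{0<..}|lborel. \<bar>f x\<bar> * x powr (Re s - 1))"
    by (intro set_lebesgue_integral_cong) (auto simp: norm_mult norm_powr_real_powr)
  finally show ?thesis .
qed

lemma mellin_cong:
  "(\<And>x. x > 0 \<Longrightarrow> f x = g x) \<Longrightarrow> mellin f s = mellin g s"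
  unfolding mellin_def by (intro set_lebesgue_integral_cong) auto

lemma mellin_integrable_cong:
  "(\<And>x. x > 0 \<Longrightarrow> f x = g x) \<Longrightarrow> mellin_integrable f a = mellin_integrable g a"
  unfolding mellin_integrable_def by (intro set_integrable_cong) auto

lemma mellin_integrable_add:
  "mellin_integrable f a \<Longrightarrow> mellin_integrable g a \<Longrightarrow> mellin_integrable (\<lambda>x. f x + g x) a"
  unfolding mellin_integrable_def by (drule (1) set_integral_add) (simp add: ring_distribs)

lemma mellin_integrable_cmult:
  "mellin_integrable f a \<Longrightarrow> mellin_integrable (\<lambda>x. k * f x) a"
  unfolding mellin_integrable_def
  using set_integrable_mult_right[of k lborel "{0<..}" "\<lambda>x. f x * x powr (a - 1)"]
  by (simp add: mult.assoc)

lemma mellin_add: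
  "mellin_integrable f (Re s) \<Longrightarrow> mellin_integrable g (Re s) \<Longrightarrow> mellin (\<lambda>x. f x + g x) s = mellin f s + mellin g s"
  unfolding mellin_def
  by (subst set_integral_add(2)[symmetric]) (auto simp: mellin_integrand_integrable ring_distribs)

lemma mellin_cmult: "mellin (\<lambda>x. k * f x) s = of_real k * mellin f s"
  unfolding mellin_def by (subst set_integral_mult_right[symmetric]) (simp add: mult_ac)

lemma mellin_integrable_sum:
  "finite A \<Longrightarrow> (\<And>k. k \<in> A \<Longrightarrow> mellin_integrable (f k) a) \<Longrightarrow> mellin_integrable (\<lambda>x. \<Sum>k\<in>A. f k x) a"
  by (induction A rule: finite_induct)
     (auto intro: mellin_integrable_add, simp add: mellin_integrable_def set_integrable_def)

lemma mellin_sum: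
  "finite A \<Longrightarrow> (\<And>k. k \<in> A \<Longrightarrow> mellin_integrable (f k) (Re s)) \<Longrightarrow> mellin (\<lambda>x. \<Sum>k\<in>A. f k x) s = (\<Sum>k\<in>A. mellin (f k) s)"
proof (induction A rule: finite_induct)
  case empty
  show ?case by (simp add: mellin_def set_lebesgue_integral_def)
next
  case (insert k A)
  have "mellin (\<lambda>x. f k x + (\<Sum>k\<in>A. f k x)) s = mellin (f k) s + mellin (\<lambda>x. \<Sum>k\<in>A. f k x) s"
    by (rule mellin_add) (use insert in \<open>auto intro: mellin_integrable_sum\<close>)
  thus ?case using insert by simp
qed

lemma mellin_scale:
  assumes "k > 0"
  shows "mellin (\<lambda>x. f (x / k)) s = of_real k powr s * mellin f s"
proof -
  have *: "of_real (k * x) powr (s - 1) = (of_real k powr (s - 1) * of_real x powr (s - 1) :: complex)" if "x > 0" for x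
    using assms that by (simp add: powr_times_real)
  have "mellin (\<lambda>x. f (x / k)) s = \<bar>k\<bar> *\<^sub>R (LINT x|lborel. indicator {0<..} (0 + k * x) *\<^sub>R (of_real (f ((0 + k * x) / k)) * of_real (0 + k * x) powr (s - 1) :: complex))"
    unfolding mellin_def set_lebesgue_integral_def
    by (subst lborel_integral_real_affine[of k _ 0]) (use assms in auto)
  also have "(\<lambda>x. indicator {0<..} (0 + k * x) *\<^sub>R (of_real (f ((0 + k * x) / k)) * of_real (0 + k * x) powr (s - 1) :: complex))
     = (\<lambda>x. of_real k powr (s - 1) * indicator {0<..} x *\<^sub>R (of_real (f x) * of_real x powr (s - 1)))"
    using assms * by (auto simp: fun_eq_iff indicator_def zero_less_mult_iff mult_ac)
  also have "\<bar>k\<bar> *\<^sub>R (LINT x|lborel. of_real k powr (s - 1) * indicator {0<..} x *\<^sub>R (of_real (f x) * of_real x powr (s - 1)))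
      = (of_real k * of_real k powr (s - 1)) * mellin f s"
    using assms by (simp add: mellin_def set_lebesgue_integral_def scaleR_conv_of_real)
  also have "of_real k * of_real k powr (s - 1) = (of_real k powr s :: complex)"
    using assms by (simp add: powr_diff)
  finally show ?thesis .
qed

lemma mellin_integrable_scale:
  assumes "k > 0" "mellin_integrable f a"
  shows "mellin_integrable (\<lambda>x. f (x / k)) a"
proof -
  have "integrable lborel (\<lambda>x. indicator {0<..} (0 + (1/k) * x) *\<^sub>R (f (0 + (1/k) * x) * (0 + (1/k) * x) powr (a - 1)))"
    by (rule lborel_integrable_real_affine) (use assms in \<open>auto simp: mellin_integrable_def set_integrable_def\<close>)
  hence "integrable lborel (\<lambda>x. k powr (a - 1) * (indicator {0<..} (0 + (1/k) * x) *\<^sub>R (f (0 + (1/k) * x) * (0 + (1/k) * x) powr (a - 1))))"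
    by (rule integrable_mult_right)
  also have "(\<lambda>x. k powr (a - 1) * (indicator {0<..} (0 + (1/k) * x) *\<^sub>R (f (0 + (1/k) * x) * (0 + (1/k) * x) powr (a - 1))))
     = (\<lambda>x. indicator {0<..} x *\<^sub>R (f (x / k) * x powr (a - 1)))"
    using assms by (auto simp: fun_eq_iff indicator_def zero_less_divide_iff powr_divide mult_ac)
  finally show ?thesis unfolding mellin_integrable_def set_integrable_def .
qed

lemma mellin_abs_integral_scale:
  fixes f :: "real \<Rightarrow> real"
  assumes "k > 0"
  shows "(LINT x:{0<..}|lborel. \<bar>f (x / k)\<bar> * x powr (a - 1)) = k powr a * (LINT x:{0<..}|lborel. \<bar>f x\<bar> * x powr (a - 1))"
proof -
  have "(LINT x:{0<..}|lborel. \<bar>f (x / k)\<bar> * x powr (a - 1))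
     = \<bar>k\<bar> *\<^sub>R (LINT x|lborel. indicator {0<..} (0 + k * x) *\<^sub>R (\<bar>f ((0 + k * x) / k)\<bar> * (0 + k * x) powr (a - 1)))"
    unfolding set_lebesgue_integral_def
    by (subst lborel_integral_real_affine[of k _ 0]) (use assms in auto)
  also have "(\<lambda>x. indicator {0<..} (0 + k * x) *\<^sub>R (\<bar>f ((0 + k * x) / k)\<bar> * (0 + k * x) powr (a - 1)))
     = (\<lambda>x. k powr (a - 1) * indicator {0<..} x *\<^sub>R (\<bar>f x\<bar> * x powr (a - 1)))"
    using assms by (auto simp: fun_eq_iff indicator_def zero_less_mult_iff mult_ac powr_mult)
  also have "\<bar>k\<bar> *\<^sub>R (LINT x|lborel. k powr (a - 1) * indicator {0<..} x *\<^sub>R (\<bar>f x\<bar> * x powr (a - 1)))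
      = (k * k powr (a - 1)) * (LINT x:{0<..}|lborel. \<bar>f x\<bar> * x powr (a - 1))"
    using assms by (simp add: set_lebesgue_integral_def)
  also have "k * k powr (a - 1) = k powr a"
    using assms by (simp add: powr_diff)
  finally show ?thesis .
qed

lemma mellin_sums:
  assumes int: "\<And>n. mellin_integrable (f n) (Re s)"
    and summ: "\<And>x. x > 0 \<Longrightarrow> summable (\<lambda>n. \<bar>f n x\<bar>)"
    and sm: "summable (\<lambda>n. LINT x:{0<..}|lborel. \<bar>f n x\<bar> * x powr (Re s - 1))"
  shows "(\<lambda>n. mellin (f n) s) sums mellin (\<lambda>x. \<Sum>n. f n x) s" "mellin_integrable (\<lambda>x. \<Sum>n. f n x) (Re s)"
proof -
  let ?F = "\<lambda>n x. indicator {0<..} x *\<^sub>R (of_real (f n x) * of_real x powr (s - 1) :: complex)"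
  have nrm: "norm (?F n x) = indicator {0<..} x *\<^sub>R (\<bar>f n x\<bar> * x powr (Re s - 1))" for n x
    by (auto simp: indicator_def norm_mult norm_powr_real_powr)
  have sx: "summable (\<lambda>n. norm (?F n x))" for x
    unfolding nrm using summ[of x] by (cases "x > 0") (auto intro!: summable_mult2)
  have eq: "(\<Sum>n. ?F n x) = indicator {0<..} x *\<^sub>R (of_real (\<Sum>n. f n x) * of_real x powr (s - 1))" for x
  proof (cases "x > 0")
    case True
    have "summable (\<lambda>n. f n x)" using summ[OF True] by (rule summable_rabs_cancel)
    hence "(\<lambda>n. of_real (f n x) * (of_real x powr (s - 1) :: complex)) sums (of_real (\<Sum>n. f n x) * of_real x powr (s - 1))"
      by (intro sums_mult2) (auto simp: sums_of_real_iff summable_sums)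
    thus ?thesis using True by (simp add: sums_iff)
  qed auto
  have "(\<lambda>n. integral\<^sup>L lborel (?F n)) sums (\<integral>x. (\<Sum>n. ?F n x) \<partial>lborel)"
  proof (rule sums_integral)
    show "integrable lborel (?F n)" for n
      using mellin_integrand_integrable[OF int[of n]] unfolding set_integrable_def .
    show "AE x in lborel. summable (\<lambda>n. norm (?F n x))" using sx by simp
    show "summable (\<lambda>n. \<integral>x. norm (?F n x) \<partial>lborel)"
      using sm unfolding nrm set_lebesgue_integral_def .
  qed
  thus "(\<lambda>n. mellin (f n) s) sums mellin (\<lambda>x. \<Sum>n. f n x) s"
    unfolding eq mellin_def set_lebesgue_integral_def .
  have "integrable lborel (\<lambda>x. \<Sum>n. indicator {0<..} x *\<^sub>R (f n x * x powr (Re s - 1)))"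
  proof (rule integrable_suminf)
    show "integrable lborel (\<lambda>x. indicator {0<..} x *\<^sub>R (f n x * x powr (Re s - 1)))" for n
      using int[of n] unfolding mellin_integrable_def set_integrable_def .
    show "AE x in lborel. summable (\<lambda>n. norm (indicator {0<..} x *\<^sub>R (f n x * x powr (Re s - 1))))"
    proof (rule AE_I2)
      fix x :: real
      show "summable (\<lambda>n. norm (indicator {0<..} x *\<^sub>R (f n x * x powr (Re s - 1))))"
        using summ[of x] by (cases "x > 0") (auto simp: abs_mult intro!: summable_mult2)
    qed
    have e: "norm (indicator {0<..} x *\<^sub>R (f n x * x powr (Re s - 1))) = indicator {0<..} x *\<^sub>R (\<bar>f n x\<bar> * x powr (Re s - 1))" for n x
      by (auto simp: indicator_def abs_mult)
    show "summable (\<lambda>n. \<integral>x. norm (indicator {0<..} x *\<^sub>R (f n x * x powr (Re s - 1))) \<partial>lborel)"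
      using sm unfolding e set_lebesgue_integral_def .
  qed
  also have "(\<lambda>x. \<Sum>n. indicator {0<..} x *\<^sub>R (f n x * x powr (Re s - 1))) = (\<lambda>x. indicator {0<..} x *\<^sub>R ((\<Sum>n. f n x) * x powr (Re s - 1)))"
  proof
    fix x :: real
    show "(\<Sum>n. indicator {0<..} x *\<^sub>R (f n x * x powr (Re s - 1))) = indicator {0<..} x *\<^sub>R ((\<Sum>n. f n x) * x powr (Re s - 1))"
      using summ[of x] by (cases "x > 0") (auto simp: suminf_mult2 summable_rabs_cancel)
  qed
  finally show "mellin_integrable (\<lambda>x. \<Sum>n. f n x) (Re s)"
    unfolding mellin_integrable_def set_integrable_def .
qed

section \<open>Exponentials, the Gamma function, and holomorphy of Mellin transforms\<close>

lemma mellin_exp: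
  assumes "Re s > 0"
  shows "mellin (\<lambda>x. exp (- x)) s = Gamma s" "mellin_integrable (\<lambda>x. exp (- x)) (Re s)"
proof -
  have e: "complex_of_real t powr (z - 1) / of_real (exp t) = of_real (exp (-t)) * of_real t powr (z - 1)" for t z
    by (simp add: exp_minus field_simps)
  let ?g = "\<lambda>z t. indicator {0<..} t *\<^sub>R (of_real (exp (- t)) * of_real t powr (z - 1) :: complex)"
  have int: "set_integrable lborel {0<..} (\<lambda>t. of_real (exp (- t)) * of_real t powr (z - 1) :: complex)" if "Re z > 0" for z
  proof -
    \<comment> \<open>The library integral is taken over the completed measure; Borel measurability
      of the integrand brings it back to \<open>lborel\<close>.\<close>
    have "integrable lebesgue (?g z)"
      using absolutely_integrable_Gamma_integral'[OF that] unfolding e set_integrable_def .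
    moreover have "?g z \<in> borel_measurable lborel"
      by (measurable)
    ultimately show ?thesis unfolding set_integrable_def by (subst (asm) integrable_completion) auto
  qed
  have "integrable lborel (\<lambda>x. norm (?g (of_real (Re s)) x))"
    using int[of "of_real (Re s)"] assms unfolding set_integrable_def by (intro integrable_norm) simp
  also have "(\<lambda>x. norm (?g (of_real (Re s)) x)) = (\<lambda>x. indicator {0<..} x *\<^sub>R (exp (- x) * x powr (Re s - 1)))"
    by (auto simp: fun_eq_iff indicator_def norm_mult norm_powr_real_powr)
  finally show *: "mellin_integrable (\<lambda>x. exp (- x)) (Re s)"
    unfolding mellin_integrable_def set_integrable_def .
  have "((\<lambda>t. of_real (exp (-t)) * of_real t powr (s - 1) :: complex) has_integral mellin (\<lambda>x. exp (- x)) s) {0<..}"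
    unfolding mellin_def set_borel_integral_eq_integral(2)[OF int[OF assms]]
    by (rule integrable_integral) (rule set_borel_integral_eq_integral(1)[OF int[OF assms]])
  with Gamma_integral_complex'[OF assms] show "mellin (\<lambda>x. exp (- x)) s = Gamma s"
    unfolding e by (rule has_integral_unique[symmetric])
qed

lemma mellin_exp_scaled:
  assumes "Re s > 0" "k > 0"
  shows "mellin (\<lambda>x. exp (- k * x)) s = of_real k powr (- s) * Gamma s" "mellin_integrable (\<lambda>x. exp (- k * x)) (Re s)"
proof -
  have "mellin (\<lambda>x. exp (- (x / (1/k)))) s = of_real (1/k) powr s * Gamma s"
    using mellin_scale[of "1/k" "\<lambda>x. exp (- x)" s] assms mellin_exp(1)[OF assms(1)] by simp
  moreover have "of_real (1/k) powr s = (of_real k powr (- s) :: complex)"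
    using assms by (simp add: powr_def exp_minus Ln_of_real ln_div flip: of_real_divide)
  ultimately show "mellin (\<lambda>x. exp (- k * x)) s = of_real k powr (- s) * Gamma s"
    by (simp add: mult.commute)
  have "mellin_integrable (\<lambda>x. exp (- (x / (1/k)))) (Re s)"
    by (rule mellin_integrable_scale) (use assms mellin_exp in auto)
  thus "mellin_integrable (\<lambda>x. exp (- k * x)) (Re s)" by (simp add: mult.commute)
qed

text \<open>Domination for the derivative of h -> x^h at 0. From |exp z - 1| <= |z| exp |z| a factor
  |ln x| remains, absorbed by d |ln x| <= exp (d |ln x|), whence the exponent 2d; the sum of both
  powers covers x < 1 and x > 1 alike.\<close>

lemma norm_powr_quotient_le:
  fixes x d :: real and h :: complex
  assumes "x > 0" "norm h \<le> d" "d > 0" "h \<noteq> 0"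
  shows "norm ((of_real x powr h - 1) / h) \<le> (1/d) * (x powr (2*d) + x powr (-2*d))"
proof -
  define y where "y = \<bar>ln x\<bar>"
  have y: "y \<ge> 0" by (simp add: y_def)
  have "norm (of_real x powr h - 1) = norm (exp (h * of_real (ln x)) - 1)"
    using assms by (simp add: powr_def Ln_of_real)
  also have "\<dots> \<le> norm (h * of_real (ln x)) * exp (norm (h * of_real (ln x)))"
  proof -
    have "norm (exp z - 1) \<le> norm z * exp (norm z)" for z :: complex
      using field_differentiable_bound[of "cball 0 (norm z)" exp exp "exp (norm z)" 0 z]
      by (auto simp: DERIV_exp has_field_derivative_at_within norm_exp mult.commute norm_minus_commute
               intro!: order_trans[OF complex_Re_le_cmod])
    thus ?thesis .
  qed
  also have "\<dots> = norm h * (y * exp (norm h * y))" by (simp add: norm_mult y_def)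
  also have "\<dots> \<le> norm h * (((1/d) * exp (d * y)) * exp (d * y))"
  proof (intro mult_left_mono mult_mono)
    have "d * y \<le> exp (d * y)" using exp_ge_add_one_self[of "d*y"] by linarith
    thus "y \<le> (1/d) * exp (d * y)" using assms by (simp add: field_simps)
    show "exp (norm h * y) \<le> exp (d * y)" using assms y by (simp add: mult_right_mono)
  qed (use assms in auto)
  finally have *: "norm ((of_real x powr h - 1) / h) \<le> (1/d) * (exp (d*y) * exp (d*y))"
    using assms by (simp add: norm_divide field_simps)
  have "exp (d*y) * exp (d*y) = exp (2 * d * y)" by (simp flip: exp_add)
  also have "\<dots> \<le> x powr (2*d) + x powr (-2*d)"
    using assms by (auto simp: powr_def y_def abs_if)
  finally show ?thesis using * assms by (meson divide_nonneg_nonneg less_imp_le mult_left_mono order_trans zero_le_one)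
qed

lemma mellin_holomorphic:
  assumes "\<And>r. a < r \<Longrightarrow> r < b \<Longrightarrow> mellin_integrable f r"
  shows "mellin f holomorphic_on {s. a < Re s \<and> Re s < b}"
proof -
  have op: "open {s. a < Re s \<and> Re s < b}"
    by (intro open_Collect_conj open_halfspace_Re_gt open_halfspace_Re_lt)
  show ?thesis unfolding holomorphic_on_open[OF op]
  proof (intro ballI)
    fix s assume "s \<in> {s. a < Re s \<and> Re s < b}"
    hence s: "a < Re s" "Re s < b" by auto
    \<comment> \<open>A third of the distance to the boundary, so that the exponents Re s + 2d and
      Re s - 2d of the majorant \<open>?W\<close> stay inside the strip.\<close>
    define d where "d = min (Re s - a) (b - Re s) / 3"
    have d: "d > 0" "Re s + 2*d < b" "a < Re s - 2*d" proof -
      have "3 * d \<le> Re s - a" "3 * d \<le> b - Re s" by (auto simp: d_def)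
      thus "Re s + 2*d < b" "a < Re s - 2*d" using s by linarith+
    qed (use s in \<open>auto simp: d_def\<close>)
    let ?K = "\<lambda>s x. indicator {0<..} x *\<^sub>R (of_real (f x) * of_real x powr (s - 1) :: complex)"
    let ?D = "\<lambda>x. of_real (ln x) * ?K s x"
    have int: "integrable lborel (?K z)" if "a < Re z" "Re z < b" for z
      using mellin_integrand_integrable[OF assms[OF that]] unfolding set_integrable_def .
    have "((\<lambda>h. (mellin f (s + h) - mellin f s) / h) \<longlongrightarrow> integral\<^sup>L lborel ?D) (at 0)"
      unfolding tendsto_at_iff_sequentially
    proof (intro allI impI)
      fix X :: "nat \<Rightarrow> complex"
      assume X: "\<forall>i. X i \<in> UNIV - {0}" "X \<longlonglongrightarrow> 0"
      obtain N where N: "\<And>n. n \<ge> N \<Longrightarrow> norm (X n) < d"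
        using X(2) d(1) by (metis LIMSEQ_iff diff_zero)
      \<comment> \<open>Dropping the first N terms makes the domination hold for every
        index.\<close>
      define Y where "Y = (\<lambda>n. X (n + N))"
      have Y: "Y n \<noteq> 0" "norm (Y n) < d" for n using X(1) N by (auto simp: Y_def)
      have Yl: "Y \<longlonglongrightarrow> 0" unfolding Y_def using X(2) by (rule LIMSEQ_ignore_initial_segment)
      have re: "a < Re (s + Y n)" "Re (s + Y n) < b" for n
        using abs_Re_le_cmod[of "Y n"] Y(2)[of n] d by auto
      have q: "(?K (s + Y n) x - ?K s x) / Y n = ?K s x * ((of_real x powr Y n - 1) / Y n)" for n x
      proof -
        have "of_real x powr (s + Y n - 1) = (of_real x powr (s - 1) * of_real x powr Y n :: complex)"
          unfolding powr_add[symmetric] by (simp add: algebra_simps)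
        thus ?thesis by (simp add: scaleR_conv_of_real right_diff_distrib diff_divide_distrib)
      qed
      let ?W = "\<lambda>x. (1/d) * (norm (?K (s + of_real (2*d)) x) + norm (?K (s - of_real (2*d)) x))"
      have "(\<lambda>n. integral\<^sup>L lborel (\<lambda>x. (?K (s + Y n) x - ?K s x) / Y n)) \<longlonglongrightarrow> integral\<^sup>L lborel ?D"
      proof (rule integral_dominated_convergence[where w = ?W])
        have [measurable]: "?K z \<in> borel_measurable borel" for z
          by (rule mellin_integrand_measurable[OF assms[OF s]])
        show "?D \<in> borel_measurable lborel" by measurable
        show "(\<lambda>x. (?K (s + Y n) x - ?K s x) / Y n) \<in> borel_measurable lborel" for n by measurable
        show "integrable lborel ?W"
          by (intro integrable_mult_right Bochner_Integration.integrable_add integrable_norm int) (use d s in auto)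
        show "AE x in lborel. (\<lambda>n. (?K (s + Y n) x - ?K s x) / Y n) \<longlonglongrightarrow> ?D x"
        proof (rule AE_I2)
          fix x :: real
          show "(\<lambda>n. (?K (s + Y n) x - ?K s x) / Y n) \<longlonglongrightarrow> ?D x"
          proof (cases "x > 0")
            case True
            have "((\<lambda>h. of_real x powr h :: complex) has_field_derivative of_real (ln x)) (at 0)"
              using True by (auto intro!: derivative_eq_intros simp: powr_def Ln_of_real)
            hence "((\<lambda>h. (of_real x powr h - 1) / h :: complex) \<longlongrightarrow> of_real (ln x)) (at 0)"
              using True by (simp add: DERIV_def)
            hence "(\<lambda>n. (of_real x powr Y n - 1) / Y n :: complex) \<longlonglongrightarrow> of_real (ln x)"
              by (rule filterlim_compose) (use Yl Y in \<open>auto simp: filterlim_at\<close>)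
            from tendsto_mult[OF tendsto_const[of "?K s x"] this] show ?thesis
              unfolding q by (simp add: mult.commute)
          qed auto
        qed
        show "AE x in lborel. norm ((?K (s + Y n) x - ?K s x) / Y n) \<le> ?W x" for n
        proof (rule AE_I2)
          fix x :: real
          show "norm ((?K (s + Y n) x - ?K s x) / Y n) \<le> ?W x"
          proof (cases "x > 0")
            case True
            have "norm ((?K (s + Y n) x - ?K s x) / Y n) = norm (?K s x) * norm ((of_real x powr Y n - 1) / Y n)"
              unfolding q by (rule norm_mult)
            also have "\<dots> \<le> norm (?K s x) * ((1/d) * (x powr (2*d) + x powr (-2*d)))"
              using norm_powr_quotient_le[of x "Y n" d] True Y d(1) by (intro mult_left_mono) (auto simp: less_imp_le)
            also have "\<dots> = ?W x"
            proof -
              have "x powr (Re s - 1) * x powr (2*d) = x powr (Re s + 2*d - 1)"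
                   "x powr (Re s - 1) * x powr (-2*d) = x powr (Re s - 2*d - 1)"
                unfolding powr_add[symmetric] by (simp_all add: algebra_simps)
              thus ?thesis using True
                by (simp add: norm_mult norm_powr_real_powr distrib_left distrib_right mult_ac flip: mult.assoc)
            qed
            finally show ?thesis .
          qed auto
        qed
      qed
      moreover have "integral\<^sup>L lborel (\<lambda>x. (?K (s + Y n) x - ?K s x) / Y n) = (mellin f (s + Y n) - mellin f s) / Y n" for n
        using int[OF re[of n]] int[OF s] unfolding mellin_def set_lebesgue_integral_def by simp
      ultimately have "(\<lambda>n. (mellin f (s + Y n) - mellin f s) / Y n) \<longlonglongrightarrow> integral\<^sup>L lborel ?D"
        by (simp only:)
      hence "(\<lambda>n. (mellin f (s + X (n + N)) - mellin f s) / X (n + N)) \<longlonglongrightarrow> integral\<^sup>L lborel ?D"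
        unfolding Y_def .
      thus "((\<lambda>h. (mellin f (s + h) - mellin f s) / h) \<circ> X) \<longlonglongrightarrow> integral\<^sup>L lborel ?D"
        unfolding o_def by (rule LIMSEQ_offset)
    qed
    thus "\<exists>f'. (mellin f has_field_derivative f') (at s)"
      by (auto simp: DERIV_def)
  qed
qed

section \<open>Hasse series and analytic continuation of zeta\<close>

lemma holomorphic_suminf:
  fixes f :: "nat \<Rightarrow> complex \<Rightarrow> complex"
  assumes "open S" "\<And>n. f n holomorphic_on S"
    and "\<And>x. x \<in> S \<Longrightarrow> \<exists>r M. r > 0 \<and> cball x r \<subseteq> S \<and> summable M \<and> (\<forall>n. \<forall>y\<in>cball x r. norm (f n y) \<le> M n)"
  shows "(\<lambda>z. \<Sum>n. f n z) holomorphic_on S"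
proof (rule holomorphic_uniform_sequence[OF assms(1), where f = "\<lambda>N z. \<Sum>n<N. f n z"])
  show "(\<lambda>z. \<Sum>n<N. f n z) holomorphic_on S" for N
    by (intro holomorphic_intros assms)
  fix x assume "x \<in> S"
  from assms(3)[OF this] obtain r M where *: "r > 0" "cball x r \<subseteq> S" "summable M" "\<And>n y. y\<in>cball x r \<Longrightarrow> norm (f n y) \<le> M n"
    by blast
  show "\<exists>d>0. cball x d \<subseteq> S \<and> uniform_limit (cball x d) (\<lambda>N z. \<Sum>n<N. f n z) (\<lambda>z. \<Sum>n. f n z) sequentially"
    using * by (intro exI[of _ r] conjI Weierstrass_m_test[where M = M]) auto
qed

lemma mellin_of_real:
  "mellin f (of_real a) = of_real (LINT x:{0<..}|lborel. f x * x powr (a - 1))"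
proof -
  have "mellin f (of_real a) = (LINT x:{0<..}|lborel. of_real (f x * x powr (a - 1)))"
    unfolding mellin_def
    by (intro set_lebesgue_integral_cong) (use powr_of_real[of _ "a - 1"] in auto)
  thus ?thesis by (simp only: set_integral_complex_of_real)
qed

lemma mellin_shift: "mellin (\<lambda>x. x * f x) s = mellin f (s + 1)"
  unfolding mellin_def
  by (intro set_lebesgue_integral_cong) (auto simp: powr_diff powr_add)

lemma mellin_integrable_shift: "mellin_integrable (\<lambda>x. x * f x) a \<longleftrightarrow> mellin_integrable f (a + 1)"
  unfolding mellin_integrable_def
  by (intro set_integrable_cong) (auto simp: powr_diff powr_add)

lemma Re_pos_not_nonpos_Int: "Re s > 0 \<Longrightarrow> s \<notin> \<int>\<^sub>\<le>\<^sub>0"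
  by (auto elim!: nonpos_Ints_cases)

text \<open>
  For j = 0 these are, up to s := s - 1, the inner sums of the Hasse series. The shift j is what
  allows the recurrence \<open>fdiff_rec\<close> to move the bound from s + 1 to s without loss:
  the factor n is compensated by the extra power of n gained from j + 1.
\<close>
definition fdiff :: "nat \<Rightarrow> nat \<Rightarrow> complex \<Rightarrow> complex" where
  "fdiff n j s = (\<Sum>k\<le>n. (-1) ^ k * of_nat (n choose k) * of_nat (Suc (k + j)) powr (- s))"

text \<open>By the binomial expansion its Mellin transform at s is Gamma s times
  \<open>fdiff n j s\<close>. The cancellation in the alternating sum thus becomes the smallness of
  a positive integrand.\<close>

definition fdiff_kernel :: "nat \<Rightarrow> nat \<Rightarrow> real \<Rightarrow> real" where
  "fdiff_kernel n j t = exp (- real (Suc j) * t) * (1 - exp (- t)) ^ n"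

lemma fdiff_kernel_expand:
  "fdiff_kernel n j t = (\<Sum>k\<le>n. (-1) ^ k * real (n choose k) * exp (- real (Suc (k + j)) * t))"
proof -
  have "(1 - exp (- t)) ^ n = ((- exp (- t)) + 1) ^ n" by simp
  also have "\<dots> = (\<Sum>k\<le>n. real (n choose k) * (- exp (- t)) ^ k)"
    by (subst binomial_ring) simp
  also have "\<dots> = (\<Sum>k\<le>n. (-1) ^ k * real (n choose k) * exp (- real k * t))"
    by (intro sum.cong refl) (simp add: power_minus[of "exp _"] exp_of_nat_mult[symmetric])
  finally have "fdiff_kernel n j t = (\<Sum>k\<le>n. (-1) ^ k * real (n choose k) * (exp (- real k * t) * exp (- real (Suc j) * t)))"
    by (simp add: fdiff_kernel_def sum_distrib_left mult_ac)
  thus ?thesis by (simp add: exp_add[symmetric] algebra_simps)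
qed

lemma fdiff_kernel_nonneg: "t > 0 \<Longrightarrow> fdiff_kernel n j t \<ge> 0"
  by (simp add: fdiff_kernel_def)

lemma mellin_integrable_fdiff_kernel:
  assumes "a > 0"
  shows "mellin_integrable (fdiff_kernel n j) a"
proof -
  have "mellin_integrable (\<lambda>t. exp (- real (Suc (k + j)) * t)) a" for k
    using mellin_exp_scaled(2)[of "of_real a" "real (Suc (k + j))"] assms by simp
  thus ?thesis unfolding fdiff_kernel_expand[abs_def]
    by (intro mellin_integrable_sum mellin_integrable_cmult) auto
qed

lemma mellin_fdiff_kernel:
  assumes "Re s > 0"
  shows "mellin (fdiff_kernel n j) s = Gamma s * fdiff n j s"
proof -
  have "mellin (\<lambda>t. \<Sum>k\<le>n. (-1) ^ k * real (n choose k) * exp (- real (Suc (k + j)) * t)) s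
      = (\<Sum>k\<le>n. mellin (\<lambda>t. (-1) ^ k * real (n choose k) * exp (- real (Suc (k + j)) * t)) s)"
  proof (intro mellin_sum mellin_integrable_cmult)
    show "mellin_integrable (\<lambda>t. exp (- real (Suc (k + j)) * t)) (Re s)" for k
      by (rule mellin_exp_scaled(2)) (use assms in auto)
  qed auto
  also have "\<dots> = (\<Sum>k\<le>n. (-1) ^ k * of_nat (n choose k) * (of_nat (Suc (k + j)) powr (- s) * Gamma s))"
  proof (intro sum.cong refl)
    fix k
    have "mellin (\<lambda>t. exp (- real (Suc (k + j)) * t)) s = of_nat (Suc (k + j)) powr (- s) * Gamma s"
      using mellin_exp_scaled(1)[OF assms, of "real (Suc (k + j))"] by simp
    thus "mellin (\<lambda>t. (-1) ^ k * real (n choose k) * exp (- real (Suc (k + j)) * t)) s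
      = (-1) ^ k * of_nat (n choose k) * (of_nat (Suc (k + j)) powr (- s) * Gamma s)"
      by (subst mellin_cmult) simp
  qed
  finally show ?thesis
    by (simp add: fdiff_kernel_expand[abs_def] fdiff_def sum_distrib_left mult_ac)
qed

text \<open>The maximum lies at y = a; its factor exp(-a) is dropped.\<close>

lemma powr_mult_exp_le:
  fixes y a :: real
  assumes "y > 0" "a > 0"
  shows "y powr a * exp (- y) \<le> a powr a"
proof -
  have "ln (y / a) \<le> y / a - 1" using assms by (intro ln_le_minus_one) auto
  hence "a * ln y - y \<le> a * ln a" using assms by (simp add: ln_div field_simps)
  thus ?thesis using assms by (simp add: powr_def exp_add[symmetric])
qed

text \<open>With u = exp(-t) the kernel is u^(j+1) (1 - u)^n. A factor u^(1/2) is kept for decay in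
  t, and the remaining u^(j+1/2) is played against (1 - u)^n <= e exp(-(n + 1) u), which yields the
  power of n + 1. The factor e is the price of replacing n by n + 1.\<close>

lemma fdiff_kernel_le:
  fixes j :: nat
  assumes "t > 0"
  defines "a \<equiv> real j + 1/2"
  shows "fdiff_kernel n j t \<le> (exp 1 * a powr a) * real (Suc n) powr (- a) * exp (- (1/2) * t)"
proof -
  define u where "u = exp (- t)"
  have u: "0 < u" "u < 1" using assms(1) by (auto simp: u_def)
  have a: "a > 0" by (simp add: a_def)
  have "(1 - u) ^ n \<le> exp (- u) ^ n"
    using u exp_ge_add_one_self[of "-u"] by (intro power_mono) auto
  also have "\<dots> = exp (- real n * u)" by (simp add: exp_of_nat_mult[symmetric])
  also have "\<dots> \<le> exp (1 - real (Suc n) * u)" using u by (simp add: algebra_simps)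
  finally have 1: "(1 - u) ^ n \<le> exp 1 * exp (- (real (Suc n) * u))" by (simp add: exp_add[symmetric])
  have "(real (Suc n) * u) powr a * exp (- (real (Suc n) * u)) \<le> a powr a"
    using u a by (intro powr_mult_exp_le) auto
  hence 2: "u powr a * exp (- (real (Suc n) * u)) \<le> a powr a * real (Suc n) powr (- a)"
    using u by (simp add: powr_mult powr_minus divide_simps mult_ac del: of_nat_Suc)
  have "fdiff_kernel n j t = u powr (a + 1/2) * (1 - u) ^ n"
    by (simp add: fdiff_kernel_def u_def a_def powr_def algebra_simps)
  also have "\<dots> = u powr (1/2) * u powr a * (1 - u) ^ n" by (simp add: powr_add)
  also have "\<dots> \<le> u powr (1/2) * u powr a * (exp 1 * exp (- (real (Suc n) * u)))"
    by (intro mult_left_mono 1) auto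
  also have "\<dots> = u powr (1/2) * exp 1 * (u powr a * exp (- (real (Suc n) * u)))" by simp
  also have "\<dots> \<le> u powr (1/2) * exp 1 * (a powr a * real (Suc n) powr (- a))"
    by (intro mult_left_mono 2) auto
  also have "u powr (1/2) = exp (- (1/2) * t)" by (simp add: u_def powr_def)
  finally show ?thesis by (simp add: mult_ac)
qed

lemma fdiff_kernel_integral_le:
  fixes j :: nat
  assumes "b > 0"
  defines "a \<equiv> real j + 1/2"
  shows "(LINT x:{0<..}|lborel. \<bar>fdiff_kernel n j x\<bar> * x powr (b - 1)) \<le>
     (exp 1 * a powr a) * real (Suc n) powr (- a) * (2 powr b * Gamma b)"
proof -
  let ?C = "(exp 1 * a powr a) * real (Suc n) powr (- a)"
  have i: "mellin_integrable (\<lambda>x. exp (- (1/2) * x)) b"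
    using mellin_exp_scaled(2)[of "of_real b" "1/2"] assms by simp
  have "of_real (LINT x:{0<..}|lborel. exp (- (1/2) * x) * x powr (b - 1)) = (of_real (1/2) powr (- of_real b) * Gamma (of_real b) :: complex)"
    unfolding mellin_of_real[symmetric] using assms by (subst mellin_exp_scaled(1)) auto
  also have "\<dots> = of_real ((1/2) powr (- b) * Gamma b)"
    by (simp add: powr_of_real[symmetric] Gamma_complex_of_real)
  finally have e: "(LINT x:{0<..}|lborel. exp (- (1/2) * x) * x powr (b - 1)) = 2 powr b * Gamma b"
    unfolding of_real_eq_iff by (simp add: powr_minus powr_divide)
  have "(LINT x:{0<..}|lborel. \<bar>fdiff_kernel n j x\<bar> * x powr (b - 1)) \<le> (LINT x:{0<..}|lborel. ?C * (exp (- (1/2) * x) * x powr (b - 1)))"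
  proof (rule set_integral_mono)
    show "set_integrable lborel {0<..} (\<lambda>x. \<bar>fdiff_kernel n j x\<bar> * x powr (b - 1))"
      using mellin_integrable_abs[OF mellin_integrable_fdiff_kernel[OF assms(1)]] unfolding mellin_integrable_def .
    show "set_integrable lborel {0<..} (\<lambda>x. ?C * (exp (- (1/2) * x) * x powr (b - 1)))"
      using i unfolding mellin_integrable_def by (intro set_integrable_mult_right)
    fix x :: real assume "x \<in> {0<..}"
    hence x: "x > 0" by simp
    have "\<bar>fdiff_kernel n j x\<bar> \<le> ?C * exp (- (1/2) * x)"
      using fdiff_kernel_le[OF x, of n j] fdiff_kernel_nonneg[OF x, of n j] by (simp add: a_def)
    from mult_right_mono[OF this, of "x powr (b - 1)"]
    show "\<bar>fdiff_kernel n j x\<bar> * x powr (b - 1) \<le> ?C * (exp (- (1/2) * x) * x powr (b - 1))"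
      by (simp add: mult_ac)
  qed
  also have "\<dots> = ?C * (2 powr b * Gamma b)"
    by (subst set_integral_mult_right) (simp only: e)
  finally show ?thesis .
qed

text \<open>Split k + j + 1 as (j + 1) + k in (k+j+1)^(-s) = (k+j+1) (k+j+1)^(-(s+1)); the part with
  k is reindexed by k (n choose k) = n (n-1 choose k-1).\<close>

lemma fdiff_rec:
  "fdiff n j s = of_nat (Suc j) * fdiff n j (s + 1) - of_nat n * fdiff (n - 1) (Suc j) (s + 1)"
proof -
  let ?x = "\<lambda>k. of_nat (Suc (k + j)) powr (- (s + 1)) :: complex"
  have *: "of_nat (Suc (k + j)) powr (- s) = of_nat (Suc (k + j)) * ?x k" for k
  proof -
    have "- s = 1 + (- (s + 1))" by simp
    thus ?thesis by (metis powr_add powr_to_1 of_nat_eq_0_iff nat.simps(3))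
  qed
  have "fdiff n j s = (\<Sum>k\<le>n. (-1) ^ k * of_nat (n choose k) * (of_nat (Suc j) * ?x k + of_nat k * ?x k))"
    unfolding fdiff_def * by (simp add: algebra_simps)
  also have "\<dots> = of_nat (Suc j) * fdiff n j (s + 1) + (\<Sum>k\<le>n. (-1) ^ k * of_nat (k * (n choose k)) * ?x k)"
    unfolding fdiff_def by (simp add: sum_distrib_left sum.distrib distrib_left mult_ac)
  also have "(\<Sum>k\<le>n. (-1) ^ k * of_nat (k * (n choose k)) * ?x k) = - of_nat n * fdiff (n - 1) (Suc j) (s + 1)"
  proof (cases n)
    case (Suc m)
    have "(\<Sum>k\<le>n. (-1) ^ k * of_nat (k * (n choose k)) * ?x k)
        = (\<Sum>k\<le>m. (-1) ^ Suc k * of_nat (Suc k * (Suc m choose Suc k)) * ?x (Suc k))"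
      unfolding Suc by (subst sum.atMost_Suc_shift) simp
    also have "\<dots> = (\<Sum>k\<le>m. - of_nat (Suc m) * ((-1) ^ k * of_nat (m choose k) * of_nat (Suc (k + Suc j)) powr (- (s + 1))))"
      unfolding Suc_times_binomial of_nat_mult by (intro sum.cong refl) (simp add: mult_ac del: of_nat_Suc)
    also have "\<dots> = - of_nat n * fdiff (n - 1) (Suc j) (s + 1)"
      unfolding fdiff_def Suc by (simp add: sum_distrib_left sum_negf)
    finally show ?thesis .
  qed simp
  finally show ?thesis by simp
qed

text \<open>The case m = 0 comes from the Mellin integral, which converges there. Each further unit
  to the left uses \<open>fdiff_rec\<close>, which looks at s + 1 and at index j + 1; hence j and R
  are generalised in the induction.\<close>

lemma fdiff_bound_halfplane:
  "\<exists>C. \<forall>n s. Re s \<ge> 1/2 - real m \<and> norm s \<le> R \<longrightarrow> norm (fdiff n j s) \<le> C * real (Suc n) powr (- (real j + 1/2))"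
proof (induction m arbitrary: j R)
  case 0
  define a where "a = real j + 1/2"
  \<comment> \<open>rGamma is entire, hence bounded on the disc, so dividing by Gamma s costs only a
    constant.\<close>
  have "compact (rGamma ` cball 0 R :: complex set)"
    by (intro compact_continuous_image continuous_intros) auto
  hence "bounded (rGamma ` cball 0 R :: complex set)" by (rule compact_imp_bounded)
  then obtain A where A: "A > 0" "\<And>s. norm s \<le> R \<Longrightarrow> norm (rGamma s :: complex) \<le> A"
    unfolding bounded_pos by auto
  have "compact ((\<lambda>b. 2 powr b * Gamma b :: real) ` {1/2..R})"
    by (intro compact_continuous_image continuous_intros) (auto elim!: nonpos_Ints_cases)
  hence "bounded ((\<lambda>b. 2 powr b * Gamma b :: real) ` {1/2..R})" by (rule compact_imp_bounded)
  then obtain B where B: "B > 0" "\<And>b. b \<in> {1/2..R} \<Longrightarrow> norm (2 powr b * Gamma b :: real) \<le> B"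
    unfolding bounded_pos by blast
  let ?K = "exp 1 * a powr a"
  show ?case
  proof (intro exI allI impI)
    fix n s assume s: "Re s \<ge> 1/2 - real 0 \<and> norm s \<le> R"
    hence s': "Re s > 0" by auto
    have b: "Re s \<in> {1/2..R}" using s complex_Re_le_cmod[of s] by auto
    have "fdiff n j s = rGamma s * mellin (fdiff_kernel n j) s"
      using mellin_fdiff_kernel[OF s', of n j] Gamma_nonzero[OF Re_pos_not_nonpos_Int[OF s']]
      by (simp add: rGamma_inverse_Gamma)
    hence "norm (fdiff n j s) = norm (rGamma s) * norm (mellin (fdiff_kernel n j) s)"
      by (simp add: norm_mult)
    also have "\<dots> \<le> A * (?K * real (Suc n) powr (- a) * B)"
    proof (intro mult_mono)
      have "norm (mellin (fdiff_kernel n j) s) \<le> ?K * real (Suc n) powr (- a) * (2 powr Re s * Gamma (Re s))"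
        using norm_mellin_le[OF mellin_integrable_fdiff_kernel[OF s'], of n j]
          fdiff_kernel_integral_le[OF s', where n = n and j = j] by (simp add: a_def)
      also have "\<dots> \<le> ?K * real (Suc n) powr (- a) * B"
        using B(2)[OF b] by (intro mult_left_mono) auto
      finally show "norm (mellin (fdiff_kernel n j) s) \<le> ?K * real (Suc n) powr (- a) * B" .
    qed (use A s in auto)
    finally show "norm (fdiff n j s) \<le> (A * ?K * B) * real (Suc n) powr (- (real j + 1/2))"
      by (simp add: a_def mult_ac)
  qed
next
  case (Suc m)
  from Suc.IH[of "R + 1" j] obtain C1 where C1: "\<And>n s. Re s \<ge> 1/2 - real m \<Longrightarrow> norm s \<le> R + 1 \<Longrightarrow> norm (fdiff n j s) \<le> C1 * real (Suc n) powr (- (real j + 1/2))"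
    by blast
  from Suc.IH[of "R + 1" "Suc j"] obtain C2 where C2: "\<And>n s. Re s \<ge> 1/2 - real m \<Longrightarrow> norm s \<le> R + 1 \<Longrightarrow> norm (fdiff n (Suc j) s) \<le> C2 * real (Suc n) powr (- (real (Suc j) + 1/2))"
    by blast
  define a where "a = real j + 1/2"
  show ?case
  proof (intro exI allI impI)
    fix n s assume s: "Re s \<ge> 1/2 - real (Suc m) \<and> norm s \<le> R"
    have s1: "Re (s + 1) \<ge> 1/2 - real m" "norm (s + 1) \<le> R + 1"
      using s norm_triangle_ineq[of s 1] by auto
    have "norm (of_nat n * fdiff (n - 1) (Suc j) (s + 1)) \<le> (\<bar>C2\<bar> * 2 powr a) * real (Suc n) powr (- a)"
    proof (cases n)
      case (Suc k)
      have n: "real n > 0" by (simp add: Suc)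
      have "norm (of_nat n * fdiff (n - 1) (Suc j) (s + 1)) \<le> real n * (\<bar>C2\<bar> * real n powr (- (a + 1)))"
        unfolding norm_mult norm_of_nat
      proof (intro mult_left_mono)
        have "norm (fdiff k (Suc j) (s + 1)) \<le> C2 * real (Suc k) powr (- (real (Suc j) + 1/2))"
          by (rule C2[OF s1])
        also have "\<dots> \<le> \<bar>C2\<bar> * real (Suc k) powr (- (real (Suc j) + 1/2))"
          by (intro mult_right_mono) auto
        finally show "norm (fdiff (n - 1) (Suc j) (s + 1)) \<le> \<bar>C2\<bar> * real n powr (- (a + 1))"
          by (simp add: Suc a_def add_ac)
      qed auto
      also have "\<dots> = \<bar>C2\<bar> * real n powr (- a)"
        using n by (simp add: powr_diff powr_minus field_simps powr_add)
      \<comment> \<open>The factor 2^a comes from n >= (n + 1)/2 for n >= 1.\<close>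
      also have "real n powr (- a) \<le> (real (Suc n) / 2) powr (- a)"
        by (intro powr_mono2') (auto simp: a_def Suc)
      also have "\<dots> = 2 powr a * real (Suc n) powr (- a)"
        by (simp add: powr_divide powr_minus field_simps)
      finally show ?thesis by (simp only: mult.assoc) (simp add: mult_left_mono)
    qed auto
    moreover have "norm (of_nat (Suc j) * fdiff n j (s + 1)) \<le> (real (Suc j) * C1) * real (Suc n) powr (- a)"
      using mult_left_mono[OF C1[OF s1, of n], of "real (Suc j)"] by (simp add: norm_mult a_def mult_ac del: of_nat_Suc)
    ultimately have "norm (fdiff n j s) \<le> (real (Suc j) * C1) * real (Suc n) powr (- a) + (\<bar>C2\<bar> * 2 powr a) * real (Suc n) powr (- a)"
      unfolding fdiff_rec[of n j s] by (intro order_trans[OF norm_triangle_ineq4] add_mono)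
    thus "norm (fdiff n j s) \<le> (real (Suc j) * C1 + \<bar>C2\<bar> * 2 powr a) * real (Suc n) powr (- (real j + 1/2))"
      by (simp add: distrib_right a_def)
  qed
qed

lemma fdiff_bound:
  "\<exists>C. \<forall>n s. norm s \<le> R \<longrightarrow> norm (fdiff n j s) \<le> C * real (Suc n) powr (- (real j + 1/2))"
proof -
  obtain m where m: "real m \<ge> R + 1/2" using real_arch_simple by blast
  from fdiff_bound_halfplane[of m R j] obtain C where
    C: "\<And>n s. Re s \<ge> 1/2 - real m \<Longrightarrow> norm s \<le> R \<Longrightarrow> norm (fdiff n j s) \<le> C * real (Suc n) powr (- (real j + 1/2))"
    by blast
  have "Re s \<ge> 1/2 - real m" if "norm s \<le> R" for s
    using m that abs_Re_le_cmod[of s] by linarith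
  thus ?thesis using C by blast
qed

text \<open>This is (s - 1) zeta(s), an entire function with value 1 at s = 1. As
  \<open>zeta 1\<close> is 0 by convention, absence of zeros is expressed through this function
  throughout.\<close>

definition zeta_reg :: "complex \<Rightarrow> complex" where
  "zeta_reg s = (\<Sum>n. fdiff n 0 (s - 1) / of_nat (Suc n))"

lemma zeta_eq: "zeta s = zeta_reg s / (s - 1)"
  unfolding zeta_def zeta_reg_def fdiff_def by simp

lemma zeta_reg_term_bound:
  "\<exists>C. \<forall>n s. norm s \<le> R \<longrightarrow> norm (fdiff n 0 (s - 1) / of_nat (Suc n)) \<le> C * real (Suc n) powr (- (3/2))"
proof -
  from fdiff_bound[of "R + 1" 0] obtain C where C: "\<And>n s. norm s \<le> R + 1 \<Longrightarrow> norm (fdiff n 0 s) \<le> C * real (Suc n) powr (- (1/2))"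
    by auto
  show ?thesis
  proof (intro exI allI impI)
    fix n and s :: complex assume "norm s \<le> R"
    hence "norm (s - 1) \<le> R + 1" using norm_triangle_ineq4[of s 1] by simp
    have *: "real (Suc n) powr (- (1/2)) / real (Suc n) = real (Suc n) powr (- (1/2) - 1)"
      by (subst powr_diff) simp
    from C[OF \<open>norm (s - 1) \<le> R + 1\<close>, of n] have "norm (fdiff n 0 (s - 1) / of_nat (Suc n)) \<le> C * real (Suc n) powr (- (1/2)) / real (Suc n)"
      by (simp add: norm_divide divide_right_mono del: of_nat_Suc)
    also have "C * real (Suc n) powr (- (1/2)) / real (Suc n) = C * (real (Suc n) powr (- (1/2)) / real (Suc n))"
      by simp
    also note *
    finally show "norm (fdiff n 0 (s - 1) / of_nat (Suc n)) \<le> C * real (Suc n) powr (- (3/2))"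
      by simp
  qed
qed

lemma summable_Suc_powr: "a > 1 \<Longrightarrow> summable (\<lambda>n. real (Suc n) powr (- a))"
  by (subst summable_Suc_iff) (simp add: summable_real_powr_iff)

lemma holomorphic_zeta_reg: "zeta_reg holomorphic_on UNIV"
  unfolding zeta_reg_def[abs_def]
proof (rule holomorphic_suminf)
  show "(\<lambda>s. fdiff n 0 (s - 1) / of_nat (Suc n)) holomorphic_on UNIV" for n
    unfolding fdiff_def by (intro holomorphic_intros) (auto simp del: of_nat_Suc)
  fix x :: complex
  from zeta_reg_term_bound[of "norm x + 1"] obtain C where
    C: "\<And>n s. norm s \<le> norm x + 1 \<Longrightarrow> norm (fdiff n 0 (s - 1) / of_nat (Suc n)) \<le> C * real (Suc n) powr (- (3/2))"
    by blast
  have "norm y \<le> norm x + 1" if "y \<in> cball x 1" for y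
    using that norm_triangle_sub[of y x] by (simp add: dist_norm norm_minus_commute)
  thus "\<exists>r M. r > 0 \<and> cball x r \<subseteq> UNIV \<and> summable M \<and> (\<forall>n. \<forall>y\<in>cball x r. norm (fdiff n 0 (y - 1) / of_nat (Suc n)) \<le> M n)"
    using C by (intro exI[of _ 1] exI[of _ "\<lambda>n. C * real (Suc n) powr (- (3/2))"] conjI summable_mult summable_Suc_powr) auto
qed auto

lemma holomorphic_zeta_reg' [holomorphic_intros]:
  "f holomorphic_on A \<Longrightarrow> (\<lambda>x. zeta_reg (f x)) holomorphic_on A"
  using holomorphic_on_compose_gen[OF _ holomorphic_zeta_reg, of f A] by (simp add: o_def)

lemma continuous_on_zeta_reg [continuous_intros]:
  "continuous_on A f \<Longrightarrow> continuous_on A (\<lambda>x. zeta_reg (f x))"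
  using continuous_on_compose2[OF holomorphic_on_imp_continuous_on[OF holomorphic_zeta_reg], of A f] by simp

lemma fdiff_at_0: "fdiff n j 0 = (if n = 0 then 1 else 0)"
proof -
  have "of_nat (Suc k) powr (0::complex) = 1" for k by (simp add: powr_def del: of_nat_Suc)
  thus ?thesis
    using choose_alternating_sum[of n, where 'a = complex]
    by (cases "n = 0") (auto simp: fdiff_def simp del: of_nat_Suc)
qed

lemma zeta_reg_1: "zeta_reg 1 = 1"
proof -
  have "zeta_reg 1 = (\<Sum>n. if n = 0 then 1 else 0)"
    unfolding zeta_reg_def by (intro suminf_cong) (simp add: fdiff_at_0)
  also have "\<dots> = 1" by (subst suminf_finite[of "{0}"]) auto
  finally show ?thesis .
qed

section \<open>Agreement with the Dirichlet series for Re s > 1\<close>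

lemma summable_nat_powr:
  assumes "Re s > 1"
  shows "summable (\<lambda>k. norm (of_nat (Suc k) powr (- s) :: complex))" "summable (\<lambda>k. of_nat (Suc k) powr (- s) :: complex)"
proof -
  have "norm (of_nat (Suc k) powr (- s) :: complex) = real (Suc k) powr (- Re s)" for k
    using norm_powr_real_powr[of "of_nat (Suc k)" "- s"] by (simp del: of_nat_Suc)
  thus "summable (\<lambda>k. norm (of_nat (Suc k) powr (- s) :: complex))"
    using summable_Suc_powr[OF assms] by (simp del: of_nat_Suc)
  thus "summable (\<lambda>k. of_nat (Suc k) powr (- s) :: complex)" by (rule summable_norm_cancel)
qed

text \<open>Expand 1 / (exp t - 1) as the geometric series of exp(-(k + 1) t) and transform term by
  term.\<close>

lemma mellin_bose:
  assumes "Re s > 1"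
  shows "mellin (\<lambda>t. 1 / (exp t - 1)) s = Gamma s * (\<Sum>k. of_nat (Suc k) powr (- s))"
    "mellin_integrable (\<lambda>t. 1 / (exp t - 1)) (Re s)"
proof -
  let ?f = "\<lambda>k t. exp (- real (Suc k) * t)"
  have s: "Re s > 0" using assms by simp
  have sums: "(\<lambda>k. ?f k t) sums (1 / (exp t - 1))" if "t > 0" for t
  proof -
    have "(\<lambda>k. exp (- t) * exp (- t) ^ k) sums (exp (- t) * (1 / (1 - exp (- t))))"
      using that by (intro sums_mult geometric_sums) auto
    also have "exp (- t) * (1 / (1 - exp (- t))) = 1 / (exp t - 1)"
      using that by (simp add: exp_minus field_simps)
    also have "(\<lambda>k. exp (- t) * exp (- t) ^ k) = (\<lambda>k. ?f k t)"
      by (simp add: exp_of_nat_mult[symmetric] exp_add[symmetric] algebra_simps)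
    finally show ?thesis .
  qed
  have i: "mellin_integrable (?f k) (Re s)" for k
    by (rule mellin_exp_scaled(2)[OF s]) simp
  have summ: "summable (\<lambda>k. \<bar>?f k t\<bar>)" if "t > 0" for t
    using sums_summable[OF sums[OF that]] by simp
  have e: "(LINT x:{0<..}|lborel. \<bar>?f k x\<bar> * x powr (Re s - 1)) = real (Suc k) powr (- Re s) * Gamma (Re s)" for k
  proof -
    have "of_real (LINT x:{0<..}|lborel. ?f k x * x powr (Re s - 1)) = (of_real (real (Suc k)) powr (- of_real (Re s)) * Gamma (of_real (Re s)) :: complex)"
      unfolding mellin_of_real[symmetric] using s by (subst mellin_exp_scaled(1)) auto
    also have "\<dots> = of_real (real (Suc k) powr (- Re s) * Gamma (Re s))"
      by (simp add: powr_of_real[symmetric] Gamma_complex_of_real del: of_nat_Suc)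
    finally show ?thesis unfolding of_real_eq_iff by simp
  qed
  have sm: "summable (\<lambda>k. LINT x:{0<..}|lborel. \<bar>?f k x\<bar> * x powr (Re s - 1))"
    unfolding e by (intro summable_mult2 summable_Suc_powr assms)
  note * = mellin_sums[OF i summ sm]
  have eq: "(\<Sum>k. ?f k t) = 1 / (exp t - 1)" if "t > 0" for t using sums[OF that] by (simp add: sums_iff)
  have "(\<lambda>k. of_nat (Suc k) powr (- s) * Gamma s) sums mellin (\<lambda>t. 1 / (exp t - 1)) s"
  proof -
    have "mellin (?f k) s = of_nat (Suc k) powr (- s) * Gamma s" for k
      using mellin_exp_scaled(1)[OF s, of "real (Suc k)"] by simp
    thus ?thesis using *(1) mellin_cong[OF eq, where s = s] by (simp only:)
  qed
  thus "mellin (\<lambda>t. 1 / (exp t - 1)) s = Gamma s * (\<Sum>k. of_nat (Suc k) powr (- s))"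
    using suminf_mult2[OF summable_nat_powr(2)[OF assms], of "Gamma s"] by (simp add: sums_iff mult.commute)
  show "mellin_integrable (\<lambda>t. 1 / (exp t - 1)) (Re s)"
    using *(2) mellin_integrable_cong[OF eq, where a = "Re s"] by (simp only:)
qed

text \<open>With u = exp(-t), the logarithmic series sums (1 - u)^(n+1) / (n + 1) to -ln u = t, and
  the remaining factor u / (1 - u) is 1 / (exp t - 1). This ties the Hasse weights 1/(n + 1) to the
  Bose kernel of \<open>mellin_bose\<close>.\<close>

lemma fdiff_kernel_sums:
  assumes "t > 0"
  shows "(\<lambda>n. fdiff_kernel n 0 t / real (Suc n)) sums (t * (1 / (exp t - 1)))"
proof -
  define u where "u = exp (- t)"
  have u: "0 < u" "u < 1" using assms by (auto simp: u_def)
  have sm: "summable (\<lambda>n. (1 - u) ^ Suc n / real (Suc n))"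
  proof (rule summable_comparison_test')
    show "summable (\<lambda>n. (1 - u) ^ Suc n)" using u by (subst summable_Suc_iff) (simp add: summable_geometric)
    show "norm ((1 - u) ^ Suc n / real (Suc n)) \<le> (1 - u) ^ Suc n" if "n \<ge> 0" for n
      using u by (simp add: divide_le_eq power_le_one mult_le_cancel_left1 del: power_Suc)
  qed
  have "ln u = (\<Sum>n. (-1) ^ n * (1 / real (n + 1)) * (u - 1) ^ Suc n)"
    using u by (intro ln_series) auto
  also have "(\<lambda>n. (-1) ^ n * (1 / real (n + 1)) * (u - 1) ^ Suc n) = (\<lambda>n. - ((1 - u) ^ Suc n / real (Suc n)))"
  proof
    fix n
    have "(u - 1) ^ Suc n = (-1) ^ Suc n * (1 - u) ^ Suc n"
      by (metis minus_diff_eq power_minus)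
    thus "(-1) ^ n * (1 / real (n + 1)) * (u - 1) ^ Suc n = - ((1 - u) ^ Suc n / real (Suc n))"
      by (simp add: mult.assoc[symmetric] flip: power_add)
  qed
  also have "(\<Sum>n. - ((1 - u) ^ Suc n / real (Suc n))) = - (\<Sum>n. (1 - u) ^ Suc n / real (Suc n))"
    using sm by (rule suminf_minus)
  finally have "(\<lambda>n. (1 - u) ^ Suc n / real (Suc n)) sums t"
    using sm by (simp add: u_def sums_iff)
  hence "(\<lambda>n. u / (1 - u) * ((1 - u) ^ Suc n / real (Suc n))) sums (u / (1 - u) * t)"
    by (rule sums_mult)
  also have "(\<lambda>n. u / (1 - u) * ((1 - u) ^ Suc n / real (Suc n))) = (\<lambda>n. fdiff_kernel n 0 t / real (Suc n))"
    using u by (simp add: fun_eq_iff fdiff_kernel_def u_def)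
  also have "u / (1 - u) * t = t * (1 / (exp t - 1))"
    using assms by (simp add: u_def exp_minus field_simps)
  finally show ?thesis .
qed

text \<open>Both sides come from one transform: that of t / (exp t - 1) at s - 1 is Gamma(s - 1)
  times the Hasse series by \<open>fdiff_kernel_sums\<close>, and, after shifting by the factor t,
  Gamma(s) times the Dirichlet series. Then Gamma(s) = (s - 1) Gamma(s - 1) supplies the factor s -
  1.\<close>

lemma zeta_reg_eq_series:
  assumes "Re s > 1"
  shows "zeta_reg s = (s - 1) * (\<Sum>k. of_nat (Suc k) powr (- s))"
proof -
  let ?f = "\<lambda>n t. fdiff_kernel n 0 t / real (Suc n)"
  have s1: "Re (s - 1) > 0" using assms by simp
  have i: "mellin_integrable (?f n) (Re (s - 1))" for n
    using mellin_integrable_cmult[OF mellin_integrable_fdiff_kernel[OF s1], of "1 / real (Suc n)" n 0] by (simp del: of_nat_Suc)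
  have summ: "summable (\<lambda>n. \<bar>?f n t\<bar>)" if "t > 0" for t
    using sums_summable[OF fdiff_kernel_sums[OF that]] fdiff_kernel_nonneg[OF that] by (simp del: of_nat_Suc)
  have sm: "summable (\<lambda>n. LINT x:{0<..}|lborel. \<bar>?f n x\<bar> * x powr (Re (s - 1) - 1))"
  proof (rule summable_comparison_test')
    define b where "b = Re (s - 1)"
    define C where "C = exp 1 * (1/2) powr (1/2) * (2 powr b * Gamma b)"
    show "summable (\<lambda>n. C * real (Suc n) powr (- (3/2)))" by (intro summable_mult summable_Suc_powr) auto
    fix n :: nat
    have "(LINT x:{0<..}|lborel. \<bar>?f n x\<bar> * x powr (b - 1)) = (LINT x:{0<..}|lborel. \<bar>fdiff_kernel n 0 x\<bar> * x powr (b - 1)) / real (Suc n)"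
      by (subst set_integral_divide_zero[symmetric]) (simp add: abs_divide del: of_nat_Suc)
    also have "\<dots> \<le> (exp 1 * (real 0 + 1/2) powr (real 0 + 1/2) * real (Suc n) powr (- (real 0 + 1/2)) * (2 powr b * Gamma b)) / real (Suc n)"
      using s1 by (intro divide_right_mono fdiff_kernel_integral_le) (auto simp: b_def)
    also have "\<dots> = C * (real (Suc n) powr (- (1/2)) / real (Suc n))" by (simp add: C_def)
    also have "real (Suc n) powr (- (1/2)) / real (Suc n) = real (Suc n) powr (- (1/2) - 1)"
      by (subst powr_diff) simp
    finally have "(LINT x:{0<..}|lborel. \<bar>?f n x\<bar> * x powr (b - 1)) \<le> C * real (Suc n) powr (- (3/2))" by simp
    moreover have "(LINT x:{0<..}|lborel. \<bar>?f n x\<bar> * x powr (b - 1)) \<ge> 0"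
      unfolding set_lebesgue_integral_def by (intro integral_nonneg_AE) (auto simp: indicator_def)
    ultimately show "norm (LINT x:{0<..}|lborel. \<bar>?f n x\<bar> * x powr (Re (s - 1) - 1)) \<le> C * real (Suc n) powr (- (3/2))"
      by (simp add: b_def)
  qed
  have eq: "(\<Sum>n. ?f n t) = t * (1 / (exp t - 1))" if "t > 0" for t
    using fdiff_kernel_sums[OF that] by (simp add: sums_iff)
  have mf: "mellin (?f n) (s - 1) = Gamma (s - 1) * (fdiff n 0 (s - 1) / of_nat (Suc n))" for n
    using mellin_cmult[of "1 / real (Suc n)" "fdiff_kernel n 0" "s - 1"] mellin_fdiff_kernel[OF s1, of n 0]
    by (simp del: of_nat_Suc)
  have "(\<lambda>n. mellin (?f n) (s - 1)) sums mellin (\<lambda>t. t * (1 / (exp t - 1))) (s - 1)"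
    using mellin_sums(1)[OF i summ sm] mellin_cong[OF eq, where s = "s - 1"] by (simp only:)
  also have "mellin (\<lambda>t. t * (1 / (exp t - 1))) (s - 1) = mellin (\<lambda>t. 1 / (exp t - 1)) s"
    by (subst mellin_shift) simp
  also have "\<dots> = Gamma s * (\<Sum>k. of_nat (Suc k) powr (- s))" by (rule mellin_bose(1)[OF assms])
  also have "Gamma s = Gamma (s - 1) * (s - 1)"
    using Gamma_plus1[OF Re_pos_not_nonpos_Int[OF s1]] by (simp add: mult.commute)
  finally have *: "(\<lambda>n. Gamma (s - 1) * (fdiff n 0 (s - 1) / of_nat (Suc n))) sums
      (Gamma (s - 1) * ((s - 1) * (\<Sum>k. of_nat (Suc k) powr (- s))))"
    unfolding mf by (simp add: mult.assoc)
  have nz: "Gamma (s - 1) \<noteq> 0" by (rule Gamma_nonzero[OF Re_pos_not_nonpos_Int[OF s1]])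
  from sums_mult_D[OF * nz] show ?thesis unfolding zeta_reg_def by (simp add: sums_iff nz)
qed

section \<open>The functional equation\<close>

text \<open>Differentiate both sides of Gamma(z) Gamma(1 - z) = pi / sin(pi z).\<close>

lemma Digamma_reflection:
  fixes z :: complex
  assumes "z \<notin> \<int>"
  shows "Digamma (1 - z) - Digamma z = pi * cos (pi * z) / sin (pi * z)"
proof -
  have z: "z \<notin> \<int>\<^sub>\<le>\<^sub>0" "1 - z \<notin> \<int>\<^sub>\<le>\<^sub>0"
    using assms nonpos_Ints_subset_Ints Ints_diff[OF Ints_1, of "1 - z"] by auto
  have sn: "sin (of_real pi * z) \<noteq> 0"
    using assms by (auto simp: sin_eq_0)
  have op: "open (- \<int> :: complex set)" by (simp add: open_Compl)
  have 1: "((\<lambda>w. Gamma w * Gamma (1 - w)) has_field_derivative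
          (Gamma z * Gamma (1 - z) * (Digamma z - Digamma (1 - z)))) (at z)"
    using z by (auto intro!: derivative_eq_intros simp: algebra_simps)
  have eq: "Gamma w * Gamma (1 - w) = of_real pi / sin (of_real pi * w)" for w :: complex
    by (rule Gamma_reflection_complex)
  have 2: "((\<lambda>w. of_real pi / sin (of_real pi * w)) has_field_derivative
          (- of_real pi * (of_real pi * cos (of_real pi * z)) / (sin (of_real pi * z))\<^sup>2)) (at z)"
    using sn by (auto intro!: derivative_eq_intros simp: power2_eq_square)
  have eq': "of_real pi / sin (of_real pi * z) * (Digamma z - Digamma (1 - z)) =
      - of_real pi * (of_real pi * cos (of_real pi * z)) / (sin (of_real pi * z))\<^sup>2"
    using DERIV_unique[OF 1[unfolded eq] 2] .
  have "Digamma z - Digamma (1 - z) = - (of_real pi * cos (of_real pi * z) / sin (of_real pi * z))"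
  proof -
    have *: "d = - (p * C / S)" if "p / S * d = - p * (p * C) / S\<^sup>2" "S \<noteq> 0" "p \<noteq> 0" for p S C d :: complex
    proof -
      have "d = (p / S * d) * (S / p)" using that(2,3) by simp
      also have "\<dots> = - p * (p * C) / S\<^sup>2 * (S / p)" by (simp only: that(1))
      also have "\<dots> = - (p * C / S)" using that(2,3) by (simp add: power2_eq_square)
      finally show ?thesis .
    qed
    show ?thesis by (rule *[OF eq' sn]) simp
  qed
  thus ?thesis by (metis minus_diff_eq minus_minus)
qed

text \<open>The Digamma series at 1 - z and 1 + z differ by partial fractions with poles at the
  nonzero integers, and the reflection formula evaluates the difference as pi cot(pi z) - 1/z. At
  imaginary z this is the expansion of coth(x / 2) / 2, that is, of 1 / (exp x - 1) + 1/2.\<close>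

lemma bose_partial_fraction:
  fixes x :: real
  assumes "x > 0"
  shows "(\<lambda>n. 2 * x / (x\<^sup>2 + (2 * pi * real (Suc n))\<^sup>2)) sums (1 / (exp x - 1) - 1 / x + 1 / 2)"
proof -
  \<comment> \<open>This scaling makes pi z = i x / 2, so that sine and cosine become exponentials
    of x / 2 and of -x / 2.\<close>
  define y where "y = x / (2 * pi)"
  have y: "y > 0" using assms by (simp add: y_def)
  define z :: complex where "z = \<i> * of_real y"
  have zn: "z \<noteq> 0" "1 + z \<noteq> 0" "1 - z \<noteq> 0" using y by (auto simp: z_def complex_eq_iff)
  have zi: "z \<notin> \<int>" using y by (auto simp: z_def complex_eq_iff elim!: Ints_cases)
  have D: "(\<lambda>n. inverse (of_nat (Suc n)) - inverse (w + of_nat n)) sums (Digamma w + euler_mascheroni)"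
    if "w \<noteq> 0" for w :: complex
    using summable_sums[OF summable_Digamma[OF that]] by (simp add: Digamma_def)
  from sums_diff[OF D[OF zn(3)] D[OF zn(2)]]
  have s1: "(\<lambda>n. inverse (1 + z + of_nat n) - inverse (1 - z + of_nat n)) sums (Digamma (1 - z) - Digamma (1 + z))"
    by simp
  \<comment> \<open>Passing from 1 + z to z by \<open>Digamma_plus1\<close> produces the term 1/z,
    which becomes the 1/x of the statement.\<close>
  have "Digamma (1 - z) - Digamma (1 + z) = of_real pi * cos (of_real pi * z) / sin (of_real pi * z) - 1 / z"
    using Digamma_reflection[OF zi] Digamma_plus1[OF zn(1)] by (simp add: add.commute algebra_simps)
  also have "of_real pi * cos (of_real pi * z) / sin (of_real pi * z) = - \<i> * of_real (pi * (exp x + 1) / (exp x - 1))"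
  proof -
    have p: "of_real pi * z = \<i> * of_real (x / 2)" by (simp add: z_def y_def)
    define e where "e = exp (x / 2)"
    have e: "e > 1" using assms by (simp add: e_def)
    have e2: "exp x = e * e" by (simp add: e_def flip: exp_add)
    have em: "exp (\<i> * (of_real pi * z)) = of_real (1 / e)" "exp (- (\<i> * (of_real pi * z))) = of_real e"
      unfolding p e_def by (simp_all add: exp_minus exp_of_real[symmetric] field_simps flip: mult.assoc)
    have c: "cos (of_real pi * z) = of_real (1 / e + e) / 2"
      unfolding cos_exp_eq em by simp
    have s: "sin (of_real pi * z) = of_real (1 / e - e) / (2 * \<i>)"
      unfolding sin_exp_eq em by simp
    have "1 / e - e \<noteq> 0" "e * e - 1 \<noteq> 0" using e by (auto simp: field_simps) (smt (verit) mult_less_cancel_left1)+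
    hence *: "(1 / e + e) / (1 / e - e) = - ((e * e + 1) / (e * e - 1))"
      using e by (simp add: divide_simps) (simp add: algebra_simps)
    have "of_real pi * cos (of_real pi * z) / sin (of_real pi * z) = \<i> * of_real pi * of_real ((1 / e + e) / (1 / e - e))"
    proof -
      have "p * (a / 2) / (b / (2 * \<i>)) = \<i> * p * (a / b)" for p a b :: complex
        by (cases "b = 0") (simp_all add: field_simps)
      thus ?thesis unfolding c s of_real_divide by simp
    qed
    also have "\<dots> = - \<i> * of_real (pi * (exp x + 1) / (exp x - 1))"
      unfolding * e2 by simp
    finally show ?thesis .
  qed
  also have "- \<i> * of_real (pi * (exp x + 1) / (exp x - 1)) - 1 / z = - \<i> * of_real (pi * (exp x + 1) / (exp x - 1) - 1 / y)"
  proof -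
    have "1 / z = - \<i> * of_real (1 / y)" using y by (simp add: z_def field_simps)
    thus ?thesis unfolding of_real_diff by (simp only: right_diff_distrib)
  qed
  finally have s2: "(\<lambda>n. inverse (1 + z + of_nat n) - inverse (1 - z + of_nat n)) sums
      (- \<i> * of_real (pi * (exp x + 1) / (exp x - 1) - 1 / y))" using s1 by simp
  have t: "inverse (1 + z + of_nat n) - inverse (1 - z + of_nat n) = - \<i> * of_real (2 * y / ((real (Suc n))\<^sup>2 + y\<^sup>2))" for n
  proof -
    define m where "m = real (Suc n)"
    have m: "m > 0" by (simp add: m_def)
    have nz: "of_real m + z \<noteq> 0" "of_real m - z \<noteq> 0" using m y by (auto simp: z_def complex_eq_iff)
    have pr: "(of_real m + z) * (of_real m - z) = of_real (m\<^sup>2 + y\<^sup>2)"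
      by (simp add: z_def power2_eq_square algebra_simps)
    have "inverse (1 + z + of_nat n) - inverse (1 - z + of_nat n) = inverse (of_real m + z) - inverse (of_real m - z)"
      by (simp add: m_def add_ac diff_add_eq)
    also have "\<dots> = - 2 * z / ((of_real m + z) * (of_real m - z))"
      using nz by (simp add: field_simps)
    also have "\<dots> = - \<i> * of_real (2 * y / (m\<^sup>2 + y\<^sup>2))"
      unfolding pr by (simp add: z_def)
    finally show ?thesis by (simp add: m_def)
  qed
  have "(\<lambda>n. \<i> * (- \<i> * of_real (2 * y / ((real (Suc n))\<^sup>2 + y\<^sup>2)))) sums (\<i> * (- \<i> * complex_of_real (pi * (exp x + 1) / (exp x - 1) - 1 / y)))"
    using s2 unfolding t by (rule sums_mult)
  hence "(\<lambda>n. complex_of_real (2 * y / ((real (Suc n))\<^sup>2 + y\<^sup>2))) sums (complex_of_real (pi * (exp x + 1) / (exp x - 1) - 1 / y))"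
    by (simp only: mult.assoc[symmetric] mult_minus_right i_squared) simp
  hence "(\<lambda>n. 2 * y / ((real (Suc n))\<^sup>2 + y\<^sup>2)) sums (pi * (exp x + 1) / (exp x - 1) - 1 / y)"
    by (simp only: sums_of_real_iff)
  hence "(\<lambda>n. 1 / (2 * pi) * (2 * y / ((real (Suc n))\<^sup>2 + y\<^sup>2))) sums (1 / (2 * pi) * (pi * (exp x + 1) / (exp x - 1) - 1 / y))"
    by (rule sums_mult)
  also have "1 / (2 * pi) * (pi * (exp x + 1) / (exp x - 1) - 1 / y) = 1 / (exp x - 1) - 1 / x + 1 / 2"
    using assms by (simp add: y_def divide_simps) (simp add: algebra_simps)
  also have "(\<lambda>n. 1 / (2 * pi) * (2 * y / ((real (Suc n))\<^sup>2 + y\<^sup>2))) = (\<lambda>n. 2 * x / (x\<^sup>2 + (2 * pi * real (Suc n))\<^sup>2))"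
  proof
    fix n
    have xy: "x = 2 * pi * y" by (simp add: y_def)
    have "(2 * pi * y)\<^sup>2 + (2 * pi * real (Suc n))\<^sup>2 = (2 * pi)\<^sup>2 * ((real (Suc n))\<^sup>2 + y\<^sup>2)"
      unfolding power_mult_distrib by (simp only: distrib_left add.commute)
    hence *: "2 * x / (x\<^sup>2 + (2 * pi * real (Suc n))\<^sup>2) = 2 * (2 * pi * y) / ((2 * pi)\<^sup>2 * ((real (Suc n))\<^sup>2 + y\<^sup>2))"
      by (simp only: xy[symmetric])
    have "2 * (p * y) / (p\<^sup>2 * B) = 1 / p * (2 * y / B)" if "p \<noteq> 0" for p B
      using that by (simp add: power2_eq_square)
    from this[of "2 * pi"] have "2 * (2 * pi * y) / ((2 * pi)\<^sup>2 * ((real (Suc n))\<^sup>2 + y\<^sup>2)) = 1 / (2 * pi) * (2 * y / ((real (Suc n))\<^sup>2 + y\<^sup>2))"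
      by simp
    with * show "1 / (2 * pi) * (2 * y / ((real (Suc n))\<^sup>2 + y\<^sup>2)) = 2 * x / (x\<^sup>2 + (2 * pi * real (Suc n))\<^sup>2)"
      by (simp only:)
  qed
  finally show ?thesis .
qed

text \<open>Nonnegativity is what turns a gauge integral into a Lebesgue integral with the same
  value.\<close>

lemma has_real_integral_lborel:
  fixes f :: "real \<Rightarrow> real"
  assumes "(f has_integral I) S" "\<And>x. x \<in> S \<Longrightarrow> f x \<ge> 0" "(\<lambda>x. indicator S x *\<^sub>R f x) \<in> borel_measurable borel"
  shows "set_integrable lborel S f" "(LINT x:S|lborel. f x) = I"
proof -
  let ?g = "\<lambda>x. indicator S x *\<^sub>R f x"
  have g: "(?g has_integral I) UNIV"
  proof -
    have "(\<lambda>x. if x \<in> S then f x else 0) = ?g" by (auto simp: fun_eq_iff)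
    thus ?thesis using assms(1) has_integral_restrict_UNIV[of S f I] by simp
  qed
  have nn: "?g x \<ge> 0" for x using assms(2) by (auto simp: indicator_def)
  have I: "I \<ge> 0" using g nn has_integral_nonneg by blast
  have "integral\<^sup>N lborel ?g = ennreal I"
    by (rule nn_integral_has_integral_lborel[OF assms(3) nn g])
  hence "integrable lborel ?g \<and> integral\<^sup>L lborel ?g = I"
    using assms(3) nn I by (subst (asm) nn_integral_eq_integrable) auto
  thus "set_integrable lborel S f" "(LINT x:S|lborel. f x) = I"
    by (auto simp: set_integrable_def set_lebesgue_integral_def)
qed

lemma mellin_one_below:
  assumes "a > 0"
  shows "mellin_integrable (\<lambda>x. if x < 1 then 1 else 0) a"
    "mellin (\<lambda>x. if x < 1 then 1 else 0) (of_real a) = of_real (1 / a)"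
proof -
  have "((\<lambda>x. x powr (a - 1)) has_integral (1 / a)) {0..1}"
    using has_integral_powr_from_0[of "a - 1" 1] assms by simp
  hence "((\<lambda>x. x powr (a - 1)) has_integral (1 / a)) {0<..<1}"
    by (subst (asm) has_integral_Icc_iff_Ioo)
  hence *: "((\<lambda>x. (if x < 1 then 1 else 0) * x powr (a - 1)) has_integral (1 / a)) {0<..}"
    by (subst has_integral_restrict_UNIV[symmetric], subst (asm) has_integral_restrict_UNIV[symmetric])
       (erule has_integral_eq[rotated], auto)
  have m: "(\<lambda>x::real. indicator {0<..} x *\<^sub>R ((if x < 1 then 1 else 0) * x powr (a - 1))) \<in> borel_measurable borel"
    by measurable
  note ** = has_real_integral_lborel[OF * _ m]
  show "mellin_integrable (\<lambda>x. if x < 1 then 1 else 0) a"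
    unfolding mellin_integrable_def by (rule **(1)) auto
  show "mellin (\<lambda>x. if x < 1 then 1 else 0) (of_real a) = of_real (1 / a)"
    unfolding mellin_of_real by (subst **(2)) auto
qed

text \<open>Compare \<open>mellin_one_below\<close>: the halves of the constant 1 have transforms
  1/a for a > 0 and -1/a for a < 0, opposite as rational functions. Hence adding a power below 1 on
  one strip and subtracting it above 1 on another changes the transform by the same rational
  function.\<close>

lemma mellin_one_above:
  assumes "a < 0"
  shows "mellin_integrable (\<lambda>x. if x < 1 then 0 else 1) a"
    "mellin (\<lambda>x. if x < 1 then 0 else 1) (of_real a) = of_real (- 1 / a)"
proof -
  have "((\<lambda>x. x powr (a - 1)) has_integral (- 1 / a)) {1..}"
    using has_integral_powr_to_inf[of "a - 1" 1] assms by simp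
  hence *: "((\<lambda>x. (if x < 1 then 0 else 1) * x powr (a - 1)) has_integral (- 1 / a)) {0<..}"
    by (subst has_integral_restrict_UNIV[symmetric], subst (asm) has_integral_restrict_UNIV[symmetric])
       (erule has_integral_eq[rotated], auto)
  have m: "(\<lambda>x::real. indicator {0<..} x *\<^sub>R ((if x < 1 then 0 else 1) * x powr (a - 1))) \<in> borel_measurable borel"
    by measurable
  note ** = has_real_integral_lborel[OF * _ m]
  show "mellin_integrable (\<lambda>x. if x < 1 then 0 else 1) a"
    unfolding mellin_integrable_def by (rule **(1)) auto
  show "mellin (\<lambda>x. if x < 1 then 0 else 1) (of_real a) = of_real (- 1 / a)"
    unfolding mellin_of_real by (subst **(2)) auto
qed

text \<open>The integral equals Beta a b with a = (1 + s)/2 and b = 1 - a, which the reflection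
  formula for Gamma evaluates as pi / sin(pi a) = pi / cos(pi s / 2).\<close>

lemma mellin_cauchy_kernel:
  assumes "-1 < s" "s < 1"
  shows "mellin_integrable (\<lambda>y. 2 * y / (y\<^sup>2 + 1)) s"
    "(LINT y:{0<..}|lborel. 2 * y / (y\<^sup>2 + 1) * y powr (s - 1)) = pi / cos (pi * s / 2)"
proof -
  define a where "a = (1 + s) / 2"
  define b where "b = (1 - s) / 2"
  have ab: "a > 0" "b > 0" "a + b = 1" using assms by (auto simp: a_def b_def field_simps)
  \<comment> \<open>the inverse of t = y^2 / (1 + y^2), which turns the integral into a Beta integral\<close>
  define g :: "real \<Rightarrow> real" where "g t = sqrt (t / (1 - t))" for t
  define g' :: "real \<Rightarrow> real" where "g' t = (inverse (sqrt (t / (1 - t))) / 2) * (1 / (1 - t)\<^sup>2)" for t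
  define f :: "real \<Rightarrow> real" where "f y = 2 * y / (y\<^sup>2 + 1) * y powr (s - 1)" for y
  have fg: "f (g t) * g' t = t powr (a - 1) * (1 - t) powr (b - 1)" if "0 < t" "t < 1" for t
  proof -
    define q where "q = t / (1 - t)"
    have q: "q > 0" using that by (simp add: q_def)
    have gq: "g t = q powr (1/2)" using q by (simp add: g_def q_def powr_half_sqrt)
    have q1: "(g t)\<^sup>2 + 1 = 1 / (1 - t)" using that by (simp add: g_def field_simps)
    have gp: "g t powr (s - 1) = q powr ((s - 1) / 2)" by (simp add: gq powr_powr)
    have gpos: "g t > 0" using q by (simp add: gq)
    have "g' t = inverse (g t) / 2 * (1 / (1 - t)\<^sup>2)" by (simp add: g'_def g_def)
    hence "f (g t) * g' t = (2 * g t / (1 / (1 - t)) * q powr ((s - 1) / 2)) * (inverse (g t) / 2 * (1 / (1 - t)\<^sup>2))"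
      unfolding f_def q1 gp by simp
    also have "\<dots> = q powr ((s - 1) / 2) * (1 / (1 - t))"
    proof -
      have "(2 * G / (1 / u) * Q) * (inverse G / 2 * (1 / u\<^sup>2)) = Q * (1 / u)" if "G > 0" "u > 0" for G u Q :: real
        using that by (simp add: power2_eq_square field_simps)
      from this[OF gpos, of "1 - t"] show ?thesis using that by simp
    qed
    also have "q powr ((s - 1) / 2) = t powr ((s - 1) / 2) * (1 - t) powr (- ((s - 1) / 2))"
      using that by (simp add: q_def powr_divide powr_minus field_simps)
    also have "t powr ((s - 1) / 2) * (1 - t) powr (- ((s - 1) / 2)) * (1 / (1 - t)) =
        t powr ((s - 1) / 2) * ((1 - t) powr (- ((s - 1) / 2)) / (1 - t) powr 1)"
      using that by simp
    also have "\<dots> = t powr (a - 1) * (1 - t) powr (b - 1)"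
      unfolding powr_diff[symmetric] by (simp add: a_def b_def field_simps)
    finally show ?thesis .
  qed
  have ib: "set_integrable lborel {0..1} (\<lambda>t. t powr (a - 1) * (1 - t) powr (b - 1))"
    by (rule integrable_Beta[OF ab(1,2)])
  have ib': "set_integrable lborel {0<..<1} (\<lambda>t. t powr (a - 1) * (1 - t) powr (b - 1))"
    by (rule set_integrable_subset[OF ib]) auto
  have vb: "(LINT t:{0<..<1}|lborel. t powr (a - 1) * (1 - t) powr (b - 1)) = Beta a b"
  proof -
    have "(LINT t:{0<..<1}|lborel. t powr (a - 1) * (1 - t) powr (b - 1)) = integral {0<..<1} (\<lambda>t. t powr (a - 1) * (1 - t) powr (b - 1))"
      by (rule set_borel_integral_eq_integral(2)[OF ib'])
    also have "\<dots> = Beta a b"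
      using has_integral_Beta_real[OF ab(1,2)] has_integral_Icc_iff_Ioo by (intro integral_unique) blast
    finally show ?thesis .
  qed
  have e01: "einterval 0 1 = {0<..<1}" by (auto simp: einterval_def zero_ereal_def one_ereal_def)
  have e0i: "einterval 0 \<infinity> = {0<..}" by (auto simp: einterval_def zero_ereal_def)
  have ifg: "set_integrable lborel (einterval 0 1) (\<lambda>t. f (g t) * g' t)"
    unfolding e01 by (subst set_integrable_cong[OF refl refl fg]) (use ib' in auto)
  have lt: "0 < x" if "0 < ereal x" for x using that by (simp add: zero_ereal_def)
  have lt1: "x < 1" if "ereal x < 1" for x using that by (simp add: one_ereal_def)
  have hyp: "(0::ereal) < 1"
    "\<And>x. (0::ereal) < ereal x \<Longrightarrow> ereal x < 1 \<Longrightarrow> DERIV g x :> g' x"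
    "\<And>x. (0::ereal) < ereal x \<Longrightarrow> ereal x < 1 \<Longrightarrow> isCont f (g x)"
    "\<And>x. (0::ereal) < ereal x \<Longrightarrow> ereal x < 1 \<Longrightarrow> isCont g' x"
    "\<And>x. (0::ereal) < ereal x \<Longrightarrow> ereal x < 1 \<Longrightarrow> 0 \<le> f (g x)"
    "\<And>x. (0::ereal) \<le> ereal x \<Longrightarrow> ereal x \<le> 1 \<Longrightarrow> 0 \<le> g' x"
    "((ereal \<circ> g \<circ> real_of_ereal) \<longlongrightarrow> 0) (at_right 0)"
    "((ereal \<circ> g \<circ> real_of_ereal) \<longlongrightarrow> \<infinity>) (at_left 1)"
  proof -
    show "(0::ereal) < 1" by simp
    fix x :: real assume x: "(0::ereal) < ereal x" "ereal x < 1"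
    note x' = lt[OF x(1)] lt1[OF x(2)]
    have q: "x / (1 - x) > 0" using x' by simp
    show "DERIV g x :> g' x" unfolding g_def[abs_def] g'_def
      using x' q by (auto intro!: derivative_eq_intros simp: power2_eq_square divide_simps)
    have gp: "g x > 0" using q by (simp add: g_def)
    have "(g x)\<^sup>2 + 1 \<noteq> 0" using zero_le_power2[of "g x"] by linarith
    thus "isCont f (g x)" unfolding f_def using gp by (intro continuous_intros) auto
    show "isCont g' x" unfolding g'_def using x' q by (intro continuous_intros) auto
    show "0 \<le> f (g x)" using gp by (simp add: f_def)
  next
    fix x :: real assume "(0::ereal) \<le> ereal x" "ereal x \<le> 1"
    hence "0 \<le> x" "x \<le> 1" by (simp_all add: zero_ereal_def one_ereal_def)
    thus "0 \<le> g' x" by (simp add: g'_def)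
  next
    have "(g \<longlongrightarrow> 0) (at_right 0)" unfolding g_def by real_asymp
    thus "((ereal \<circ> g \<circ> real_of_ereal) \<longlongrightarrow> 0) (at_right 0)"
      by (simp add: zero_ereal_def ereal_tendsto_simps)
  next
    have "filterlim g at_top (at_left 1)" unfolding g_def by real_asymp
    thus "((ereal \<circ> g \<circ> real_of_ereal) \<longlongrightarrow> \<infinity>) (at_left 1)"
      by (simp add: one_ereal_def ereal_tendsto_simps)
  qed
  \<comment> \<open>The nonnegative form of the substitution rule delivers integrability of f on the
    half-line as well as the value.\<close>
  note sub = interval_integral_substitution_nonneg[OF hyp ifg]
  show "mellin_integrable (\<lambda>y. 2 * y / (y\<^sup>2 + 1)) s"
    using sub(1) unfolding mellin_integrable_def e0i f_def[abs_def] .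
  have "(LBINT x=0..\<infinity>. f x) = (LINT t:{0<..<1}|lborel. f (g t) * g' t)"
    using sub(2) by (simp add: interval_lebesgue_integral_def e01)
  also have "\<dots> = Beta a b"
    unfolding vb[symmetric] by (intro set_lebesgue_integral_cong) (auto simp: fg)
  also have "\<dots> = Gamma a * Gamma (1 - a)" 
  proof -
    have "b = 1 - a" using ab(3) by simp
    thus ?thesis by (simp add: Beta_def)
  qed
  also have "\<dots> = pi / sin (pi * a)"
  proof -
    have "complex_of_real (Gamma a * Gamma (1 - a)) = of_real (pi / sin (pi * a))"
    proof -
      have "complex_of_real (Gamma a * Gamma (1 - a)) = Gamma (of_real a) * Gamma (1 - of_real a)"
        using Gamma_complex_of_real[of a] Gamma_complex_of_real[of "1 - a"] by simp
      also have "\<dots> = of_real pi / sin (of_real (pi * a))"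
        by (subst Gamma_reflection_complex) simp
      finally show ?thesis by (simp only: sin_of_real of_real_divide)
    qed
    thus ?thesis unfolding of_real_eq_iff .
  qed
  also have "sin (pi * a) = cos (pi * s / 2)"
    by (simp add: a_def distrib_left add_divide_distrib sin_add)
  finally show "(LINT y:{0<..}|lborel. 2 * y / (y\<^sup>2 + 1) * y powr (s - 1)) = pi / cos (pi * s / 2)"
    by (simp add: interval_lebesgue_integral_def e0i f_def)
qed


text \<open>An interior point of the segment is a limit point of it, so the identity theorem
  applies. The transforms then need to be computed at real exponents only.\<close>

lemma real_segment_identity:
  assumes "open S" "connected S" "f holomorphic_on S" "g holomorphic_on S"
    and "a < b" "complex_of_real ` {a<..<b} \<subseteq> S"
    and "\<And>t. a < t \<Longrightarrow> t < b \<Longrightarrow> f (of_real t) = g (of_real t)"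
    and "z \<in> S"
  shows "f z = g z"
proof -
  define m where "m = (a + b) / 2"
  have m: "a < m" "m < b" using assms(5) by (auto simp: m_def)
  have "m islimpt {a<..<b}" using m by (intro interior_limit_point) (auto simp: interior_open)
  hence "of_real m islimpt (complex_of_real ` {a<..<b})"
    unfolding islimpt_approachable
    by (auto simp: dist_of_real)
  have "f z - g z = 0"
    by (rule analytic_continuation[of "\<lambda>z. f z - g z" S "complex_of_real ` {a<..<b}" "of_real m"])
       (use assms m \<open>of_real m islimpt _\<close> in \<open>auto intro!: holomorphic_intros\<close>)
  thus ?thesis by simp
qed

text \<open>Removing the first two Laurent terms 1/x and -1/2 at 0 leaves a function that is O(x) at
  0 and tends to 1/2 at infinity, so that its Mellin transform lives in -1 < Re s < 0.\<close>

definition bose_reg :: "real \<Rightarrow> real" where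
  "bose_reg x = 1 / (exp x - 1) - 1 / x + 1 / 2"

text \<open>Each partial fraction is a dilate of 2y / (y^2 + 1) and contributes a factor (2 pi (n +
  1))^(s-1). For s < 0 the sum over n is the Dirichlet series of zeta at 1 - s: this is where the
  reflection enters.\<close>

lemma mellin_bose_reg:
  assumes "-1 < s" "s < 0"
  shows "mellin_integrable bose_reg s"
    "mellin bose_reg (of_real s) = of_real (pi / cos (pi * s / 2)) * of_real (2 * pi) powr (of_real s - 1) *
        (zeta_reg (1 - of_real s) / (- of_real s))"
proof -
  let ?g = "\<lambda>y::real. 2 * y / (y\<^sup>2 + 1)"
  define c where "c n = 2 * pi * real (Suc n)" for n
  have c: "c n > 0" for n by (simp add: c_def)
  let ?h = "\<lambda>n x. 2 * x / (x\<^sup>2 + (2 * pi * real (Suc n))\<^sup>2)"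
  have h: "?h n x = (1 / c n) * ?g (x / c n)" for n x
  proof -
    have "x\<^sup>2 + (c n)\<^sup>2 = (c n)\<^sup>2 * ((x / c n)\<^sup>2 + 1)" using c[of n] by (simp add: field_simps)
    thus ?thesis using c[of n] unfolding c_def[symmetric] by (simp add: power2_eq_square)
  qed
  have gi: "mellin_integrable ?g s" "(LINT y:{0<..}|lborel. ?g y * y powr (s - 1)) = pi / cos (pi * s / 2)"
    using mellin_cauchy_kernel[of s] assms by auto
  have i: "mellin_integrable (?h n) s" for n
    unfolding h by (intro mellin_integrable_cmult mellin_integrable_scale c gi)
  have hpos: "?h n x \<ge> 0" if "x > 0" for n x using that by simp
  have mh: "mellin (?h n) (of_real s) = of_real (pi / cos (pi * s / 2)) * of_real (c n powr (s - 1))" for n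
  proof -
    have "mellin (?h n) (of_real s) = of_real (1 / c n) * (of_real (c n) powr (of_real s) * of_real (pi / cos (pi * s / 2)))"
      unfolding h mellin_cmult mellin_scale[OF c, of ?g] unfolding mellin_of_real gi(2) ..
    also have "of_real (c n) powr (of_real s) = (of_real (c n powr s) :: complex)"
      using c[of n] by (intro powr_of_real) auto
    also have "of_real (1 / c n) * (of_real (c n powr s) * of_real (pi / cos (pi * s / 2))) =
        complex_of_real (pi / cos (pi * s / 2)) * of_real (c n powr s / c n)"
      by (simp only: of_real_mult[symmetric] of_real_eq_iff) (simp add: mult.commute)
    also have "c n powr s / c n = c n powr (s - 1)" using c[of n] by (simp add: powr_diff)
    finally show ?thesis .
  qed
  have eI: "(LINT x:{0<..}|lborel. \<bar>?h n x\<bar> * x powr (s - 1)) = pi / cos (pi * s / 2) * c n powr (s - 1)" for n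
  proof -
    have "(LINT x:{0<..}|lborel. \<bar>?h n x\<bar> * x powr (s - 1)) = (LINT x:{0<..}|lborel. ?h n x * x powr (s - 1))"
      by (intro set_lebesgue_integral_cong) auto
    also have "complex_of_real \<dots> = of_real (pi / cos (pi * s / 2) * c n powr (s - 1))"
      unfolding mellin_of_real[symmetric] mh by simp
    finally show ?thesis unfolding of_real_eq_iff .
  qed
  have cp: "c n powr (s - 1) = (2 * pi) powr (s - 1) * real (Suc n) powr (- (1 - s))" for n
    unfolding c_def by (subst powr_mult) auto
  have "summable (\<lambda>n. LINT x:{0<..}|lborel. \<bar>?h n x\<bar> * x powr (s - 1))"
    unfolding eI cp using assms by (intro summable_mult summable_Suc_powr) auto
  moreover have "summable (\<lambda>n. \<bar>?h n x\<bar>)" if "x > 0" for x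
    using sums_summable[OF bose_partial_fraction[OF that]] hpos[OF that] that by simp
  ultimately have *: "(\<lambda>n. mellin (?h n) (of_real s)) sums mellin (\<lambda>x. \<Sum>n. ?h n x) (of_real s)"
      "mellin_integrable (\<lambda>x. \<Sum>n. ?h n x) s"
    using mellin_sums[of ?h "of_real s"] i by simp_all
  have eq: "(\<Sum>n. ?h n x) = bose_reg x" if "x > 0" for x
    using bose_partial_fraction[OF that] by (simp add: sums_iff bose_reg_def)
  show "mellin_integrable bose_reg s" using *(2) mellin_integrable_cong[OF eq, where a = s] by (simp only:)
  have "(\<lambda>n. of_real (pi / cos (pi * s / 2)) * of_real ((2 * pi) powr (s - 1)) * of_nat (Suc n) powr (- (1 - of_real s))) sums mellin bose_reg (of_real s)"
  proof -
    have "mellin (?h n) (of_real s) = of_real (pi / cos (pi * s / 2)) * of_real ((2 * pi) powr (s - 1)) * of_nat (Suc n) powr (- (1 - of_real s))" for n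
    proof -
      have "of_nat (Suc n) powr (- (1 - of_real s)) = complex_of_real (real (Suc n) powr (- (1 - s)))"
        using powr_of_real[of "real (Suc n)" "- (1 - s)"] by simp
      thus ?thesis unfolding mh cp by simp
    qed
    thus ?thesis using *(1) mellin_cong[OF eq, where s = "of_real s"] by (simp only:)
  qed
  moreover have "(\<lambda>n. of_real (pi / cos (pi * s / 2)) * of_real ((2 * pi) powr (s - 1)) * of_nat (Suc n) powr (- (1 - of_real s)))
      sums (of_real (pi / cos (pi * s / 2)) * of_real ((2 * pi) powr (s - 1)) * (\<Sum>n. of_nat (Suc n) powr (- (1 - complex_of_real s))))"
    using assms by (intro sums_mult summable_sums summable_nat_powr) auto
  moreover have "(\<Sum>n. of_nat (Suc n) powr (- (1 - complex_of_real s))) = zeta_reg (1 - of_real s) / (- of_real s)"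
    using zeta_reg_eq_series[of "1 - of_real s"] assms by simp
  moreover have "of_real ((2 * pi) powr (s - 1)) = of_real (2 * pi) powr (complex_of_real s - 1)"
    using powr_of_real[of "2 * pi" "s - 1"] by simp
  ultimately show "mellin bose_reg (of_real s) = of_real (pi / cos (pi * s / 2)) * of_real (2 * pi) powr (of_real s - 1) *
        (zeta_reg (1 - of_real s) / (- of_real s))"
    using sums_unique2 by metis
qed

text \<open>Dropping x^2 from the denominators of the partial fractions and summing the inverse
  squares gives even x / 12.\<close>

lemma bose_reg_bounds:
  assumes "x > 0"
  shows "0 \<le> bose_reg x" "bose_reg x \<le> x"
proof -
  let ?h = "\<lambda>n. 2 * x / (x\<^sup>2 + (2 * pi * real (Suc n))\<^sup>2)"
  have s: "?h sums bose_reg x" using bose_partial_fraction[OF assms] by (simp add: bose_reg_def)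
  show "0 \<le> bose_reg x" by (rule sums_le[OF _ sums_zero s]) (use assms in auto)
  have X: "(\<lambda>n. x / (2 * pi\<^sup>2) * (1 / (real n + 1)\<^sup>2)) sums (x / (2 * pi\<^sup>2) * (pi\<^sup>2 / 6))"
    using inverse_squares_sums by (intro sums_mult) (simp add: add.commute)
  have le: "?h n \<le> x / (2 * pi\<^sup>2) * (1 / (real n + 1)\<^sup>2)" for n
  proof -
    have "?h n \<le> 2 * x / ((2 * pi * real (Suc n))\<^sup>2)"
      using assms by (intro divide_left_mono) (auto intro!: mult_pos_pos add_nonneg_pos)
    also have "\<dots> = x / (2 * pi\<^sup>2) * (1 / (real n + 1)\<^sup>2)"
    proof -
      have "2 * x / (2 * pi * m)\<^sup>2 = x / (2 * pi\<^sup>2) * (1 / m\<^sup>2)" for m :: real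
        by (simp add: power_mult_distrib)
      from this[of "real (Suc n)"] show ?thesis by (simp only: of_nat_Suc add.commute)
    qed
    finally show ?thesis .
  qed
  have "bose_reg x \<le> x / (2 * pi\<^sup>2) * (pi\<^sup>2 / 6)"
    by (rule sums_le[OF le s X])
  also have "\<dots> = x / 12" by simp
  finally show "bose_reg x \<le> x" using assms by simp
qed

text \<open>
  Its Mellin transform converges for Re s > -1 and differs from that of 1 / (exp x - 1) for
  Re s > 1, and from that of \<open>bose_reg\<close> for -1 < Re s < 0, by the same rational function.
\<close>
definition bose_trunc :: "real \<Rightarrow> real" where
  "bose_trunc x = (if x < 1 then bose_reg x else 1 / (exp x - 1))"

lemma mellin_integrable_bose_trunc:
  assumes "a > -1"
  shows "mellin_integrable bose_trunc a"
proof -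
  have "mellin_integrable (\<lambda>x. if x < 1 then bose_reg x else 0) a"
  proof (rule mellin_integrable_bound)
    \<comment> \<open>The bound \<open>bose_reg x\<close> <= x gains one in the exponent near 0; on
      (0, 1) the factor exp 1 compensates for exp(-x).\<close>
    show "mellin_integrable (\<lambda>x. exp (- x)) (a + 1)"
      using mellin_exp(2)[of "of_real (a + 1)"] assms by simp
    show "(\<lambda>x::real. indicator {0<..} x * (if x < 1 then bose_reg x else 0)) \<in> borel_measurable borel"
      unfolding bose_reg_def by measurable
    fix x :: real assume x: "x > 0"
    show "\<bar>if x < 1 then bose_reg x else 0\<bar> * x powr (a - 1) \<le> exp 1 * (\<bar>exp (- x)\<bar> * x powr (a + 1 - 1))"
    proof (cases "x < 1")
      case True
      have "\<bar>bose_reg x\<bar> * x powr (a - 1) \<le> x * x powr (a - 1)"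
        using bose_reg_bounds[OF x] by (intro mult_right_mono) auto
      also have "\<dots> = 1 * x powr a" using x by (simp add: powr_diff)
      also have "\<dots> \<le> exp (1 - x) * x powr a" using True by (intro mult_right_mono) auto
      finally show ?thesis using True by (simp add: exp_diff exp_minus divide_inverse)
    qed auto
  qed
  moreover have "mellin_integrable (\<lambda>x. if x < 1 then 0 else 1 / (exp x - 1)) a"
  proof (rule mellin_integrable_bound)
    \<comment> \<open>exp(-x) has a transform only at positive exponents, and on x >= 1 raising the
      exponent from a to b only enlarges the power.\<close>
    define b where "b = max a 1"
    show "mellin_integrable (\<lambda>x. exp (- x)) b"
      using mellin_exp(2)[of "of_real b"] by (simp add: b_def)
    show "(\<lambda>x::real. indicator {0<..} x * (if x < 1 then 0 else 1 / (exp x - 1))) \<in> borel_measurable borel"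
      by measurable
    fix x :: real assume x: "x > 0"
    show "\<bar>if x < 1 then 0 else 1 / (exp x - 1)\<bar> * x powr (a - 1) \<le> 2 * (\<bar>exp (- x)\<bar> * x powr (b - 1))"
    proof (cases "x < 1")
      case False
      have e: "exp x \<ge> 2" using exp_ge_add_one_self[of x] False by linarith
      have "1 / (exp x - 1) * x powr (a - 1) \<le> (2 * exp (- x)) * x powr (b - 1)"
      proof (intro mult_mono)
        have "1 / (exp x - 1) \<le> 1 / (exp x / 2)"
          using e x by (intro divide_left_mono) (auto intro!: mult_pos_pos)
        also have "1 / (exp x / 2) = 2 * exp (- x)" by (simp add: exp_minus inverse_eq_divide)
        finally show "1 / (exp x - 1) \<le> 2 * exp (- x)" .
        show "x powr (a - 1) \<le> x powr (b - 1)" using False by (intro powr_mono) (auto simp: b_def)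
      qed auto
      thus ?thesis using False e by simp
    qed auto
  qed
  ultimately have "mellin_integrable (\<lambda>x. (if x < 1 then bose_reg x else 0) + (if x < 1 then 0 else 1 / (exp x - 1))) a"
    by (rule mellin_integrable_add)
  also have "(\<lambda>x. (if x < 1 then bose_reg x else 0) + (if x < 1 then 0 else 1 / (exp x - 1))) = bose_trunc"
    by (auto simp: bose_trunc_def)
  finally show ?thesis .
qed

lemma mellin_over_shift:
  assumes "mellin_integrable f (a - 1)"
  shows "mellin_integrable (\<lambda>x. f x / x) a" "mellin (\<lambda>x. f x / x) (of_real a) = mellin f (of_real (a - 1))"
proof -
  have "mellin_integrable (\<lambda>x. x * (f x / x)) (a - 1)"
    using assms mellin_integrable_cong[of "\<lambda>x. x * (f x / x)" f] by simp
  thus "mellin_integrable (\<lambda>x. f x / x) a" unfolding mellin_integrable_shift by simp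
  have "mellin f (of_real (a - 1)) = mellin (\<lambda>x. x * (f x / x)) (of_real (a - 1))"
    by (intro mellin_cong) auto
  also have "\<dots> = mellin (\<lambda>x. f x / x) (of_real a)" unfolding mellin_shift by simp
  finally show "mellin (\<lambda>x. f x / x) (of_real a) = mellin f (of_real (a - 1))" ..
qed

text \<open>For t > 1 the transform of 1 / (exp x - 1) exceeds that of \<open>bose_trunc\<close> by
  1/(t - 1) - 1/(2t), the transform of 1/x - 1/2 cut off at 1. Multiplication by s (s - 1) and
  rGamma s clears all poles, so the identity continues past Re s = 1 and Re s = 0.\<close>

lemma Gamma_zeta_reg_eq:
  assumes "-1 < Re s" "Re s < 3"
  shows "s * zeta_reg s = rGamma s * (s * (s - 1) * mellin bose_trunc s + s - (s - 1) / 2)"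
proof (rule real_segment_identity[where S = "{s. -1 < Re s \<and> Re s < 3}" and a = 1 and b = 3 and z = s])
  show "open {s. -1 < Re s \<and> Re s < 3}"
    by (intro open_Collect_conj open_halfspace_Re_gt open_halfspace_Re_lt)
  show "connected {s. -1 < Re s \<and> Re s < 3}"
    unfolding Collect_conj_eq
    by (intro convex_connected convex_Int convex_halfspace_Re_gt convex_halfspace_Re_lt)
  have "mellin bose_trunc holomorphic_on {s. -1 < Re s \<and> Re s < 3}"
    by (rule mellin_holomorphic) (rule mellin_integrable_bose_trunc)
  thus "(\<lambda>s. rGamma s * (s * (s - 1) * mellin bose_trunc s + s - (s - 1) / 2)) holomorphic_on {s. -1 < Re s \<and> Re s < 3}"
    by (auto intro!: holomorphic_intros)
  show "(\<lambda>s. s * zeta_reg s) holomorphic_on {s. -1 < Re s \<and> Re s < 3}"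
    by (intro holomorphic_intros)
  fix t :: real assume t: "1 < t" "t < 3"
  let ?p = "\<lambda>x::real. if x < 1 then 1 else 0 :: real"
  have i1: "mellin_integrable (\<lambda>x. ?p x / x) t" "mellin (\<lambda>x. ?p x / x) (of_real t) = of_real (1 / (t - 1))"
    using mellin_over_shift[of ?p t] mellin_one_below[of "t - 1"] t by auto
  have i2: "mellin_integrable (\<lambda>x. (- 1 / 2) * ?p x) t" "mellin (\<lambda>x. (- 1 / 2) * ?p x) (of_real t) = of_real ((- 1 / 2) * (1 / t))"
    using mellin_integrable_cmult[OF mellin_one_below(1)[of t], of "- 1 / 2"] mellin_one_below(2)[of t] t
      mellin_cmult[of "- 1 / 2" ?p "of_real t"] by (simp_all only: of_real_mult)
  have i3: "mellin_integrable bose_trunc t" using t by (intro mellin_integrable_bose_trunc) auto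
  have "mellin (\<lambda>x. 1 / (exp x - 1)) (of_real t) = mellin (\<lambda>x. bose_trunc x + (?p x / x + (- 1 / 2) * ?p x)) (of_real t)"
    by (intro mellin_cong) (auto simp: bose_trunc_def bose_reg_def)
  also have "\<dots> = mellin bose_trunc (of_real t) + mellin (\<lambda>x. ?p x / x + (- 1 / 2) * ?p x) (of_real t)"
    by (rule mellin_add) (use i1 i2 i3 mellin_integrable_add[OF i1(1) i2(1)] in auto)
  also have "mellin (\<lambda>x. ?p x / x + (- 1 / 2) * ?p x) (of_real t) = of_real (1 / (t - 1)) + of_real ((- 1 / 2) * (1 / t))"
    unfolding i1(2)[symmetric] i2(2)[symmetric] by (rule mellin_add) (use i1 i2 in auto)
  finally have "Gamma (of_real t) * (\<Sum>k. of_nat (Suc k) powr (- of_real t)) =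
      mellin bose_trunc (of_real t) + (of_real (1 / (t - 1)) + of_real ((- 1 / 2) * (1 / t)))"
    using mellin_bose(1)[of "of_real t"] t by simp
  hence "rGamma (of_real t) * (Gamma (of_real t) * (\<Sum>k. of_nat (Suc k) powr (- of_real t))) =
      rGamma (of_real t) * (mellin bose_trunc (of_real t) + (of_real (1 / (t - 1)) + of_real ((- 1 / 2) * (1 / t))))"
    by simp
  moreover have "rGamma (of_real t) * Gamma (of_real t) = (1::complex)"
    using Gamma_nonzero[OF Re_pos_not_nonpos_Int[of "of_real t"]] t by (simp add: rGamma_inverse_Gamma)
  ultimately have *: "(\<Sum>k. of_nat (Suc k) powr (- of_real t)) =
      rGamma (of_real t) * (mellin bose_trunc (of_real t) + (of_real (1 / (t - 1)) + of_real ((- 1 / 2) * (1 / t))))"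
    by (simp add: mult.assoc[symmetric])
  have tz: "complex_of_real t \<noteq> 0" "complex_of_real t - 1 \<noteq> 0" using t by (auto simp: complex_eq_iff)
  have "of_real t * zeta_reg (of_real t) = of_real t * (of_real t - 1) *
     (rGamma (of_real t) * (mellin bose_trunc (of_real t) + (of_real (1 / (t - 1)) + of_real ((- 1 / 2) * (1 / t)))))"
    using zeta_reg_eq_series[of "of_real t"] t * by simp
  also have "\<dots> = rGamma (of_real t) * (of_real t * (of_real t - 1) * mellin bose_trunc (of_real t) + of_real t - (of_real t - 1) / 2)"
    using tz by (simp add: field_simps)
  finally show "of_real t * zeta_reg (of_real t) = rGamma (of_real t) * (of_real t * (of_real t - 1) * mellin bose_trunc (of_real t) + of_real t - (of_real t - 1) / 2)" .
qed (use assms in auto)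

text \<open>On (-1, 0) the rational terms of \<open>Gamma_zeta_reg_eq\<close> are exactly what turns
  the transform of \<open>bose_trunc\<close> into that of \<open>bose_reg\<close>, which contains
  zeta(1 - s). Multiplying by the cosine makes both sides entire, so this segment suffices.\<close>

theorem zeta_reg_functional_equation:
  "s * zeta_reg s * cos (of_real pi * s / 2) =
     - (rGamma s * (s - 1) * of_real pi * of_real (2 * pi) powr (s - 1) * zeta_reg (1 - s))"
proof (rule real_segment_identity[where S = UNIV and a = "-1" and b = 0 and z = s])
  show "(\<lambda>s. s * zeta_reg s * cos (of_real pi * s / 2)) holomorphic_on UNIV"
    by (auto intro!: holomorphic_intros)
  show "(\<lambda>s. - (rGamma s * (s - 1) * of_real pi * of_real (2 * pi) powr (s - 1) * zeta_reg (1 - s))) holomorphic_on UNIV"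
    by (auto intro!: holomorphic_intros)
  fix t :: real assume t: "-1 < t" "t < 0"
  let ?r = "\<lambda>x::real. if x < 1 then 0 else 1 :: real"
  have i1: "mellin_integrable (\<lambda>x. ?r x / x) t" "mellin (\<lambda>x. ?r x / x) (of_real t) = of_real (- 1 / (t - 1))"
    using mellin_over_shift[of ?r t] mellin_one_above[of "t - 1"] t by auto
  have i1': "mellin_integrable (\<lambda>x. (- 1) * (?r x / x)) t" "mellin (\<lambda>x. (- 1) * (?r x / x)) (of_real t) = of_real (1 / (t - 1))"
    using mellin_integrable_cmult[OF i1(1), of "-1"] mellin_cmult[of "- 1" "\<lambda>x. ?r x / x" "of_real t"] i1(2) by simp_all
  have i2: "mellin_integrable (\<lambda>x. (1 / 2) * ?r x) t" "mellin (\<lambda>x. (1 / 2) * ?r x) (of_real t) = of_real ((1 / 2) * (- 1 / t))"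
    using mellin_integrable_cmult[OF mellin_one_above(1)[of t], of "1 / 2"] mellin_one_above(2)[of t] t
      mellin_cmult[of "1 / 2" ?r "of_real t"] by (simp_all only: of_real_mult)
  have i3: "mellin_integrable bose_trunc t" using t by (intro mellin_integrable_bose_trunc) auto
  have "mellin bose_reg (of_real t) = mellin (\<lambda>x. bose_trunc x + ((- 1) * (?r x / x) + (1 / 2) * ?r x)) (of_real t)"
    by (intro mellin_cong) (auto simp: bose_trunc_def bose_reg_def)
  also have "\<dots> = mellin bose_trunc (of_real t) + mellin (\<lambda>x. (- 1) * (?r x / x) + (1 / 2) * ?r x) (of_real t)"
    by (rule mellin_add) (use i1' i2 i3 mellin_integrable_add[OF i1'(1) i2(1)] in auto)
  also have "mellin (\<lambda>x. (- 1) * (?r x / x) + (1 / 2) * ?r x) (of_real t) = of_real (1 / (t - 1)) + of_real ((1 / 2) * (- 1 / t))"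
    unfolding i1'(2)[symmetric] i2(2)[symmetric] by (rule mellin_add) (use i1' i2 in auto)
  finally have *: "mellin bose_reg (of_real t) = mellin bose_trunc (of_real t) + (of_real (1 / (t - 1)) + of_real ((1 / 2) * (- 1 / t)))" .
  have tz: "complex_of_real t \<noteq> 0" "complex_of_real t - 1 \<noteq> 0" using t by (auto simp: complex_eq_iff)
  define C where "C = cos (complex_of_real pi * of_real t / 2)"
  have C: "C = of_real (cos (pi * t / 2))" by (simp add: C_def flip: cos_of_real)
  have Cn: "cos (pi * t / 2) > 0"
  proof (rule cos_gt_zero_pi)
    have "pi * (-1) < pi * t" "pi * t < pi * 1"
      by (rule mult_strict_left_mono[OF _ pi_gt_zero]; use t in simp)+
    thus "- (pi / 2) < pi * t / 2" "pi * t / 2 < pi / 2" by auto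
  qed
  have "of_real t * zeta_reg (of_real t) = rGamma (of_real t) * (of_real t * (of_real t - 1) * mellin bose_trunc (of_real t) + of_real t - (of_real t - 1) / 2)"
    using t by (intro Gamma_zeta_reg_eq) auto
  also have "\<dots> = rGamma (of_real t) * (of_real t * (of_real t - 1) * mellin bose_reg (of_real t))"
    unfolding * using tz by (simp add: field_simps)
  finally have "of_real t * zeta_reg (of_real t) * C = rGamma (of_real t) * (of_real t * (of_real t - 1) * mellin bose_reg (of_real t)) * C"
    by simp
  also have "mellin bose_reg (of_real t) = of_real pi / C * of_real (2 * pi) powr (of_real t - 1) * (zeta_reg (1 - of_real t) / (- of_real t))"
    unfolding mellin_bose_reg(2)[OF t] C by simp
  also have "rGamma (of_real t) * (of_real t * (of_real t - 1) * (of_real pi / C * of_real (2 * pi) powr (of_real t - 1) * (zeta_reg (1 - of_real t) / (- of_real t)))) * C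
     = - (rGamma (of_real t) * (of_real t - 1) * of_real pi * of_real (2 * pi) powr (of_real t - 1) * zeta_reg (1 - of_real t))"
    using tz Cn unfolding C by (simp add: field_simps del: of_real_mult)
  finally show "of_real t * zeta_reg (of_real t) * cos (of_real pi * of_real t / 2) =
     - (rGamma (of_real t) * (of_real t - 1) * of_real pi * of_real (2 * pi) powr (of_real t - 1) * zeta_reg (1 - of_real t))"
    unfolding C_def .
qed auto

text \<open>This excludes w = 0 in \<open>zeta_reg_zero_reflect\<close>, an even integer that is not
  a trivial zero. Only two terms of the Hasse series survive at s = 0.\<close>

lemma zeta_reg_0: "zeta_reg 0 = 1 / 2"
proof -
  have "fdiff n 0 (0 - 1) / of_nat (Suc n) = (if n = 0 then 1 else if n = 1 then - 1 / 2 else 0)" for n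
    using fdiff_rec[of n 0 "-1"] by (auto simp: fdiff_at_0)
  hence "zeta_reg 0 = (\<Sum>n. if n = 0 then 1 else if n = 1 then - 1 / 2 else 0)"
    unfolding zeta_reg_def by (intro suminf_cong)
  also have "\<dots> = (\<Sum>n\<in>{0,1::nat}. if n = 0 then 1 else if n = 1 then - 1 / 2 else 0)"
    by (rule suminf_finite) auto
  also have "\<dots> = 1 / 2" by simp
  finally show ?thesis .
qed

text \<open>The functional equation is used at 1 - w, so that the zero w annihilates the side with
  rGamma and only the cosine has to be excluded. It vanishes just for even integers w; those with Re
  w < 1/2 are 0, where \<open>zeta_reg\<close> is 1/2, and the trivial zeros.\<close>

lemma zeta_reg_zero_reflect:
  assumes "zeta_reg w = 0" "Re w < 1 / 2" "\<And>n::nat. w \<noteq> - 2 * of_nat (Suc n)"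
  shows "zeta_reg (1 - w) = 0"
proof (rule ccontr)
  assume nz: "zeta_reg (1 - w) \<noteq> 0"
  have "1 - w \<noteq> 0" using assms(2) by (auto simp: complex_eq_iff)
  with nz zeta_reg_functional_equation[of "1 - w"] assms(1) have "cos (of_real pi * (1 - w) / 2) = 0"
    by simp
  then obtain n :: int where n: "of_real pi * (1 - w) / 2 = complex_of_real (n * pi) + of_real pi / 2"
    unfolding cos_eq_0 by blast
  have "of_real pi * (1 - w) = 2 * (of_real pi * (1 - w) / 2)" by simp
  also have "\<dots> = of_real pi * (2 * of_int n + 1)" unfolding n by (simp add: algebra_simps)
  finally have "of_real pi * (1 - w) = of_real pi * (2 * of_int n + 1)" .
  hence "1 - w = 2 * of_int n + 1" by (subst (asm) mult_cancel_left) auto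
  hence w: "w = - 2 * of_int n" by (simp add: algebra_simps eq_neg_iff_add_eq_0)
  with assms(2) have "real_of_int n > - 1 / 4" by simp
  hence "n \<ge> 0" by linarith
  show False
  proof (cases "n = 0")
    case True
    thus False using w assms(1) zeta_reg_0 by simp
  next
    case False
    then obtain m where "n = int (Suc m)" using \<open>n \<ge> 0\<close> by (metis nonneg_int_cases of_nat_0 not0_implies_Suc)
    thus False using w assms(3)[of m] by simp
  qed
qed

section \<open>Growth, non-vanishing and lower bounds for zeta\<close>

text \<open>This is N^(-s) minus the integral of x^(-s) over [N, N+1], times s - 1, for N = n + 1.\<close>
definition em_term :: "nat \<Rightarrow> complex \<Rightarrow> complex" where
  "em_term n s = (s - 1) * of_nat (Suc n) powr (- s) + (of_nat (Suc (Suc n)) powr (1 - s) - of_nat (Suc n) powr (1 - s))"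

lemma norm_powr_diff_le:
  fixes x N :: real
  assumes "0 < N" "N \<le> x" "x \<le> N + 1" "Re s > 0"
  shows "norm (of_real N powr (- s) - of_real x powr (- s)) \<le> norm s * N powr (- Re s - 1)"
proof -
  let ?S = "closed_segment (of_real N) (of_real (N + 1)) :: complex set"
  have S: "?S = of_real ` {N..N+1}" unfolding closed_segment_of_real by (simp add: closed_segment_eq_real_ivl)
  have "norm (of_real N powr (- s) - of_real x powr (- s)) \<le> norm s * N powr (- Re s - 1) * norm (complex_of_real N - of_real x)"
  proof (rule field_differentiable_bound[where S = ?S and f = "\<lambda>z. z powr (- s)" and f' = "\<lambda>z. - s * z powr (- s - 1)"])
    fix z assume "z \<in> ?S"
    then obtain y where y: "z = of_real y" "N \<le> y" "y \<le> N + 1" unfolding S by auto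
    have y0: "y > 0" using y assms by linarith
    have "((\<lambda>z. z powr (- s)) has_field_derivative (- s * z powr (- s - 1))) (at z)"
      using y0 y by (intro has_field_derivative_powr) (auto simp: complex_nonpos_Reals_iff)
    thus "((\<lambda>z. z powr (- s)) has_field_derivative (- s * z powr (- s - 1))) (at z within ?S)"
      by (rule has_field_derivative_at_within)
    have "norm (- s * z powr (- s - 1)) = norm s * y powr (- Re s - 1)"
      using y y0 by (simp add: norm_mult norm_powr_real_powr)
    also have "\<dots> \<le> norm s * N powr (- Re s - 1)"
      using y assms by (intro mult_left_mono powr_mono2') auto
    finally show "norm (- s * z powr (- s - 1)) \<le> norm s * N powr (- Re s - 1)" .
  next
    show "complex_of_real N \<in> ?S" unfolding S using assms by auto
  next
    show "complex_of_real x \<in> ?S" unfolding S using assms by auto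
  qed auto
  also have "norm (complex_of_real N - of_real x) = \<bar>N - x\<bar>" by (simp flip: of_real_diff)
  also have "norm s * N powr (- Re s - 1) * \<bar>N - x\<bar> \<le> norm s * N powr (- Re s - 1) * 1"
    using assms by (intro mult_left_mono) auto
  finally show ?thesis by simp
qed

lemma norm_em_term_le:
  assumes "Re s > 0"
  shows "norm (em_term n s) \<le> norm (s - 1) * norm s * real (Suc n) powr (- Re s - 1)"
proof -
  define N where "N = real (Suc n)"
  have N: "N > 0" by (simp add: N_def)
  let ?S = "closed_segment (of_real N) (of_real (N + 1)) :: complex set"
  have S: "?S = of_real ` {N..N+1}" unfolding closed_segment_of_real by (simp add: closed_segment_eq_real_ivl)
  \<comment> \<open>\<open>?G\<close> is a primitive of (s - 1) (N^(-s) - z^(-s)), and its increment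
    over [N, N + 1] is \<open>em_term n s\<close>.\<close>
  let ?G = "\<lambda>z. (s - 1) * z * of_real N powr (- s) + z powr (1 - s)"
  let ?B = "norm (s - 1) * (norm s * N powr (- Re s - 1))"
  have "norm (?G (of_real (N + 1)) - ?G (of_real N)) \<le> ?B * norm (complex_of_real (N + 1) - of_real N)"
  proof (rule field_differentiable_bound[where S = ?S and f' = "\<lambda>z. (s - 1) * (of_real N powr (- s) - z powr (- s))"])
    fix z assume "z \<in> ?S"
    then obtain y where y: "z = of_real y" "N \<le> y" "y \<le> N + 1" unfolding S by auto
    have y0: "y > 0" using y N by linarith
    have "((\<lambda>z. z powr (1 - s)) has_field_derivative ((1 - s) * z powr (1 - s - 1))) (at z)"
      using y0 y by (intro has_field_derivative_powr) (auto simp: complex_nonpos_Reals_iff)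
    moreover have "z \<notin> \<real>\<^sub>\<le>\<^sub>0" using y0 y by (simp add: complex_nonpos_Reals_iff)
    ultimately have "(?G has_field_derivative (s - 1) * (of_real N powr (- s) - z powr (- s))) (at z)"
      by (auto intro!: derivative_eq_intros simp: algebra_simps)
    thus "(?G has_field_derivative (s - 1) * (of_real N powr (- s) - z powr (- s))) (at z within ?S)"
      by (rule has_field_derivative_at_within)
    show "norm ((s - 1) * (of_real N powr (- s) - z powr (- s))) \<le> ?B"
      unfolding norm_mult y(1) by (intro mult_left_mono norm_powr_diff_le) (use y N assms in auto)
  qed (auto simp: S)
  also have "norm (complex_of_real (N + 1) - of_real N) = 1" by simp
  also have "?G (of_real (N + 1)) - ?G (of_real N) = em_term n s"
    by (simp add: em_term_def N_def algebra_simps)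
  finally show ?thesis by (simp add: N_def mult.assoc)
qed

lemma em_term_sums:
  assumes "Re s > 1"
  shows "(\<lambda>n. em_term n s) sums (zeta_reg s - 1)"
proof -
  let ?f = "\<lambda>n. of_nat (Suc n) powr (1 - s) :: complex"
  have "(\<lambda>n. real (Suc n) powr (1 - Re s)) \<longlonglongrightarrow> 0"
    using assms by (intro tendsto_neg_powr filterlim_compose[OF filterlim_real_sequentially filterlim_Suc]) auto
  moreover have "norm (?f n) = real (Suc n) powr (1 - Re s)" for n
    using norm_powr_real_powr[of "of_nat (Suc n)" "1 - s"] by (simp del: of_nat_Suc)
  ultimately have "(\<lambda>n. norm (?f n)) \<longlonglongrightarrow> 0" by (simp del: of_nat_Suc)
  hence "?f \<longlonglongrightarrow> 0" by (rule tendsto_norm_zero_cancel)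
  from telescope_sums[OF this] have "(\<lambda>n. ?f (Suc n) - ?f n) sums (0 - ?f 0)" .
  moreover have "(\<lambda>n. (s - 1) * of_nat (Suc n) powr (- s)) sums ((s - 1) * (\<Sum>n. of_nat (Suc n) powr (- s)))"
    using summable_nat_powr(2)[OF assms] by (intro sums_mult summable_sums)
  ultimately have "(\<lambda>n. (s - 1) * of_nat (Suc n) powr (- s) + (?f (Suc n) - ?f n)) sums ((s - 1) * (\<Sum>n. of_nat (Suc n) powr (- s)) + (0 - ?f 0))"
    by (intro sums_add)
  thus ?thesis using zeta_reg_eq_series[OF assms] by (simp add: em_term_def[abs_def])
qed

text \<open>The terms are O(n^(-Re s - 1)), so the series converges for Re s > 0. Unlike the
  constants in \<open>fdiff_bound\<close>, its bounds depend explicitly on s, which is what a growth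
  estimate requires.\<close>

lemma zeta_reg_eq_em:
  assumes "Re s > 0"
  shows "zeta_reg s = 1 + (\<Sum>n. em_term n s)"
proof (rule analytic_continuation_open[where s = "{s. Re s > 1}" and s' = "{s. Re s > 0}" and z = s])
  show "open {s. Re s > 1}" "open {s. Re s > 0}" by (rule open_halfspace_Re_gt)+
  show "{s. Re s > 1} \<noteq> {}" by (auto intro!: exI[of _ 2])
  show "connected {s. Re s > 0}" by (intro convex_connected convex_halfspace_Re_gt)
  show "zeta_reg holomorphic_on {s. Re s > 0}" by (rule holomorphic_on_subset[OF holomorphic_zeta_reg]) auto
  have "(\<lambda>s. \<Sum>n. em_term n s) holomorphic_on {s. Re s > 0}"
  proof (rule holomorphic_suminf)
    show "em_term n holomorphic_on {s. Re s > 0}" for n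
      unfolding em_term_def by (intro holomorphic_intros) (auto simp del: of_nat_Suc)
    fix x assume "x \<in> {s. Re s > 0}"
    hence x: "Re x > 0" by simp
    define r where "r = Re x / 2"
    have r: "r > 0" using x by (simp add: r_def)
    have re: "Re y \<ge> r" if "y \<in> cball x r" for y
      using that abs_Re_le_cmod[of "x - y"] by (auto simp: dist_norm r_def abs_le_iff)
    have nm: "norm y \<le> norm x + r" if "y \<in> cball x r" for y
      using that norm_triangle_sub[of y x] by (simp add: dist_norm norm_minus_commute)
    have nm1: "norm (y - 1) \<le> norm x + r + 1" if "y \<in> cball x r" for y
      using nm[OF that] norm_triangle_ineq4[of y 1] by simp
    show "\<exists>r M. r > 0 \<and> cball x r \<subseteq> {s. Re s > 0} \<and> summable M \<and> (\<forall>n. \<forall>y\<in>cball x r. norm (em_term n y) \<le> M n)"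
    proof (intro exI conjI allI ballI)
      show "r > 0" by (rule r)
      show "cball x r \<subseteq> {s. Re s > 0}" using re r by force
      show "summable (\<lambda>n. (norm x + r + 1) * (norm x + r) * real (Suc n) powr (- (r + 1)))"
        using r by (intro summable_mult summable_Suc_powr) auto
      fix n y assume y: "y \<in> cball x r"
      have "norm (em_term n y) \<le> norm (y - 1) * norm y * real (Suc n) powr (- Re y - 1)"
        using re[OF y] r by (intro norm_em_term_le) auto
      also have "\<dots> \<le> (norm x + r + 1) * (norm x + r) * real (Suc n) powr (- (r + 1))"
        using nm[OF y] nm1[OF y] re[OF y] r by (intro mult_mono powr_mono) auto
      finally show "norm (em_term n y) \<le> (norm x + r + 1) * (norm x + r) * real (Suc n) powr (- (r + 1))" .
    qed
  qed (auto intro: open_halfspace_Re_gt)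
  thus "(\<lambda>s. 1 + (\<Sum>n. em_term n s)) holomorphic_on {s. Re s > 0}" by (intro holomorphic_intros)
  show "zeta_reg z = 1 + (\<Sum>n. em_term n z)" if "z \<in> {s. Re s > 1}" for z
    using em_term_sums[of z] that by (simp add: sums_iff)
qed (use assms in auto)

lemma norm_zeta_reg_le:
  "\<exists>K\<ge>0. \<forall>s. Re s \<ge> 1/2 \<longrightarrow> norm (zeta_reg s) \<le> 1 + K * norm (s - 1) * norm s"
proof (intro exI conjI allI impI)
  let ?g = "\<lambda>n. real (Suc n) powr (- (3/2))"
  have sg: "summable ?g" by (rule summable_Suc_powr) simp
  show "(\<Sum>n. ?g n) \<ge> 0" using sg by (rule suminf_nonneg) simp
  fix s :: complex assume s: "Re s \<ge> 1/2"
  have b: "norm (em_term n s) \<le> norm (s - 1) * norm s * ?g n" for n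
  proof -
    have "norm (em_term n s) \<le> norm (s - 1) * norm s * real (Suc n) powr (- Re s - 1)"
      using s by (intro norm_em_term_le) auto
    also have "\<dots> \<le> norm (s - 1) * norm s * ?g n"
      using s by (intro mult_left_mono powr_mono) auto
    finally show ?thesis .
  qed
  have "norm (zeta_reg s) \<le> 1 + norm (\<Sum>n. em_term n s)"
    using zeta_reg_eq_em[of s] s norm_triangle_ineq[of 1 "\<Sum>n. em_term n s"] by simp
  also have "norm (\<Sum>n. em_term n s) \<le> (\<Sum>n. norm (s - 1) * norm s * ?g n)"
    by (rule norm_suminf_le) (use b sg in \<open>auto intro: summable_mult\<close>)
  also have "\<dots> = (\<Sum>n. ?g n) * norm (s - 1) * norm s"
    using sg by (subst suminf_mult) (auto simp: mult_ac)
  finally show "norm (zeta_reg s) \<le> 1 + (\<Sum>n. ?g n) * norm (s - 1) * norm s" by simp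
qed

section \<open>Lower bounds for zeta and absence of zeros\<close>

lemma zeta_eq_series:
  assumes "Re s > 1"
  shows "zeta s = (\<Sum>k. of_nat (Suc k) powr (- s))"
proof -
  have "s - 1 \<noteq> 0" using assms by (auto simp: complex_eq_iff)
  thus ?thesis using zeta_reg_eq_series[OF assms] by (simp add: zeta_eq)
qed

text \<open>For Re s >= 3 the terms after the first are at most m^(-3) <= m^(-2) / 2, in total
  (pi^2/6 - 1) / 2. The crude bound pi < 4 makes this 5/6, which leaves 1/6.\<close>

lemma norm_zeta_ge:
  assumes "Re s \<ge> 3"
  shows "norm (zeta s) \<ge> 1 / 6"
proof -
  let ?f = "\<lambda>k. of_nat (Suc k) powr (- s) :: complex"
  have s1: "Re s > 1" using assms by simp
  have nrm: "norm (?f k) = real (Suc k) powr (- Re s)" for k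
    using norm_powr_real_powr[of "of_nat (Suc k)" "- s"] by (simp del: of_nat_Suc)
  have q: "(\<lambda>n. 1 / (real (Suc n) + 1)\<^sup>2) sums (pi\<^sup>2 / 6 - 1)"
    using inverse_squares_sums by (subst sums_Suc_iff) (simp add: add.commute)
  have le: "norm (?f (Suc k)) \<le> 1 / 2 * (1 / (real (Suc k) + 1)\<^sup>2)" for k
  proof -
    define m where "m = real (Suc (Suc k))"
    have m: "m \<ge> 2" by (simp add: m_def)
    have "norm (?f (Suc k)) = m powr (- Re s)" unfolding nrm m_def ..
    also have "\<dots> \<le> m powr (- 3)" using m assms by (intro powr_mono) auto
    also have "\<dots> = 1 / (m * m\<^sup>2)" using m by (simp add: powr_minus powr_numeral power3_eq_cube power2_eq_square field_simps)
    also have "\<dots> \<le> 1 / (2 * m\<^sup>2)" using m by (intro divide_left_mono mult_right_mono) auto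
    finally show ?thesis by (simp add: m_def add_ac)
  qed
  have "(\<Sum>k. ?f k) = ?f 0 + (\<Sum>k. ?f (Suc k))"
    using suminf_split_head[OF summable_nat_powr(2)[OF s1]] by simp
  hence z: "zeta s = 1 + (\<Sum>k. ?f (Suc k))" using zeta_eq_series[OF s1] by simp
  have "norm (\<Sum>k. ?f (Suc k)) \<le> (\<Sum>k. 1 / 2 * (1 / (real (Suc k) + 1)\<^sup>2))"
    using le sums_mult[OF q, of "1/2"] by (intro norm_suminf_le) (auto simp: sums_iff)
  also have "\<dots> = 1 / 2 * (pi\<^sup>2 / 6 - 1)" using sums_mult[OF q, of "1/2"] by (simp add: sums_iff)
  also have "pi\<^sup>2 \<le> 4\<^sup>2" using pi_less_4 by (intro power_mono) auto
  hence "1 / 2 * (pi\<^sup>2 / 6 - 1) \<le> 5 / 6" by simp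
  finally have "norm (\<Sum>k. ?f (Suc k)) \<le> 5 / 6" .
  thus ?thesis unfolding z using norm_triangle_ineq2[of 1 "- (\<Sum>k. ?f (Suc k))"] by simp
qed

lemma zeta_reg_nonzero:
  assumes "Re s > 1"
  shows "zeta_reg s \<noteq> 0"
proof
  assume z: "zeta_reg s = 0"
  let ?f = "\<lambda>n::nat. of_nat n powr (- s) :: complex"
  let ?g = "\<lambda>n. real n powr (- Re s)"
  define A where "A P = {n::nat. n > 0 \<and> (\<forall>p\<in>P. \<not> p dvd n)}" for P
  have nrm: "norm (?f n) = ?g n" if "n > 0" for n
    using norm_powr_real_powr[of "of_nat n" "- s"] that by simp
  have sg: "summable ?g" using assms by (simp add: summable_real_powr_iff)
  have abs: "(\<lambda>n. norm (?f n)) summable_on UNIV"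
  proof -
    have "summable (\<lambda>n. norm (?f n))"
    proof (rule summable_comparison_test')
      show "norm (norm (?f n)) \<le> ?g n" if "n \<ge> 1" for n using nrm[of n] that by simp
    qed (rule sg)
    thus ?thesis by (intro norm_summable_imp_summable_on) simp
  qed
  have sm: "?f summable_on X" for X
    using abs_summable_summable[OF abs] summable_on_subset_banach by blast
  have base: "infsum ?f (A {}) = 0"
  proof -
    have "A {} = range Suc" using gr0_conv_Suc by (auto simp: A_def)
    hence "infsum ?f (A {}) = infsum (?f \<circ> Suc) UNIV" by (simp add: infsum_reindex)
    also have "\<dots> = (\<Sum>k. ?f (Suc k))"
    proof (rule infsumI)
      show "(?f \<circ> Suc has_sum (\<Sum>k. ?f (Suc k))) UNIV"
        unfolding o_def by (intro norm_summable_imp_has_sum summable_nat_powr summable_sums assms)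
    qed
    also have "\<dots> = 0"
    proof -
      have "s - 1 \<noteq> 0" using assms by (auto simp: complex_eq_iff)
      thus ?thesis using zeta_reg_eq_series[OF assms] z by simp
    qed
    finally show ?thesis .
  qed
  \<comment> \<open>If the full series vanishes, removing the multiples of a prime multiplies by 1 - q^(-s) and
    keeps it zero; after removing all primes up to N only 1 and a tail of size less than 1 remain.\<close>
  have sieve: "infsum ?f (A P) = 0" if "finite P" "\<And>p. p \<in> P \<Longrightarrow> prime p" for P
    using that
  proof (induction P rule: finite_induct)
    case (insert q P)
    have IH: "infsum ?f (A P) = 0" using insert by auto
    have q: "prime q" using insert by auto
    have nd: "p dvd q * n \<longleftrightarrow> p dvd n" if "p \<in> P" for p n
    proof -
      have "\<not> p dvd q" using insert that q by (metis insertI1 insertI2 primes_dvd_imp_eq)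
      thus ?thesis using insert(4)[of p] that by (simp add: prime_dvd_mult_iff)
    qed
    have split: "A P = A (insert q P) \<union> (\<lambda>n. q * n) ` A P"
    proof (intro equalityI subsetI)
      fix n assume n: "n \<in> A P"
      show "n \<in> A (insert q P) \<union> (\<lambda>n. q * n) ` A P"
      proof (cases "q dvd n")
        case True
        then obtain m where m: "n = q * m" by (elim dvdE)
        hence "m \<in> A P" using n nd by (auto simp: A_def)
        thus ?thesis using m by auto
      qed (use n in \<open>auto simp: A_def\<close>)
    next
      fix n assume "n \<in> A (insert q P) \<union> (\<lambda>n. q * n) ` A P"
      thus "n \<in> A P" using nd prime_gt_0_nat[OF q] by (auto simp: A_def)
    qed
    have disj: "A (insert q P) \<inter> (\<lambda>n. q * n) ` A P = {}" by (auto simp: A_def)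
    have inj: "inj_on (\<lambda>n. q * n) (A P)" using prime_gt_0_nat[OF q] by (auto simp: inj_on_def)
    have "infsum ?f ((\<lambda>n. q * n) ` A P) = infsum (\<lambda>n. ?f (q * n)) (A P)"
      using infsum_reindex[OF inj, of ?f] by (simp add: o_def)
    also have "\<dots> = infsum (\<lambda>n. ?f q * ?f n) (A P)"
    proof (rule infsum_cong)
      fix n
      show "?f (q * n) = ?f q * ?f n"
        using powr_times_real[of "of_nat q" "of_nat n" "- s"] by simp
    qed
    also have "\<dots> = 0" using IH by (simp add: infsum_cmult_right')
    finally have "infsum ?f ((\<lambda>n. q * n) ` A P) = 0" .
    moreover have "infsum ?f (A P) = infsum ?f (A (insert q P)) + infsum ?f ((\<lambda>n. q * n) ` A P)"
      by (subst split) (rule infsum_Un_disjoint[OF sm sm disj])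
    ultimately show ?case using IH by simp
  qed (rule base)
  obtain N where N: "\<And>n. n \<ge> N \<Longrightarrow> norm (\<Sum>i. ?g (i + n)) < 1"
    using suminf_exist_split[OF zero_less_one sg] by auto
  define P where "P = {p::nat. prime p \<and> p \<le> N}"
  have P: "finite P" "\<And>p. p \<in> P \<Longrightarrow> prime p" by (auto simp: P_def)
  define B where "B = A P - {1}"
  have "1 \<in> A P" using P(2)[of "Suc 0"] by (auto simp: A_def)
  hence AB: "A P = {1} \<union> B" by (auto simp: B_def)
  have BN: "n > N" if "n \<in> B" for n
  proof (rule ccontr)
    assume "\<not> n > N"
    have n: "n > 0" "n \<noteq> 1" "\<forall>p\<in>P. \<not> p dvd n" using that by (auto simp: B_def A_def)
    then obtain p where p: "prime p" "p dvd n" using prime_factor_nat by blast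
    hence "p \<le> N" using n dvd_imp_le[of p n] \<open>\<not> n > N\<close> by linarith
    thus False using p n by (auto simp: P_def)
  qed
  have "infsum ?f (A P) = 0" using P by (intro sieve) auto
  moreover have "infsum ?f ({1} \<union> B) = infsum ?f {1} + infsum ?f B"
    by (rule infsum_Un_disjoint[OF sm sm]) (auto simp: B_def)
  ultimately have "0 = infsum ?f {1} + infsum ?f B" unfolding AB by simp
  hence B1: "infsum ?f B = - 1" by (simp add: eq_neg_iff_add_eq_0 add.commute)
  have "norm (infsum ?f B) \<le> infsum (\<lambda>n. norm (?f n)) B"
    by (rule norm_infsum_bound) (use abs summable_on_subset_banach in blast)
  also have "\<dots> \<le> (\<Sum>i. ?g (i + N))"
  proof (rule infsum_le_finite_sums)
    show "(\<lambda>n. norm (?f n)) summable_on B" using abs summable_on_subset_banach by blast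
    fix F assume F: "finite F" "F \<subseteq> B"
    have F': "F = (\<lambda>i. i + N) ` ((\<lambda>n. n - N) ` F)"
      using BN F(2) by (force simp: image_image)
    have "(\<Sum>n\<in>F. norm (?f n)) = (\<Sum>n\<in>F. ?g n)"
      using F(2) by (intro sum.cong refl nrm) (auto simp: B_def A_def)
    also have "\<dots> = (\<Sum>i\<in>(\<lambda>n. n - N) ` F. ?g (i + N))"
      by (subst F', subst sum.reindex) (auto simp: o_def)
    also have "\<dots> \<le> (\<Sum>i. ?g (i + N))"
    proof (rule sum_le_suminf)
      show "summable (\<lambda>i. ?g (i + N))" using sg by (subst summable_iff_shift)
    qed (use F(1) in auto)
    finally show "(\<Sum>n\<in>F. norm (?f n)) \<le> (\<Sum>i. ?g (i + N))" .
  qed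
  also have "\<dots> < 1" using N[of N] by simp
  finally show False unfolding B1 by simp
qed

text \<open>A function without zeros on a disc has a holomorphic logarithm there. Normalised at the
  centre, its real part is below L; this one-sided bound controls its modulus on a smaller disc,
  hence its real part from below as well.\<close>

lemma borel_caratheodory_lower:
  fixes f :: "complex \<Rightarrow> complex"
  assumes holf: "f holomorphic_on ball w r" and r: "r > 0"
    and nz: "\<And>z. z \<in> ball w r \<Longrightarrow> f z \<noteq> 0"
    and M: "\<And>z. z \<in> ball w r \<Longrightarrow> norm (f z) \<le> M"
    and L: "L > 0" "M < exp L * norm (f w)"
    and th: "0 \<le> \<theta>" "\<theta> < 1" "norm (z - w) \<le> \<theta> * r"
  shows "norm (f z) \<ge> norm (f w) * exp (- (2 * \<theta> / (1 - \<theta>)) * L)"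
proof -
  have fw: "f w \<noteq> 0" using nz r by simp
  define F where "F = (\<lambda>u. f (w + of_real r * u) / f w)"
  have inb: "w + of_real r * u \<in> ball w r" if "u \<in> ball 0 1" for u
    using that r by (simp add: dist_norm norm_mult)
  have F: "F holomorphic_on ball 0 1" unfolding F_def
    by (intro holomorphic_intros holomorphic_on_compose_gen[OF _ holf, unfolded o_def]) (use inb fw in auto)
  have Fnz: "F u \<noteq> 0" if "u \<in> ball 0 1" for u using nz[OF inb[OF that]] fw by (simp add: F_def)
  have "convex (ball (0::complex) 1)" by simp
  then obtain g0 where g0: "g0 holomorphic_on ball 0 1" "\<And>u. u \<in> ball 0 1 \<Longrightarrow> F u = exp (g0 u)"
    using simply_connected_eq_holomorphic_log[OF open_ball, of 0 1] convex_imp_simply_connected F Fnz by metis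
  define g where "g = (\<lambda>u. g0 u - g0 0)"
  have "F 0 = 1" using fw by (simp add: F_def)
  hence g: "g holomorphic_on ball 0 1" "g 0 = 0" "\<And>u. u \<in> ball 0 1 \<Longrightarrow> F u = exp (g u)"
    using g0 g0(2)[of 0] by (auto simp: g_def exp_diff intro!: holomorphic_intros)
  have Reg: "Re (g u) < L" if "u \<in> ball 0 1" for u
  proof -
    have "exp (Re (g u)) = norm (F u)" using g(3)[OF that] by simp
    also have "\<dots> \<le> M / norm (f w)" using M[OF inb[OF that]] by (simp add: F_def norm_divide divide_right_mono)
    also have "\<dots> < exp L" using L fw by (simp add: field_simps)
    finally show ?thesis by simp
  qed
  \<comment> \<open>Re g < L makes g / (2L - g) a self-map of the disc fixing 0, so the Schwarz lemma applies.\<close>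
  define \<phi> where "\<phi> = (\<lambda>u. g u / (2 * of_real L - g u))"
  have dn: "2 * of_real L - g u \<noteq> 0" if "u \<in> ball 0 1" for u
    using Reg[OF that] L by (auto simp: complex_eq_iff)
  have phi: "\<phi> holomorphic_on ball 0 1" unfolding \<phi>_def by (intro holomorphic_intros g) (use dn in auto)
  have phi1: "norm (\<phi> u) < 1" if "norm u < 1" for u
  proof -
    have u: "u \<in> ball 0 1" using that by simp
    \<comment> \<open>The difference of the two squares is 4 L (L - Re g), positive by
      \<open>Reg\<close>.\<close>
    have "(norm (g u))\<^sup>2 < (norm (2 * of_real L - g u))\<^sup>2"
      using mult_strict_left_mono[OF Reg[OF u] L(1)] unfolding cmod_power2 by (simp add: power2_eq_square algebra_simps)
    hence "norm (g u) < norm (2 * of_real L - g u)" by (rule power_less_imp_less_base) simp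
    thus ?thesis using dn[OF u] by (simp add: \<phi>_def norm_divide)
  qed
  define u where "u = (z - w) / of_real r"
  have nu: "norm u \<le> \<theta>" using th r by (simp add: u_def norm_divide field_simps)
  have u: "u \<in> ball 0 1" using nu th by simp
  have "norm (\<phi> u) \<le> norm u"
    by (rule Schwarz_Lemma(1)[OF phi]) (use phi1 g(2) u in \<open>auto simp: \<phi>_def\<close>)
  hence "norm (\<phi> u) \<le> \<theta>" using nu by simp
  hence "norm (g u) \<le> \<theta> * norm (2 * of_real L - g u)"
    using dn[OF u] by (simp add: \<phi>_def norm_divide divide_le_eq)
  also have "norm (2 * of_real L - g u) \<le> 2 * L + norm (g u)"
    using norm_triangle_ineq4[of "2 * of_real L" "g u"] L by (simp add: norm_mult)
  hence "\<theta> * norm (2 * of_real L - g u) \<le> \<theta> * (2 * L + norm (g u))" using th by (intro mult_left_mono)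
  finally have "norm (g u) * (1 - \<theta>) \<le> 2 * \<theta> * L" by (simp add: algebra_simps)
  hence "norm (g u) \<le> 2 * \<theta> / (1 - \<theta>) * L" using th by (simp add: field_simps)
  hence "Re (g u) \<ge> - (2 * \<theta> / (1 - \<theta>)) * L" using abs_Re_le_cmod[of "g u"] by simp
  hence "exp (- (2 * \<theta> / (1 - \<theta>)) * L) \<le> exp (Re (g u))" by simp
  also have "\<dots> = norm (F u)" using g(3)[OF u] by simp
  also have "\<dots> = norm (f z) / norm (f w)" using r by (simp add: F_def u_def norm_divide)
  finally show ?thesis using fw by (simp add: field_simps)
qed

text \<open>\<open>borel_caratheodory_lower\<close> converts polynomial growth of zeta on discs
  about 3 + it into a polynomial bound for 1/zeta. Heights |Im z| >= 4 keep these discs away from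
  the pole; Re z >= 3 is covered by \<open>norm_zeta_ge\<close>, and a compact rectangle
  remains.\<close>

lemma inverse_zeta_bound:
  assumes RH: "\<And>s. Re s > 1/2 \<Longrightarrow> zeta_reg s \<noteq> 0" and d: "\<delta> > 0"
  shows "\<exists>C A. \<forall>s. Re s \<ge> 1/2 + \<delta> \<longrightarrow> norm (inverse (zeta s)) \<le> C * (1 + \<bar>Im s\<bar>) ^ A"
proof (cases "\<delta> < 5/2")
  case False
  show ?thesis
  proof (intro exI allI impI)
    fix s assume "Re s \<ge> 1/2 + \<delta>"
    hence "norm (zeta s) \<ge> 1/6" using False by (intro norm_zeta_ge) auto
    from le_imp_inverse_le[OF this] show "norm (inverse (zeta s)) \<le> 6 * (1 + \<bar>Im s\<bar>) ^ 0"
      by (simp add: norm_inverse)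
  qed
next
  case True
  obtain K where K: "K \<ge> 0" "\<And>s. Re s \<ge> 1/2 \<Longrightarrow> norm (zeta_reg s) \<le> 1 + K * norm (s - 1) * norm s"
    using norm_zeta_reg_le by blast
  \<comment> \<open>Discs of radius 5/2 about 3 + it touch the line Re = 1/2; the concentric discs
    of radius 5/2 - \<delta> reach exactly to Re = 1/2 + \<delta>.\<close>
  define \<theta> where "\<theta> = (5/2 - \<delta>) / (5/2)"
  have th: "0 \<le> \<theta>" "\<theta> < 1" using d True by (auto simp: \<theta>_def)
  define \<kappa> where "\<kappa> = 2 * \<theta> / (1 - \<theta>)"
  have ka: "\<kappa> \<ge> 0" using th by (simp add: \<kappa>_def)
  define C1 where "C1 = 7 * exp 1 * (2 + 7 * K)"
  have C1: "C1 \<ge> 1"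
  proof -
    have "1 * 1 \<le> exp (1::real) * (2 + 7 * K)" using K by (intro mult_mono) auto
    thus ?thesis by (simp add: C1_def)
  qed
  obtain A :: nat where A: "real A \<ge> \<kappa>" using real_arch_simple by blast
  have far: "norm (inverse (zeta z)) \<le> 6 * (C1 * (1 + \<bar>Im z\<bar>)) ^ A"
    if z: "Re z \<ge> 1/2 + \<delta>" "Re z \<le> 3" "\<bar>Im z\<bar> \<ge> 4" for z
  proof -
    define w where "w = Complex 3 (Im z)"
    have ball: "Re y > 1/2" "\<bar>Im y\<bar> > 1" "norm y \<le> \<bar>Im z\<bar> + 6" if "y \<in> ball w (5/2)" for y
    proof -
      have n: "norm (y - w) < 5/2" using that by (simp add: dist_norm norm_minus_commute)
      have "\<bar>Re (y - w)\<bar> < 5/2" "\<bar>Im (y - w)\<bar> < 5/2"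
        using abs_Re_le_cmod[of "y - w"] abs_Im_le_cmod[of "y - w"] n by linarith+
      hence "\<bar>Re y - 3\<bar> < 5/2" "\<bar>Im y - Im z\<bar> < 5/2" by (simp_all add: w_def)
      thus "Re y > 1/2" "\<bar>Im y\<bar> > 1" using z by linarith+
      have "norm w \<le> 3 + \<bar>Im z\<bar>" using cmod_le[of w] by (simp add: w_def)
      thus "norm y \<le> \<bar>Im z\<bar> + 6" using n norm_triangle_sub[of y w] by simp
    qed
    have y1: "y - 1 \<noteq> 0" "norm (y - 1) \<ge> 1" if "y \<in> ball w (5/2)" for y
    proof -
      show "norm (y - 1) \<ge> 1" using ball(2)[OF that] abs_Im_le_cmod[of "y - 1"] by simp
      thus "y - 1 \<noteq> 0" by auto
    qed
    define M where "M = 1 + K * (\<bar>Im z\<bar> + 6)"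
    have M: "norm (zeta y) \<le> M" if "y \<in> ball w (5/2)" for y
    proof -
      note b = ball[OF that] and y = y1[OF that]
      have "norm (zeta y) = norm (zeta_reg y) / norm (y - 1)" by (simp add: zeta_eq norm_divide)
      also have "\<dots> \<le> (1 + K * norm (y - 1) * norm y) / norm (y - 1)"
        using K(2)[of y] b by (intro divide_right_mono) auto
      also have "\<dots> = 1 / norm (y - 1) + K * norm y" using y by (simp add: add_divide_distrib)
      also have "\<dots> \<le> 1 + K * (\<bar>Im z\<bar> + 6)"
        using y b K by (intro add_mono mult_left_mono) auto
      finally show ?thesis by (simp add: M_def)
    qed
    have M1: "M \<ge> 1" using K by (simp add: M_def)
    have zw: "norm (zeta w) \<ge> 1/6" by (rule norm_zeta_ge) (simp add: w_def)
    \<comment> \<open>exp L must exceed M / |zeta w|, which is at most 6 M. The choice exp L = 7 e M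
      is linear in |Im z|, so its powers are polynomial.\<close>
    define L where "L = ln (7 * M) + 1"
    have "ln (7 * M) \<ge> 0" using M1 by simp
    hence L0: "L > 0" by (simp add: L_def)
    have eL: "exp L = 7 * M * exp 1" using M1 by (simp add: L_def exp_add)
    have L: "M < exp L * norm (zeta w)"
    proof -
      have "M < 7 * M * 1 * (1/6)" using M1 by simp
      also have "\<dots> \<le> 7 * M * exp 1 * norm (zeta w)"
        using M1 zw by (intro mult_mono) auto
      finally show ?thesis unfolding eL .
    qed
    have hol: "zeta holomorphic_on ball w (5/2)"
      unfolding zeta_eq[abs_def] by (intro holomorphic_intros) (use y1 in auto)
    have nz: "zeta y \<noteq> 0" if "y \<in> ball w (5/2)" for y
      using RH[OF ball(1)[OF that]] y1[OF that] by (simp add: zeta_eq)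
    have "norm (z - w) = \<bar>Re z - 3\<bar>" by (simp add: w_def cmod_def)
    hence zt: "norm (z - w) \<le> \<theta> * (5/2)" using z by (simp add: \<theta>_def)
    have "norm (zeta z) \<ge> norm (zeta w) * exp (- \<kappa> * L)"
      unfolding \<kappa>_def using borel_caratheodory_lower[OF hol _ nz M L0 L th zt] by simp
    moreover have "norm (zeta w) * exp (- \<kappa> * L) \<ge> (1/6) * exp (- \<kappa> * L)"
      using zw by (intro mult_right_mono) auto
    ultimately have "norm (zeta z) \<ge> (1/6) * exp (- \<kappa> * L)" by linarith
    hence "inverse (norm (zeta z)) \<le> inverse ((1/6) * exp (- \<kappa> * L))" by (rule le_imp_inverse_le) simp
    also have "\<dots> = 6 * exp (\<kappa> * L)" by (simp add: exp_minus field_simps)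
    also have "exp (\<kappa> * L) \<le> exp (real A * L)" using A L0 by simp
    also have "\<dots> = (7 * M * exp 1) ^ A" unfolding eL[symmetric] by (simp add: exp_of_nat_mult)
    also have "\<dots> \<le> (C1 * (1 + \<bar>Im z\<bar>)) ^ A"
    proof (rule power_mono)
      have "M \<le> (2 + 7 * K) * (1 + \<bar>Im z\<bar>)" using K by (simp add: M_def algebra_simps)
      hence "7 * exp 1 * M \<le> 7 * exp 1 * ((2 + 7 * K) * (1 + \<bar>Im z\<bar>))" by (intro mult_left_mono) auto
      thus "7 * M * exp 1 \<le> C1 * (1 + \<bar>Im z\<bar>)" by (simp add: C1_def mult_ac)
    qed (use M1 in auto)
    finally show ?thesis by (simp add: norm_inverse)
  qed
  \<comment> \<open>The rectangle may contain the pole, where (z - 1) / \<open>zeta_reg z\<close> is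
    still continuous.\<close>
  define S where "S = {z. Re z \<ge> 1/2 + \<delta> \<and> Re z \<le> 3 \<and> \<bar>Im z\<bar> \<le> 4}"
  have "S = cbox (Complex (1/2 + \<delta>) (-4)) (Complex 3 4)" by (auto simp: S_def in_cbox_complex_iff abs_le_iff)
  hence "compact S" by simp
  hence "compact ((\<lambda>z. (z - 1) / zeta_reg z) ` S)"
    using RH d by (intro compact_continuous_image continuous_intros) (auto simp: S_def)
  hence "bounded ((\<lambda>z. (z - 1) / zeta_reg z) ` S)" by (rule compact_imp_bounded)
  then obtain B where B: "B > 0" "\<And>z. z \<in> S \<Longrightarrow> norm ((z - 1) / zeta_reg z) \<le> B"
    unfolding bounded_pos by blast
  have near: "norm (inverse (zeta z)) \<le> B" if "z \<in> S" for z
    using B(2)[OF that] by (simp add: zeta_eq)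
  show ?thesis
  proof (intro exI allI impI)
    fix s assume s: "Re s \<ge> 1/2 + \<delta>"
    have p1: "(1 + \<bar>Im s\<bar>) ^ A \<ge> 1" by (rule one_le_power) simp
    have c1: "C1 ^ A \<ge> 1" using C1 by (rule one_le_power)
    consider "Re s \<ge> 3" | "s \<in> S" | "Re s \<le> 3" "\<bar>Im s\<bar> \<ge> 4" using s by (force simp: S_def)
    hence "norm (inverse (zeta s)) \<le> B * (1 + \<bar>Im s\<bar>) ^ A \<or> norm (inverse (zeta s)) \<le> (6 * C1 ^ A) * (1 + \<bar>Im s\<bar>) ^ A"
    proof cases
      case 1
      have "norm (inverse (zeta s)) \<le> 6" using le_imp_inverse_le[OF norm_zeta_ge[OF 1]] by (simp add: norm_inverse)
      also have "6 \<le> 6 * (C1 ^ A * (1 + \<bar>Im s\<bar>) ^ A)" using mult_mono[OF c1 p1] c1 by simp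
      finally show ?thesis by (simp add: mult_ac)
    next
      case 2
      have "norm (inverse (zeta s)) \<le> B * 1" using near[OF 2] by simp
      also have "\<dots> \<le> B * (1 + \<bar>Im s\<bar>) ^ A" using p1 B by (intro mult_left_mono) auto
      finally show ?thesis by simp
    next
      case 3
      thus ?thesis using far[of s] s by (simp add: power_mult_distrib mult_ac)
    qed
    moreover have "B * (1 + \<bar>Im s\<bar>) ^ A \<le> (B + 6 * C1 ^ A) * (1 + \<bar>Im s\<bar>) ^ A"
      "(6 * C1 ^ A) * (1 + \<bar>Im s\<bar>) ^ A \<le> (B + 6 * C1 ^ A) * (1 + \<bar>Im s\<bar>) ^ A"
      using B C1 by (intro mult_right_mono, auto)+
    ultimately show "norm (inverse (zeta s)) \<le> (B + 6 * C1 ^ A) * (1 + \<bar>Im s\<bar>) ^ A" by linarith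
  qed
qed


section \<open>Zeta at real arguments and convergence of the Riesz series\<close>

lemma zeta_of_real:
  assumes "a > 1"
  shows "(\<lambda>k. real (Suc k) powr (- a)) sums Re (zeta (of_real a))"
    "Re (zeta (of_real a)) \<ge> 1" "zeta (of_real a) = of_real (Re (zeta (of_real a)))"
proof -
  have sm: "summable (\<lambda>k. real (Suc k) powr (- a))" by (rule summable_Suc_powr) fact
  have "of_nat (Suc k) powr (- complex_of_real a) = of_real (real (Suc k) powr (- a))" for k
    using powr_of_real[of "real (Suc k)" "- a"] by simp
  hence z: "zeta (of_real a) = of_real (\<Sum>k. real (Suc k) powr (- a))"
    using zeta_eq_series[of "of_real a"] assms by (simp only: suminf_of_real[OF sm]) simp
  show "zeta (of_real a) = of_real (Re (zeta (of_real a)))" unfolding z by simp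
  show s: "(\<lambda>k. real (Suc k) powr (- a)) sums Re (zeta (of_real a))"
    unfolding z Re_complex_of_real by (rule summable_sums[OF sm])
  have "(\<Sum>k<1. real (Suc k) powr (- a)) \<le> (\<Sum>k. real (Suc k) powr (- a))"
    by (intro sum_le_suminf sm) auto
  thus "Re (zeta (of_real a)) \<ge> 1" unfolding z by simp
qed

definition riesz_term :: "real \<Rightarrow> nat \<Rightarrow> real \<Rightarrow> real" where
  "riesz_term c n x = (-1) ^ n * x ^ Suc n / (fact n * Re (zeta (of_real (c * real (Suc n)))))"

lemma Riesz_eq: "Riesz c x = (\<Sum>n. riesz_term c n x)"
  by (simp add: Riesz_def riesz_term_def)

lemma riesz_zeta_arg_gt_1:
  assumes "c > 1"
  shows "c * real (Suc n) > 1"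
proof -
  have "c * 1 \<le> c * real (Suc n)" using assms by (intro mult_left_mono) auto
  thus ?thesis using assms by linarith
qed

lemma abs_riesz_term_le:
  assumes "c > 1" "x \<ge> 0"
  shows "\<bar>riesz_term c n x\<bar> \<le> x * (x ^ n / fact n)"
proof -
  let ?z = "Re (zeta (of_real (c * real (Suc n))))"
  have z: "?z \<ge> 1" by (rule zeta_of_real(2)[OF riesz_zeta_arg_gt_1[OF assms(1)]])
  have "\<bar>riesz_term c n x\<bar> = x ^ Suc n / (fact n * ?z)"
    using assms z by (simp add: riesz_term_def abs_mult power_abs)
  also have "\<dots> \<le> x ^ Suc n / (fact n * 1)"
    using assms z by (intro divide_left_mono mult_left_mono mult_pos_pos) auto
  finally show ?thesis by simp
qed

lemma exp_sums: "(\<lambda>n. x ^ n / fact n) sums exp (x::real)"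
  using exp_converges[of x] by (simp add: field_simps)

lemma summable_riesz_term:
  assumes "c > 1" "x \<ge> 0"
  shows "summable (\<lambda>n. riesz_term c n x)"
  by (rule summable_comparison_test'[of "\<lambda>n. x * (x ^ n / fact n)" 0])
     (use sums_summable[OF sums_mult[OF exp_sums[of x], of x]] abs_riesz_term_le[OF assms] in auto)

lemma abs_Riesz_le:
  assumes "c > 1" "x \<ge> 0"
  shows "\<bar>Riesz c x\<bar> \<le> x * exp x"
proof -
  have s: "(\<lambda>n. x * (x ^ n / fact n)) sums (x * exp x)" by (intro sums_mult exp_sums)
  have "norm (\<Sum>n. riesz_term c n x) \<le> (\<Sum>n. x * (x ^ n / fact n))"
    using abs_riesz_term_le[OF assms] s by (intro norm_suminf_le) (auto simp: sums_iff)
  thus ?thesis using s by (simp add: sums_iff Riesz_eq)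
qed

section \<open>The Riesz function as a line integral\<close>

lemma norm_Gamma_le:
  assumes "Re s > 0"
  shows "norm (Gamma s) \<le> Gamma (Re s)"
proof -
  have "norm (mellin (\<lambda>x. exp (- x)) s) \<le> (LINT x:{0<..}|lborel. \<bar>exp (- x)\<bar> * x powr (Re s - 1))"
    by (rule norm_mellin_le[OF mellin_exp(2)[OF assms]])
  also have "\<dots> = (LINT x:{0<..}|lborel. exp (- x) * x powr (Re s - 1))" by simp
  also have "\<dots> = Gamma (Re s)"
  proof -
    have "complex_of_real (LINT x:{0<..}|lborel. exp (- x) * x powr (Re s - 1)) = Gamma (of_real (Re s))"
      unfolding mellin_of_real[symmetric] using assms by (intro mellin_exp(1)) simp
    thus ?thesis unfolding Gamma_complex_of_real of_real_eq_iff .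
  qed
  finally show ?thesis using mellin_exp(1)[OF assms] by simp
qed

lemma norm_pochhammer_ge:
  fixes z :: complex
  shows "\<bar>Im z\<bar> ^ n \<le> norm (pochhammer z n)"
proof -
  have "\<bar>Im z\<bar> ^ n = (\<Prod>i<n. \<bar>Im z\<bar>)" by simp
  also have "\<dots> \<le> (\<Prod>i<n. norm (z + of_nat i))"
  proof (intro prod_mono conjI)
    show "\<bar>Im z\<bar> \<le> norm (z + of_nat i)" for i using abs_Im_le_cmod[of "z + of_nat i"] by simp
  qed auto
  also have "\<dots> = norm (pochhammer z n)"
    by (simp add: pochhammer_prod prod_norm atLeast0LessThan)
  finally show ?thesis .
qed

text \<open>Gamma(s) = Gamma(s + k) / (s (s + 1) ... (s + k - 1)). Every factor of the denominator
  has modulus at least |Im s|, and k is taken large enough both for the power N and for Re (s + k)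
  >= 1, where Gamma is bounded on the strip.\<close>

lemma Gamma_decay:
  "\<exists>C\<ge>0. \<forall>s. a \<le> Re s \<and> Re s \<le> b \<and> \<bar>Im s\<bar> \<ge> 1 \<longrightarrow> norm (Gamma s) \<le> C / \<bar>Im s\<bar> ^ N"
proof -
  obtain k0 :: nat where k0: "real k0 \<ge> 1 - a" using real_arch_simple by blast
  define k where "k = k0 + N"
  have k: "a + real k \<ge> 1" "k \<ge> N" using k0 by (auto simp: k_def)
  have "compact ((\<lambda>x. Gamma x :: real) ` {a + real k..b + real k})"
    using k by (intro compact_continuous_image continuous_intros) (auto elim!: nonpos_Ints_cases)
  hence "bounded ((\<lambda>x. Gamma x :: real) ` {a + real k..b + real k})" by (rule compact_imp_bounded)
  then obtain B where B: "B > 0" "\<And>x. x \<in> {a + real k..b + real k} \<Longrightarrow> norm (Gamma x :: real) \<le> B"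
    unfolding bounded_pos by blast
  show ?thesis
  proof (intro exI[of _ B] conjI allI impI)
    show "B \<ge> 0" using B by simp
    fix s assume s: "a \<le> Re s \<and> Re s \<le> b \<and> \<bar>Im s\<bar> \<ge> 1"
    have ni: "s \<notin> \<int>\<^sub>\<le>\<^sub>0" using s by (auto elim!: nonpos_Ints_cases)
    have G: "pochhammer s k * Gamma s = Gamma (s + of_nat k)"
      using pochhammer_Gamma[OF ni, of k] Gamma_nonzero[OF ni] by simp
    have "norm (Gamma (s + of_nat k)) \<le> Gamma (Re (s + of_nat k))" using s k by (intro norm_Gamma_le) auto
    also have "\<dots> \<le> B" using B(2)[of "Re (s + of_nat k)"] s by simp
    finally have 1: "norm (pochhammer s k) * norm (Gamma s) \<le> B" unfolding G[symmetric] norm_mult .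
    have "\<bar>Im s\<bar> ^ N \<le> \<bar>Im s\<bar> ^ k" using s k by (intro power_increasing) auto
    also have "\<dots> \<le> norm (pochhammer s k)" by (rule norm_pochhammer_ge)
    finally have "\<bar>Im s\<bar> ^ N * norm (Gamma s) \<le> B" using 1
      by (meson mult_right_mono norm_ge_zero order_trans)
    thus "norm (Gamma s) \<le> B / \<bar>Im s\<bar> ^ N" 
      using s by (subst pos_le_divide_eq) (auto simp: mult.commute)
  qed
qed

lemma integrable_quadratic_decay:
  fixes g :: "real \<Rightarrow> complex"
  assumes cont: "continuous_on UNIV g" and C: "\<And>t. \<bar>t\<bar> \<ge> 1 \<Longrightarrow> norm (g t) \<le> C / t\<^sup>2"
  shows "integrable lborel g"
proof -
  have "compact (g ` {-1..1})" by (intro compact_continuous_image continuous_on_subset[OF cont]) auto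
  hence "bounded (g ` {-1..1})" by (rule compact_imp_bounded)
  then obtain B where B: "B > 0" "\<And>t. t \<in> {-1..1} \<Longrightarrow> norm (g t) \<le> B" unfolding bounded_pos by blast
  have C0: "C \<ge> 0" using C[of 1] norm_ge_zero[of "g 1"] by (simp del: norm_ge_zero)
  show ?thesis
  proof (rule Bochner_Integration.integrable_bound)
    have "integrable lborel (\<lambda>t::real. inverse (1 + t\<^sup>2))"
      using integrable_inverse_1_plus_square by (simp add: set_integrable_def)
    thus "integrable lborel (\<lambda>t. (2 * B + 2 * C) * inverse (1 + t\<^sup>2))" by (rule integrable_mult_right)
    show "g \<in> borel_measurable lborel" using borel_measurable_continuous_onI[OF cont] by simp
    show "AE t in lborel. norm (g t) \<le> norm ((2 * B + 2 * C) * inverse (1 + t\<^sup>2))"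
    proof (rule AE_I2)
      fix t :: real
      have p: "1 + t\<^sup>2 > 0" by (simp add: add_pos_nonneg)
      have "norm (g t) * (1 + t\<^sup>2) \<le> 2 * B + 2 * C"
      proof (cases "\<bar>t\<bar> \<le> 1")
        case True
        hence "t\<^sup>2 \<le> 1" by (simp add: abs_square_le_1)
        hence "norm (g t) * (1 + t\<^sup>2) \<le> B * 2" using B(2)[of t] B(1) True by (intro mult_mono) (auto simp: abs_le_iff)
        thus ?thesis using C0 by simp
      next
        case False
        hence t2: "t\<^sup>2 \<ge> 1" using abs_square_le_1[of t] by linarith
        have "norm (g t) * (1 + t\<^sup>2) \<le> C / t\<^sup>2 * (1 + t\<^sup>2)" using C[of t] False p by (intro mult_right_mono) auto
        also have "\<dots> = C * (1 / t\<^sup>2 + 1)" using t2 by (cases "t = 0") (auto simp: field_simps)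
        also have "\<dots> \<le> C * 2" using t2 C0 by (intro mult_left_mono) (auto simp: divide_le_eq)
        finally show ?thesis using B by simp
      qed
      hence "norm (g t) \<le> (2 * B + 2 * C) * inverse (1 + t\<^sup>2)" using p by (simp add: field_simps)
      thus "norm (g t) \<le> norm ((2 * B + 2 * C) * inverse (1 + t\<^sup>2))"
        unfolding real_norm_def by (rule order_trans[OF _ abs_ge_self])
    qed
  qed
qed

lemma integral_symmetric_limit:
  fixes g :: "real \<Rightarrow> complex"
  assumes "integrable lborel g"
  shows "(\<lambda>n. integral {- real n..real n} g) \<longlonglongrightarrow> integral\<^sup>L lborel g"
proof -
  have "(\<lambda>n. LINT t|lborel. indicator {- real n..real n} t *\<^sub>R g t) \<longlonglongrightarrow> integral\<^sup>L lborel g"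
  proof (rule integral_dominated_convergence[where w = "\<lambda>t. norm (g t)"])
    show "AE t in lborel. (\<lambda>n. indicator {- real n..real n} t *\<^sub>R g t) \<longlonglongrightarrow> g t"
    proof (rule AE_I2, rule tendsto_eventually)
      fix t :: real
      show "\<forall>\<^sub>F n in sequentially. indicator {- real n..real n} t *\<^sub>R g t = g t"
        using eventually_ge_at_top[of "nat \<lceil>\<bar>t\<bar>\<rceil>"]
      proof eventually_elim
        case (elim n)
        hence "\<bar>t\<bar> \<le> real n" by (simp only: nat_ceiling_le_eq)
        thus ?case by (auto simp: indicator_def)
      qed
    qed
  qed (use assms in \<open>auto simp: indicator_def\<close>)
  moreover have "(LINT t|lborel. indicator {- real n..real n} t *\<^sub>R g t) = integral {- real n..real n} g" for n
  proof -
    have "set_integrable lborel {- real n..real n} g"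
      unfolding set_integrable_def using assms by (intro integrable_mult_indicator) auto
    from set_borel_integral_eq_integral(2)[OF this] show ?thesis by (simp add: set_lebesgue_integral_def)
  qed
  ultimately show ?thesis by simp
qed

text \<open>Residue theorem on the rectangle of height 2T with T = n; the horizontal sides are
  O(1/T^2). Since dz = i dt on vertical lines, the factor i of the residue theorem cancels.\<close>

lemma vertical_line_shift:
  fixes f :: "complex \<Rightarrow> complex"
  assumes hol: "f holomorphic_on {s. a' < Re s \<and> Re s < b'} - {of_real p}"
    and ord: "a' < a" "a < p" "p < b" "b < b'"
    and C: "\<And>s. a \<le> Re s \<Longrightarrow> Re s \<le> b \<Longrightarrow> \<bar>Im s\<bar> \<ge> 1 \<Longrightarrow> norm (f s) \<le> C / (Im s)\<^sup>2"
  shows "(LINT t|lborel. f (Complex b t)) - (LINT t|lborel. f (Complex a t)) = 2 * pi * residue f (of_real p)"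
proof -
  let ?S = "{s. a' < Re s \<and> Re s < b'}"
  have op: "open ?S" by (intro open_Collect_conj open_halfspace_Re_gt open_halfspace_Re_lt)
  have cn: "connected ?S"
    unfolding Collect_conj_eq by (intro convex_connected convex_Int convex_halfspace_Re_gt convex_halfspace_Re_lt)
  have contf: "continuous_on (?S - {of_real p}) f" by (rule holomorphic_on_imp_continuous_on[OF hol])
  have cvert: "continuous_on UNIV (\<lambda>t. f (Complex r t))" if "r = a \<or> r = b" for r
    by (rule continuous_on_compose2[OF contf]) (use that ord in \<open>auto intro!: continuous_intros simp: Complex_eq complex_eq_iff\<close>)
  have ivert: "integrable lborel (\<lambda>t. f (Complex r t))" if "r = a \<or> r = b" for r
  proof (rule integrable_quadratic_decay[OF cvert[OF that], where C = C])
    show "norm (f (Complex r t)) \<le> C / t\<^sup>2" if "\<bar>t\<bar> \<ge> 1" for t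
      using C[of "Complex r t"] ord \<open>r = a \<or> r = b\<close> that by auto
  qed
  have C0: "C \<ge> 0" using C[of "Complex a 1"] norm_ge_zero[of "f (Complex a 1)"] ord by (simp del: norm_ge_zero)
  let ?I = "\<lambda>r n. integral {- real n..real n} (\<lambda>t. f (Complex r t))"
  have main: "norm (?I b n - ?I a n - 2 * pi * residue f (of_real p)) \<le> 2 * (C / (real n)\<^sup>2 * (b - a))" if n: "n \<ge> 1" for n
  proof -
    define T where "T = real n"
    have T: "T \<ge> 1" using n by (simp add: T_def)
    define z1 z2 z3 z4 where "z1 = Complex a (- T)" and "z2 = Complex b (- T)" and "z3 = Complex b T" and "z4 = Complex a T"
    note z = z1_def z2_def z3_def z4_def
    have rp: "rectpath z1 z3 = linepath z1 z2 +++ linepath z2 z3 +++ linepath z3 z4 +++ linepath z4 z1"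
      by (simp add: rectpath_def Let_def z)
    have seg: "closed_segment z1 z2 \<subseteq> ?S - {of_real p}" "closed_segment z2 z3 \<subseteq> ?S - {of_real p}"
        "closed_segment z3 z4 \<subseteq> ?S - {of_real p}" "closed_segment z4 z1 \<subseteq> ?S - {of_real p}"
      using ord T by (auto simp: z closed_segment_same_Re closed_segment_same_Im closed_segment_eq_real_ivl complex_eq_iff)
    have ci: "f contour_integrable_on linepath z1 z2" "f contour_integrable_on linepath z2 z3"
        "f contour_integrable_on linepath z3 z4" "f contour_integrable_on linepath z4 z1"
      by (intro contour_integrable_continuous_linepath continuous_on_subset[OF contf] seg)+
    have img: "path_image (rectpath z1 z3) \<subseteq> ?S - {of_real p}"
      using ord T by (subst path_image_rectpath) (auto simp: z complex_eq_iff)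
    have cb: "cbox z1 z3 \<subseteq> ?S" using ord by (auto simp: z in_cbox_complex_iff)
    have R: "contour_integral (rectpath z1 z3) f = 2 * pi * \<i> * (\<Sum>q\<in>{of_real p}. winding_number (rectpath z1 z3) q * residue f q)"
    proof (rule Residue_theorem[OF op cn])
      show "\<forall>w. w \<notin> ?S \<longrightarrow> winding_number (rectpath z1 z3) w = 0"
        using cb ord T by (auto intro!: winding_number_rectpath_outside simp: z)
    qed (use hol img in auto)
    have "winding_number (rectpath z1 z3) (of_real p) = 1"
      using ord T by (intro winding_number_rectpath) (auto simp: z in_box_complex_iff)
    hence w: "(\<Sum>q\<in>{of_real p}. winding_number (rectpath z1 z3) q * residue f q) = residue f (of_real p)" by simp
    with R have res: "contour_integral (rectpath z1 z3) f = 2 * pi * \<i> * residue f (of_real p)"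
      by (simp only:)
    have "contour_integral (rectpath z1 z3) f = contour_integral (linepath z1 z2) f + contour_integral (linepath z2 z3) f
        + contour_integral (linepath z3 z4) f + contour_integral (linepath z4 z1) f"
      unfolding rp using ci by (simp add: add.assoc contour_integrable_join)
    also have "contour_integral (linepath z2 z3) f = \<i> * ?I b n"
      using T by (subst contour_integral_linepath_same_Re[of _ b _ "-T" T]) (auto simp: z T_def)
    also have "contour_integral (linepath z4 z1) f = - contour_integral (linepath z1 z4) f"
      using continuous_on_subset[OF contf seg(4)] by (intro contour_integral_reverse_linepath)
    also have "contour_integral (linepath z1 z4) f = \<i> * ?I a n"
      using T by (subst contour_integral_linepath_same_Re[of _ a _ "-T" T]) (auto simp: z T_def)
    finally have "\<i> * (?I b n - ?I a n - 2 * pi * residue f (of_real p)) =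
        - (contour_integral (linepath z1 z2) f + contour_integral (linepath z3 z4) f)"
      unfolding res by (simp add: algebra_simps)
    hence "norm (\<i> * (?I b n - ?I a n - 2 * pi * residue f (of_real p))) =
        norm (contour_integral (linepath z1 z2) f + contour_integral (linepath z3 z4) f)"
      by (simp only: norm_minus_cancel)
    also have "\<dots> \<le> norm (contour_integral (linepath z1 z2) f) + norm (contour_integral (linepath z3 z4) f)"
      by (rule norm_triangle_ineq)
    also have "\<dots> \<le> C / T\<^sup>2 * norm (z2 - z1) + C / T\<^sup>2 * norm (z4 - z3)"
    proof (intro add_mono contour_integral_bound_linepath ci)
      fix w assume "w \<in> closed_segment z1 z2"
      hence "a \<le> Re w" "Re w \<le> b" "Im w = - T"
        using ord by (auto simp: z closed_segment_same_Im closed_segment_eq_real_ivl)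
      thus "norm (f w) \<le> C / T\<^sup>2" using C[of w] T by simp
    next
      fix w assume "w \<in> closed_segment z3 z4"
      hence "a \<le> Re w" "Re w \<le> b" "Im w = T"
        using ord by (auto simp: z closed_segment_same_Im closed_segment_eq_real_ivl)
      thus "norm (f w) \<le> C / T\<^sup>2" using C[of w] T by simp
    qed (use C0 in auto)
    also have "norm (z2 - z1) = b - a" using ord by (simp add: z cmod_def)
    also have "norm (z4 - z3) = b - a" using ord by (simp add: z cmod_def)
    finally show ?thesis by (simp add: norm_mult T_def)
  qed
  let ?J = "\<lambda>r. LINT t|lborel. f (Complex r t)"
  have "(\<lambda>n. ?I b n - ?I a n - 2 * pi * residue f (of_real p)) \<longlonglongrightarrow> ?J b - ?J a - 2 * pi * residue f (of_real p)"
    by (intro tendsto_intros integral_symmetric_limit ivert) auto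
  moreover have "(\<lambda>n. ?I b n - ?I a n - 2 * pi * residue f (of_real p)) \<longlonglongrightarrow> 0"
  proof (rule Lim_null_comparison)
    show "\<forall>\<^sub>F n in sequentially. norm (?I b n - ?I a n - 2 * pi * residue f (of_real p)) \<le> 2 * (C / (real n)\<^sup>2 * (b - a))"
      using eventually_ge_at_top[of 1] by eventually_elim (rule main)
    show "(\<lambda>n. 2 * (C / (real n)\<^sup>2 * (b - a))) \<longlonglongrightarrow> 0" by real_asymp
  qed
  ultimately have "?J b - ?J a - 2 * pi * residue f (of_real p) = 0" by (rule LIMSEQ_unique)
  thus ?thesis by simp
qed

section \<open>Shifting the line of integration when zeta has no zeros with real part above
  1/2\<close>

context
  fixes c :: real
  assumes c: "c > 1"
    and nz: "\<And>s. Re s > 1/2 \<Longrightarrow> zeta_reg s \<noteq> 0"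
begin

text \<open>The quotient form is holomorphic wherever \<open>zeta_reg\<close> does not vanish, the
  pole w = 1 included.\<close>

definition inv_zeta :: "complex \<Rightarrow> complex" where
  "inv_zeta w = (w - 1) / zeta_reg w"

text \<open>Valid at the pole w = 1 too, where \<open>zeta 1 = 0\<close> by convention and both sides are 0.\<close>
lemma inv_zeta_eq: "inv_zeta w = inverse (zeta w)"
  by (simp add: inv_zeta_def zeta_eq)

text \<open>The factor x^s is kept apart: on a vertical line its modulus is constant, so one
  integral of the kernel bounds the line integral for all x.\<close>

definition riesz_kernel :: "complex \<Rightarrow> complex" where
  "riesz_kernel s = Gamma (1 - s) * inv_zeta (of_real c * s)"

lemma one_minus_nonpos_IntD:
  assumes "1 - s \<in> \<int>\<^sub>\<le>\<^sub>0"
  shows "\<exists>n. s = of_nat (Suc n)"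
proof -
  obtain n where "1 - s = - of_nat n" using assms by (auto elim!: nonpos_Ints_cases')
  hence "s = of_nat (Suc n)" by (simp add: algebra_simps)
  thus ?thesis ..
qed

lemma half_less: "Re s > 1 / (2 * c) \<Longrightarrow> Re (of_real c * s) > 1/2"
  using c by (simp add: field_simps)

lemma riesz_kernel_holomorphic:
  assumes "\<And>s. s \<in> A \<Longrightarrow> Re s > 1 / (2 * c)" "\<And>n. of_nat (Suc n) \<notin> A"
  shows "riesz_kernel holomorphic_on A"
  unfolding riesz_kernel_def inv_zeta_def
  by (intro holomorphic_intros) (use assms one_minus_nonpos_IntD nz half_less in \<open>force+\<close>)

text \<open>If 1/zeta grows at most like |Im s|^A, decay of Gamma to order A + 2 leaves the
  quadratic decay needed for integrability.\<close>

lemma riesz_kernel_decay: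
  assumes "a > 1 / (2 * c)"
  shows "\<exists>C\<ge>0. \<forall>s. a \<le> Re s \<and> Re s \<le> b \<and> \<bar>Im s\<bar> \<ge> 1 \<longrightarrow> norm (riesz_kernel s) \<le> C / (Im s)\<^sup>2"
proof -
  define \<delta> where "\<delta> = c * a - 1/2"
  have d: "\<delta> > 0" using assms c by (simp add: \<delta>_def field_simps)
  obtain C1 A where CA: "\<And>s. Re s \<ge> 1/2 + \<delta> \<Longrightarrow> norm (inverse (zeta s)) \<le> C1 * (1 + \<bar>Im s\<bar>) ^ A"
    using inverse_zeta_bound[OF nz d] by blast
  obtain C2 where C2: "C2 \<ge> 0" "\<And>s. 1 - b \<le> Re s \<and> Re s \<le> 1 - a \<and> \<bar>Im s\<bar> \<ge> 1 \<Longrightarrow> norm (Gamma s) \<le> C2 / \<bar>Im s\<bar> ^ (A + 2)"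
    using Gamma_decay[of "1 - b" "1 - a" "A + 2"] by blast
  show ?thesis
  proof (intro exI[of _ "C2 * (\<bar>C1\<bar> * (1 + c) ^ A)"] conjI allI impI)
    show "0 \<le> C2 * (\<bar>C1\<bar> * (1 + c) ^ A)" using C2 c by simp
    fix s assume s: "a \<le> Re s \<and> Re s \<le> b \<and> \<bar>Im s\<bar> \<ge> 1"
    define t where "t = \<bar>Im s\<bar>"
    have t: "t \<ge> 1" using s by (simp add: t_def)
    have 1: "norm (Gamma (1 - s)) \<le> C2 / t ^ (A + 2)" using C2(2)[of "1 - s"] s by (simp add: t_def)
    have "norm (inv_zeta (of_real c * s)) \<le> C1 * (1 + \<bar>Im (of_real c * s)\<bar>) ^ A"
      unfolding inv_zeta_eq using s c by (intro CA) (auto simp: \<delta>_def)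
    also have "\<dots> \<le> \<bar>C1\<bar> * ((1 + c) * t) ^ A"
    proof (intro mult_mono power_mono)
      show "1 + \<bar>Im (of_real c * s)\<bar> \<le> (1 + c) * t" using t c by (simp add: abs_mult t_def algebra_simps)
    qed (use c t in auto)
    finally have 2: "norm (inv_zeta (of_real c * s)) \<le> \<bar>C1\<bar> * ((1 + c) * t) ^ A" .
    have "norm (riesz_kernel s) \<le> (C2 / t ^ (A + 2)) * (\<bar>C1\<bar> * ((1 + c) * t) ^ A)"
      unfolding riesz_kernel_def norm_mult using 1 2 C2 t by (intro mult_mono) auto
    also have "\<dots> = C2 * (\<bar>C1\<bar> * (1 + c) ^ A) / t\<^sup>2"
    proof -
      have "C2 / (T * U) * (D * (E * T)) = C2 * (D * E) / U" if "T > 0" for D E T U :: real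
        using that by (simp add: field_simps)
      from this[of "t ^ A"] show ?thesis using t unfolding power_mult_distrib power_add by simp
    qed
    finally show "norm (riesz_kernel s) \<le> C2 * (\<bar>C1\<bar> * (1 + c) ^ A) / (Im s)\<^sup>2" by (simp add: t_def)
  qed
qed

definition riesz_integrand :: "real \<Rightarrow> complex \<Rightarrow> complex" where
  "riesz_integrand x s = riesz_kernel s * of_real x powr s"

text \<open>Near s = n + 1 the argument 1 - s runs backwards: s - (n + 1) = -((1 - s) + n), which
  negates the residue (-1)^n / n! of Gamma at -n.\<close>

lemma residue_riesz_integrand:
  assumes "x > 0"
  shows "residue (riesz_integrand x) (of_real (real (Suc n))) = - of_real (riesz_term c n x)"
proof -
  let ?p = "of_real (real (Suc n)) :: complex"
  let ?S = "{s. max (1 / (2 * c)) (real n) < Re s \<and> Re s < real n + 2}"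
  have c2: "1 / (2 * c) < 1" using c by (simp add: field_simps)
  have op: "open ?S" by (intro open_Collect_conj open_halfspace_Re_gt open_halfspace_Re_lt)
  have "riesz_kernel holomorphic_on (?S - {?p})"
  proof (rule riesz_kernel_holomorphic)
    show "of_nat (Suc m) \<notin> ?S - {?p}" for m by (cases "m = n") auto
  qed auto
  hence hol: "riesz_integrand x holomorphic_on (?S - {?p})"
    unfolding riesz_integrand_def using assms by (intro holomorphic_intros) auto
  let ?w = "of_real (c * real (Suc n)) :: complex"
  have re: "Re ?w > 1/2" using riesz_zeta_arg_gt_1[OF c, of n] by simp
  have lim: "filterlim (\<lambda>s. 1 - s) (at (- of_nat n)) (at ?p)"
    by (rule filterlim_atI) (auto intro!: tendsto_eq_intros simp: eventually_at_filter algebra_simps)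
  have L1: "((\<lambda>s. Gamma (1 - s) * ((1 - s) + of_nat n)) \<longlongrightarrow> ((-1) ^ n / fact n)) (at ?p)"
    by (rule filterlim_compose[OF Gamma_residues lim])
  have "isCont (\<lambda>s. inv_zeta (of_real c * s) * of_real x powr s) ?p"
    unfolding inv_zeta_def
    by (intro continuous_intros continuous_on_interior[OF holomorphic_on_imp_continuous_on[OF holomorphic_zeta_reg]]
        isCont_o2[where g = zeta_reg])
       (use assms nz[OF re] in auto)
  hence L2: "((\<lambda>s. inv_zeta (of_real c * s) * of_real x powr s) \<longlongrightarrow> inv_zeta (of_real c * ?p) * of_real x powr ?p) (at ?p)"
    by (simp add: isCont_def)
  have "((\<lambda>s. - (Gamma (1 - s) * ((1 - s) + of_nat n)) * (inv_zeta (of_real c * s) * of_real x powr s))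
      \<longlongrightarrow> - ((-1) ^ n / fact n) * (inv_zeta (of_real c * ?p) * of_real x powr ?p)) (at ?p)"
    by (intro tendsto_intros L1 L2)
  also have "(\<lambda>s. - (Gamma (1 - s) * ((1 - s) + of_nat n)) * (inv_zeta (of_real c * s) * of_real x powr s))
      = (\<lambda>s. riesz_integrand x s * (s - ?p))"
    by (simp add: fun_eq_iff riesz_integrand_def riesz_kernel_def algebra_simps)
  also have "- ((-1) ^ n / fact n) * (inv_zeta (of_real c * ?p) * of_real x powr ?p) = - of_real (riesz_term c n x)"
  proof -
    have "of_real x powr ?p = (of_real (x ^ Suc n) :: complex)"
      using assms by (simp add: powr_of_real powr_realpow flip: of_real_power of_nat_Suc)
    moreover have "inv_zeta (of_real c * ?p) = of_real (inverse (Re (zeta ?w)))"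
      unfolding inv_zeta_eq using zeta_of_real(3)[OF riesz_zeta_arg_gt_1[OF c, of n]]
      by (metis of_real_inverse of_real_mult)
    ultimately show ?thesis
      unfolding riesz_term_def by (simp add: field_simps del: power_Suc of_nat_Suc)
  qed
  finally show ?thesis by (intro residue_simple'[OF op _ hol]) (use c2 in auto)
qed

lemma riesz_line_step:
  assumes x: "x > 0" and a: "max (1 / (2 * c)) (real n) < a" "a < real (Suc n)" and b: "real (Suc n) < b" "b < real n + 2"
  shows "(LINT t|lborel. riesz_integrand x (Complex b t)) - (LINT t|lborel. riesz_integrand x (Complex a t)) =
     - of_real (2 * pi * riesz_term c n x)"
proof -
  obtain C where C: "C \<ge> 0" "\<And>s. a \<le> Re s \<and> Re s \<le> b \<and> \<bar>Im s\<bar> \<ge> 1 \<Longrightarrow> norm (riesz_kernel s) \<le> C / (Im s)\<^sup>2"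
    using riesz_kernel_decay[of a b] a by auto
  have "(LINT t|lborel. riesz_integrand x (Complex b t)) - (LINT t|lborel. riesz_integrand x (Complex a t)) =
      2 * pi * residue (riesz_integrand x) (of_real (real (Suc n)))"
  proof (rule vertical_line_shift)
    have "riesz_kernel holomorphic_on ({s. max (1 / (2 * c)) (real n) < Re s \<and> Re s < real n + 2} - {of_real (real (Suc n))})"
    proof (rule riesz_kernel_holomorphic)
      show "of_nat (Suc m) \<notin> {s. max (1 / (2 * c)) (real n) < Re s \<and> Re s < real n + 2} - {of_real (real (Suc n))}" for m
        by (cases "m = n") auto
    qed auto
    thus "riesz_integrand x holomorphic_on ({s. max (1 / (2 * c)) (real n) < Re s \<and> Re s < real n + 2} - {of_real (real (Suc n))})"
      unfolding riesz_integrand_def using x by (intro holomorphic_intros) auto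
    fix s assume s: "a \<le> Re s" "Re s \<le> b" "\<bar>Im s\<bar> \<ge> 1"
    \<comment> \<open>One bound for the whole strip, valid for x below and above 1.\<close>
    have xs: "x powr Re s \<le> x powr a + x powr b"
    proof (cases "x \<ge> 1")
      case True
      hence "x powr Re s \<le> x powr b" using s by (intro powr_mono) auto
      thus ?thesis using powr_ge_zero[of x a] by linarith
    next
      case False
      hence "x powr Re s \<le> x powr a" using s x by (intro powr_mono') auto
      thus ?thesis using powr_ge_zero[of x b] by linarith
    qed
    have "norm (riesz_integrand x s) = norm (riesz_kernel s) * x powr Re s"
      using x by (simp add: riesz_integrand_def norm_mult norm_powr_real_powr)
    also have "\<dots> \<le> C / (Im s)\<^sup>2 * (x powr a + x powr b)"
      using C(1) C(2)[of s] s xs by (intro mult_mono) auto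
    finally show "norm (riesz_integrand x s) \<le> (C * (x powr a + x powr b)) / (Im s)\<^sup>2" by simp
  qed (use a b in auto)
  thus ?thesis unfolding residue_riesz_integrand[OF x] by simp
qed

lemma riesz_kernel_integrable:
  assumes "a > 1 / (2 * c)" "\<And>n. a \<noteq> real (Suc n)"
  shows "integrable lborel (\<lambda>t. riesz_kernel (Complex a t))"
proof -
  obtain C where C: "C \<ge> 0" "\<And>s. a \<le> Re s \<and> Re s \<le> a \<and> \<bar>Im s\<bar> \<ge> 1 \<Longrightarrow> norm (riesz_kernel s) \<le> C / (Im s)\<^sup>2"
    using riesz_kernel_decay[of a a] assms by auto
  have "riesz_kernel holomorphic_on {s. Re s = a}"
    by (rule riesz_kernel_holomorphic) (use assms in auto)
  hence "continuous_on {s. Re s = a} riesz_kernel" by (rule holomorphic_on_imp_continuous_on)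
  hence "continuous_on UNIV (\<lambda>t. riesz_kernel (Complex a t))"
    by (rule continuous_on_compose2) (auto intro!: continuous_intros simp: Complex_eq)
  moreover have "norm (riesz_kernel (Complex a t)) \<le> C / t\<^sup>2" if "\<bar>t\<bar> \<ge> 1" for t
    using C(2)[of "Complex a t"] that by simp
  ultimately show ?thesis by (rule integrable_quadratic_decay)
qed

lemma norm_riesz_line_le:
  assumes "x > 0"
  shows "norm (LINT t|lborel. riesz_integrand x (Complex a t)) \<le> x powr a * (LINT t|lborel. norm (riesz_kernel (Complex a t)))"
proof -
  have "norm (LINT t|lborel. riesz_integrand x (Complex a t)) \<le> (LINT t|lborel. norm (riesz_integrand x (Complex a t)))"
    by (rule integral_norm_bound)
  also have "\<dots> = (LINT t|lborel. x powr a * norm (riesz_kernel (Complex a t)))"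
    using assms by (simp add: riesz_integrand_def norm_mult norm_powr_real_powr mult.commute)
  finally show ?thesis by simp
qed

text \<open>Factor number i has a real part of modulus N - i - 1/2 >= (N - i)/2.\<close>

lemma norm_pochhammer_half_ge:
  "norm (pochhammer (Complex (1/2 - real N) t) N) \<ge> fact N / 2 ^ N"
proof -
  have "norm (pochhammer (Complex (1/2 - real N) t) N) = (\<Prod>i<N. norm (Complex (1/2 - real N) t + of_nat i))"
    by (simp add: pochhammer_prod prod_norm atLeast0LessThan)
  also have "\<dots> \<ge> (\<Prod>i<N. real (N - i) / 2)"
  proof (intro prod_mono conjI)
    fix i assume i: "i \<in> {..<N}"
    have "real (N - i) / 2 \<le> \<bar>Re (Complex (1/2 - real N) t + of_nat i)\<bar>"
      using i by (auto simp: of_nat_diff)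
    also have "\<dots> \<le> norm (Complex (1/2 - real N) t + of_nat i)" by (rule abs_Re_le_cmod)
    finally show "real (N - i) / 2 \<le> norm (Complex (1/2 - real N) t + of_nat i)" .
  qed auto
  also have "(\<Prod>i<N. real (N - i) / 2) = fact N / 2 ^ N"
  proof -
    have "(\<Prod>i<N. real (N - i)) = (fact N :: real)"
      unfolding fact_prod_rev by (simp add: atLeast0LessThan)
    thus ?thesis by (simp add: prod_dividef)
  qed
  finally show ?thesis .
qed

text \<open>Half-integer lines run midway between the poles. There Gamma(1/2 - N - it) is Gamma(1/2
  - it) divided by a product bounded below in \<open>norm_pochhammer_half_ge\<close>, and N >= 3
  gives Re (c s) >= 3, where 1/zeta is at most 6.\<close>

lemma riesz_kernel_line_integral_le:
  "\<exists>K N0. \<forall>N\<ge>N0. (LINT t|lborel. norm (riesz_kernel (Complex (real N + 1/2) t))) \<le> K * (2 ^ N / fact N)"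
proof -
  obtain C where C: "C \<ge> 0" "\<And>s. 1/2 \<le> Re s \<and> Re s \<le> 1/2 \<and> \<bar>Im s\<bar> \<ge> 1 \<Longrightarrow> norm (Gamma s :: complex) \<le> C / \<bar>Im s\<bar> ^ 2"
    using Gamma_decay[of "1/2" "1/2" 2] by blast
  have iG: "integrable lborel (\<lambda>t. Gamma (Complex (1/2) (- t)))"
  proof (rule integrable_quadratic_decay)
    have "continuous_on {s. Re s = 1/2} (Gamma :: complex \<Rightarrow> complex)"
      by (intro continuous_intros) (auto elim!: nonpos_Ints_cases)
    thus "continuous_on UNIV (\<lambda>t. Gamma (Complex (1/2) (- t)))"
      by (rule continuous_on_compose2) (auto intro!: continuous_intros simp: Complex_eq)
    show "norm (Gamma (Complex (1/2) (- t))) \<le> C / t\<^sup>2" if "\<bar>t\<bar> \<ge> 1" for t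
      using C(2)[of "Complex (1/2) (- t)"] that by simp
  qed
  obtain N0 :: nat where N0: "real N0 \<ge> 3" "N0 \<ge> 1" using real_arch_simple[of 3] by (metis le_add2 le_add_same_cancel2 of_nat_0_le_iff of_nat_add add_increasing2)
  show ?thesis
  proof (intro exI allI impI)
    fix N assume N: "N \<ge> N0"
    have pt: "norm (riesz_kernel (Complex (real N + 1/2) t)) \<le> 6 * (2 ^ N / fact N) * norm (Gamma (Complex (1/2) (- t)))" for t
    proof -
      let ?s = "Complex (real N + 1/2) t"
      let ?z = "Complex (1/2 - real N) (- t)"
      have sz: "1 - ?s = ?z" by (simp add: complex_eq_iff)
      have ni: "?z \<notin> \<int>\<^sub>\<le>\<^sub>0"
      proof
        assume "?z \<in> \<int>\<^sub>\<le>\<^sub>0"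
        then obtain n :: int where "1/2 - real N = real_of_int n" by (auto elim!: nonpos_Ints_cases simp: complex_eq_iff)
        hence "real_of_int (2 * (n + int N)) = real_of_int 1" by simp
        hence "2 * (n + int N) = 1" unfolding of_int_eq_iff .
        thus False by presburger
      qed
      have "pochhammer ?z N * Gamma ?z = Gamma (?z + of_nat N)"
        using pochhammer_Gamma[OF ni, of N] Gamma_nonzero[OF ni] by simp
      also have "?z + of_nat N = Complex (1/2) (- t)" by (simp add: complex_eq_iff)
      finally have "norm (pochhammer ?z N) * norm (Gamma ?z) = norm (Gamma (Complex (1/2) (- t)))"
        by (simp only: norm_mult[symmetric])
      moreover have "fact N / 2 ^ N * norm (Gamma ?z) \<le> norm (pochhammer ?z N) * norm (Gamma ?z)"
        by (intro mult_right_mono norm_pochhammer_half_ge) auto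
      ultimately have G: "norm (Gamma ?z) \<le> 2 ^ N / fact N * norm (Gamma (Complex (1/2) (- t)))"
        by (simp add: field_simps)
      have "Re (of_real c * ?s) \<ge> 3"
      proof -
        have "3 \<le> 1 * (real N + 1/2)" using N N0 by simp
        also have "\<dots> \<le> c * (real N + 1/2)" using c by (intro mult_right_mono) auto
        finally show ?thesis by simp
      qed
      from norm_zeta_ge[OF this] have "norm (zeta (of_real c * ?s)) \<ge> 1/6" .
      from le_imp_inverse_le[OF this] have Z: "norm (inv_zeta (of_real c * ?s)) \<le> 6"
        by (simp add: inv_zeta_eq norm_inverse)
      have "norm (riesz_kernel ?s) \<le> (2 ^ N / fact N * norm (Gamma (Complex (1/2) (- t)))) * 6"
        unfolding riesz_kernel_def norm_mult sz by (intro mult_mono G Z) auto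
      thus ?thesis by (simp add: mult_ac)
    qed
    have "(LINT t|lborel. norm (riesz_kernel (Complex (real N + 1/2) t))) \<le> (LINT t|lborel. 6 * (2 ^ N / fact N) * norm (Gamma (Complex (1/2) (- t))))"
    proof (rule integral_mono)
      show "integrable lborel (\<lambda>t. norm (riesz_kernel (Complex (real N + 1/2) t)))"
      proof (intro integrable_norm riesz_kernel_integrable)
        have "1 / (2 * c) < 1" using c by (simp add: field_simps)
        thus "1 / (2 * c) < real N + 1/2" using N N0 by simp
        show "real N + 1/2 \<noteq> real (Suc n)" for n
        proof
          assume "real N + 1/2 = real (Suc n)"
          hence "real (2 * N + 1) = real (2 * Suc n)" by simp
          hence "2 * N + 1 = 2 * Suc n" unfolding of_nat_eq_iff .
          thus False by presburger
        qed
      qed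
      show "integrable lborel (\<lambda>t. 6 * (2 ^ N / fact N) * norm (Gamma (Complex (1/2) (- t))))"
        by (intro integrable_mult_right integrable_norm iG)
    qed (rule pt)
    thus "(LINT t|lborel. norm (riesz_kernel (Complex (real N + 1/2) t))) \<le> (6 * (LINT t|lborel. norm (Gamma (Complex (1/2) (- t))))) * (2 ^ N / fact N)"
      by (simp add: mult_ac)
  qed
qed

lemma riesz_line_integral:
  assumes x: "x > 0" and a: "1 / (2 * c) < a" "a < 1"
  shows "(LINT t|lborel. riesz_integrand x (Complex a t)) = of_real (2 * pi * Riesz c x)"
proof -
  \<comment> \<open>\<open>l n\<close> lies between n and n + 1, so passing from \<open>l n\<close>
    to \<open>l (Suc n)\<close> crosses exactly the pole n + 1. The sequence starts on the wanted
    line a.\<close>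
  define l where "l n = (if n = 0 then a else real n + 1/2)" for n :: nat
  define J where "J n = (LINT t|lborel. riesz_integrand x (Complex (l n) t))" for n
  have c2: "1 / (2 * c) < 1" using c by (simp add: field_simps)
  have "0 < 1 / (2 * c)" using c by simp
  hence a0: "a > 0" using a by linarith
  have step: "J n - J (Suc n) = of_real (2 * pi * riesz_term c n x)" for n
  proof -
    have "max (1 / (2 * c)) (real n) < l n" "l n < real (Suc n)" "real (Suc n) < l (Suc n)" "l (Suc n) < real n + 2"
      using a a0 c2 by (auto simp: l_def)
    from riesz_line_step[OF x this] show ?thesis unfolding J_def by (simp add: algebra_simps)
  qed
  obtain K N0 where K: "\<And>N. N \<ge> N0 \<Longrightarrow> (LINT t|lborel. norm (riesz_kernel (Complex (real N + 1/2) t))) \<le> K * (2 ^ N / fact N)"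
    using riesz_kernel_line_integral_le by blast
  have J0: "J \<longlonglongrightarrow> 0"
  proof (rule Lim_null_comparison)
    show "\<forall>\<^sub>F N in sequentially. norm (J N) \<le> x powr (1/2) * K * ((2 * x) ^ N / fact N)"
      using eventually_ge_at_top[of "max N0 1"]
    proof eventually_elim
      case (elim N)
      have "norm (J N) \<le> x powr (real N + 1/2) * (LINT t|lborel. norm (riesz_kernel (Complex (real N + 1/2) t)))"
        using norm_riesz_line_le[OF x, of "l N"] elim by (simp add: J_def l_def)
      also have "\<dots> \<le> x powr (real N + 1/2) * (K * (2 ^ N / fact N))"
        using elim by (intro mult_left_mono K) auto
      also have "x powr (real N + 1/2) = x ^ N * x powr (1/2)"
        using x by (simp add: powr_add powr_realpow)
      finally show ?case by (simp add: power_mult_distrib mult_ac)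
    qed
    have "(\<lambda>N. (2 * x) ^ N / fact N) \<longlonglongrightarrow> 0"
      using summable_LIMSEQ_zero[OF sums_summable[OF exp_sums[of "2 * x"]]] .
    from tendsto_mult_left[OF this, of "x powr (1/2) * K"]
    show "(\<lambda>N. x powr (1/2) * K * ((2 * x) ^ N / fact N)) \<longlonglongrightarrow> 0" by simp
  qed
  have "(\<lambda>n. J n - J (Suc n)) sums (J 0 - 0)" by (rule telescope_sums'[OF J0])
  hence "(\<lambda>n. complex_of_real (2 * pi * riesz_term c n x)) sums J 0" unfolding step by simp
  moreover have "(\<lambda>n. complex_of_real (2 * pi * riesz_term c n x)) sums (of_real (2 * pi * Riesz c x))"
    unfolding Riesz_eq sums_of_real_iff using summable_riesz_term[OF c, of x] x
    by (intro sums_mult summable_sums) simp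
  ultimately have "J 0 = of_real (2 * pi * Riesz c x)" by (rule sums_unique2)
  thus ?thesis by (simp add: J_def l_def)
qed

lemma Riesz_bound_of_no_zeros:
  assumes "\<epsilon> > 0"
  shows "Riesz c \<in> O[at_top](\<lambda>x. x powr (1 / (2 * c) + \<epsilon>))"
proof -
  \<comment> \<open>The cap 1/4 keeps a below 3/4, left of the first pole s = 1; for x >= 1 a
    smaller exponent gives a stronger bound.\<close>
  define a where "a = 1 / (2 * c) + min \<epsilon> (1/4)"
  have "1 / (2 * c) < 1 / 2" using c by (simp add: field_simps)
  hence a: "1 / (2 * c) < a" "a < 1" "a \<le> 1 / (2 * c) + \<epsilon>" using assms by (auto simp: a_def)
  define K where "K = (LINT t|lborel. norm (riesz_kernel (Complex a t)))"
  have K0: "K \<ge> 0" unfolding K_def by (rule integral_nonneg_AE) simp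
  show ?thesis
  proof (rule bigoI[where c = "K / (2 * pi)"])
    show "\<forall>\<^sub>F x in at_top. norm (Riesz c x) \<le> K / (2 * pi) * norm (x powr (1 / (2 * c) + \<epsilon>))"
      using eventually_ge_at_top[of 1]
    proof eventually_elim
      case (elim x)
      have "2 * pi * \<bar>Riesz c x\<bar> = norm (LINT t|lborel. riesz_integrand x (Complex a t))"
        unfolding riesz_line_integral[OF _ a(1,2), of x, OF less_le_trans[OF zero_less_one elim]]
        by (simp add: norm_mult)
      also have "\<dots> \<le> x powr a * K" unfolding K_def using elim by (intro norm_riesz_line_le) auto
      also have "\<dots> \<le> x powr (1 / (2 * c) + \<epsilon>) * K"
        using elim a K0 by (intro mult_right_mono powr_mono) auto
      finally show ?case by (simp add: field_simps)
    qed
  qed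
qed

end

section \<open>The Mellin transform of the Riesz function\<close>

lemma Riesz_borel_measurable: "Riesz c \<in> borel_measurable borel"
  unfolding Riesz_def by measurable

text \<open>Summing over m first, the powers m^(-c(n+1)) add up to zeta(c(n+1)), which cancels the
  denominator. Tannery's theorem justifies the interchange: partial sums of that zeta value divided
  by it lie in [0, 1], a bound uniform in M.\<close>

lemma Riesz_dilate_sums:
  assumes c: "c > 1" and x: "x > 0"
  shows "(\<lambda>m. Riesz c (x / real (Suc m) powr c)) sums (x * exp (- x))"
proof -
  define q where "q m = real (Suc m) powr (- c)" for m
  define z where "z n = Re (zeta (of_real (c * real (Suc n))))" for n
  have q: "0 < q m" for m by (simp add: q_def)
  have xq: "x / real (Suc m) powr c = x * q m" for m
    by (simp add: q_def powr_minus divide_inverse)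
  have z1: "z n \<ge> 1" for n unfolding z_def by (rule zeta_of_real(2)[OF riesz_zeta_arg_gt_1[OF c]])
  have zs: "(\<lambda>m. q m ^ Suc n) sums z n" for n
  proof -
    have "q m ^ Suc n = real (Suc m) powr (- (c * real (Suc n)))" for m
    proof -
      have "q m ^ Suc n = q m powr real (Suc n)" using q by (simp only: powr_realpow)
      also have "\<dots> = real (Suc m) powr (- (c * real (Suc n)))"
        unfolding q_def powr_powr by simp
      finally show ?thesis .
    qed
    thus ?thesis using zeta_of_real(1)[OF riesz_zeta_arg_gt_1[OF c, of n]] unfolding z_def by (simp only:)
  qed
  define a where "a n M = (\<Sum>m<M. riesz_term c n (x * q m))" for n M
  have a: "a n M = (-1) ^ n * x ^ Suc n / (fact n * z n) * (\<Sum>m<M. q m ^ Suc n)" for n M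
    unfolding a_def riesz_term_def z_def sum_distrib_left by (simp add: power_mult_distrib mult_ac)
  have lim0: "(\<lambda>M. a n M) \<longlonglongrightarrow> (-1) ^ n * x ^ Suc n / (fact n * z n) * z n" for n
    unfolding a using zs[of n] by (intro tendsto_intros) (simp add: sums_def)
  have lim: "(\<lambda>M. a n M) \<longlonglongrightarrow> x * ((- x) ^ n / fact n)" for n
  proof -
    have "z n \<noteq> 0" using z1[of n] by auto
    with lim0[of n] show ?thesis
      by (simp add: power_minus[of x] mult_ac)
  qed
  have bound: "norm (a n M) \<le> x * (x ^ n / fact n)" for n M
  proof -
    have le: "(\<Sum>m<M. q m ^ Suc n) \<le> z n"
    proof -
      have "(\<Sum>m<M. q m ^ Suc n) \<le> (\<Sum>m. q m ^ Suc n)"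
      proof (rule sum_le_suminf)
        show "summable (\<lambda>m. q m ^ Suc n)" using zs[of n] by (rule sums_summable)
        show "0 \<le> q m ^ Suc n" for m using q[of m] by (intro zero_le_power less_imp_le)
      qed auto
      thus ?thesis using zs[of n] by (simp only: sums_iff)
    qed
    have ge: "(\<Sum>m<M. q m ^ Suc n) \<ge> 0" using q by (intro sum_nonneg) (simp add: less_imp_le del: power_Suc)
    have "norm (a n M) = x ^ Suc n / (fact n * z n) * (\<Sum>m<M. q m ^ Suc n)"
      unfolding a using x z1[of n] ge by (simp add: abs_mult power_abs del: power_Suc)
    also have "\<dots> \<le> x ^ Suc n / (fact n * z n) * z n"
      using x z1[of n] by (intro mult_left_mono le) auto
    also have "\<dots> = x * (x ^ n / fact n)" using z1[of n] by simp
    finally show ?thesis .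
  qed
  have "(\<lambda>M. \<Sum>n. a n M) \<longlonglongrightarrow> (\<Sum>n. x * ((- x) ^ n / fact n))"
  proof -
    have "\<forall>\<^sub>F (n, M) in at_top \<times>\<^sub>F sequentially. norm (a n M) \<le> x * (x ^ n / fact n)"
      using bound by (intro always_eventually) auto
    from tannerys_theorem[OF lim this sums_summable[OF sums_mult[OF exp_sums[of x], of x]]]
    show ?thesis by simp
  qed
  also have "(\<Sum>n. x * ((- x) ^ n / fact n)) = x * exp (- x)"
    using sums_mult[OF exp_sums[of "- x"], of x] by (simp only: sums_iff)
  also have "(\<lambda>M. \<Sum>n. a n M) = (\<lambda>M. \<Sum>m<M. Riesz c (x / real (Suc m) powr c))"
  proof
    fix M
    show "(\<Sum>n. a n M) = (\<Sum>m<M. Riesz c (x / real (Suc m) powr c))"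
      unfolding a_def Riesz_eq xq
      by (rule suminf_sum) (use x q in \<open>auto intro!: summable_riesz_term c mult_nonneg_nonneg less_imp_le\<close>)
  qed
  finally show ?thesis unfolding sums_def .
qed

text \<open>By \<open>abs_Riesz_le\<close> the function is O(y) at y = 0, so the m-th term is
  O(m^(-c)) with c > 1.\<close>

lemma summable_Riesz_dilate:
  assumes c: "c > 1" and x: "x > 0"
  shows "summable (\<lambda>m. \<bar>Riesz c (x / real (Suc m) powr c)\<bar>)"
proof (rule summable_comparison_test')
  show "summable (\<lambda>m. x * exp x * real (Suc m) powr (- c))" using c by (intro summable_mult summable_Suc_powr)
  fix m :: nat
  have p: "real (Suc m) powr c \<ge> 1" using c by (intro ge_one_powr_ge_zero) auto
  have "\<bar>Riesz c (x / real (Suc m) powr c)\<bar> \<le> (x / real (Suc m) powr c) * exp (x / real (Suc m) powr c)"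
    using x by (intro abs_Riesz_le c) auto
  also have "\<dots> \<le> (x / real (Suc m) powr c) * exp x"
  proof (intro mult_left_mono)
    have "x / real (Suc m) powr c \<le> x / 1" using x p by (intro divide_left_mono) auto
    thus "exp (x / real (Suc m) powr c) \<le> exp x" by simp
  qed (use x in auto)
  also have "\<dots> = x * exp x * real (Suc m) powr (- c)" by (simp add: powr_minus divide_inverse)
  finally show "norm \<bar>Riesz c (x / real (Suc m) powr c)\<bar> \<le> x * exp x * real (Suc m) powr (- c)" by simp
qed

text \<open>Split at X. Below X the bound x exp X leaves x^(-a), integrable at 0 because a < 1;
  above X a bound x^b with b < a leaves x^(b-a-1), integrable at infinity.\<close>

lemma mellin_integrable_Riesz:
  assumes c: "c > 1"
    and O: "\<And>\<epsilon>. \<epsilon> > 0 \<Longrightarrow> Riesz c \<in> O[at_top](\<lambda>x. x powr (1 / (2 * c) + \<epsilon>))"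
    and a: "1 / (2 * c) < a" "a < 1"
  shows "mellin_integrable (Riesz c) (- a)"
proof -
  \<comment> \<open>Half of the margin between a and 1/(2c), so that b stays strictly below
    a.\<close>
  define e where "e = (a - 1 / (2 * c)) / 2"
  have e: "e > 0" using a by (simp add: e_def)
  define b where "b = 1 / (2 * c) + e"
  have b: "b < a" using e by (simp add: b_def e_def field_simps)
  from O[OF e] obtain C where "\<forall>\<^sub>F x in at_top. norm (Riesz c x) \<le> C * norm (x powr b)"
    unfolding b_def by (elim landau_o.bigE)
  then obtain X0 where X0: "\<And>x. x \<ge> X0 \<Longrightarrow> \<bar>Riesz c x\<bar> \<le> C * x powr b"
    unfolding eventually_at_top_linorder by auto
  define X where "X = max X0 1"
  have X: "X \<ge> 1" "\<And>x. x \<ge> X \<Longrightarrow> \<bar>Riesz c x\<bar> \<le> C * x powr b" using X0 by (auto simp: X_def)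
  have m: "(\<lambda>x. indicator {0<..} x * (if x < X then Riesz c x else 0)) \<in> borel_measurable borel"
    "(\<lambda>x. indicator {0<..} x * (if x < X then 0 else Riesz c x)) \<in> borel_measurable borel"
    using Riesz_borel_measurable[of c] by measurable
  have "mellin_integrable (\<lambda>x. if x < X then Riesz c x else 0) (- a)"
  proof (rule mellin_integrable_bound[OF _ m(1)])
    show "mellin_integrable (\<lambda>x. if x / X < 1 then 1 else 0) (1 - a)"
      using X a by (intro mellin_integrable_scale[where f = "\<lambda>x. if x < 1 then 1 else 0"] mellin_one_below(1)) auto
    fix x :: real assume x: "x > 0"
    show "\<bar>if x < X then Riesz c x else 0\<bar> * x powr (- a - 1) \<le> exp X * (\<bar>if x / X < 1 then 1 else 0\<bar> * x powr (1 - a - 1))"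
    proof (cases "x < X")
      case True
      have "\<bar>Riesz c x\<bar> * x powr (- a - 1) \<le> (x * exp x) * x powr (- a - 1)"
        using x by (intro mult_right_mono abs_Riesz_le c) auto
      also have "\<dots> \<le> (x * exp X) * x powr (- a - 1)"
        using x True by (intro mult_right_mono mult_left_mono) auto
      also have "\<dots> = exp X * x powr (1 - a - 1)"
        using x by (simp add: powr_diff)
      finally show ?thesis using True X by simp
    qed (use X in auto)
  qed
  moreover have "mellin_integrable (\<lambda>x. if x < X then 0 else Riesz c x) (- a)"
  proof (rule mellin_integrable_bound[OF _ m(2)])
    show "mellin_integrable (\<lambda>x. if x / X < 1 then 0 else 1) (b - a)"
      using X b by (intro mellin_integrable_scale[where f = "\<lambda>x. if x < 1 then 0 else 1"] mellin_one_above(1)) auto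
    fix x :: real assume x: "x > 0"
    show "\<bar>if x < X then 0 else Riesz c x\<bar> * x powr (- a - 1) \<le> C * (\<bar>if x / X < 1 then 0 else 1\<bar> * x powr (b - a - 1))"
    proof (cases "x < X")
      case False
      have "\<bar>Riesz c x\<bar> * x powr (- a - 1) \<le> (C * x powr b) * x powr (- a - 1)"
        using False by (intro mult_right_mono X) auto
      also have "\<dots> = C * x powr (b - a - 1)" by (simp add: powr_add[symmetric] algebra_simps)
      finally show ?thesis using False X by simp
    qed (use X in auto)
  qed
  ultimately have "mellin_integrable (\<lambda>x. (if x < X then Riesz c x else 0) + (if x < X then 0 else Riesz c x)) (- a)"
    by (rule mellin_integrable_add)
  also have "(\<lambda>x. (if x < X then Riesz c x else 0) + (if x < X then 0 else Riesz c x)) = Riesz c" by auto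
  finally show ?thesis .
qed

text \<open>Transform \<open>Riesz_dilate_sums\<close> term by term at -s: dilation by m^c
  contributes m^(-c s), and these factors sum to zeta(c s). The absolute integrals scale by m^(-c Re
  s), hence the condition Re s > 1/c.\<close>

lemma Gamma_eq_zeta_mellin_Riesz:
  assumes c: "c > 1"
    and int: "mellin_integrable (Riesz c) (- Re s)"
    and s: "1 / c < Re s" "Re s < 1"
  shows "Gamma (1 - s) = zeta (of_real c * s) * mellin (Riesz c) (- s)"
proof -
  define k where "k m = real (Suc m) powr c" for m
  have k: "k m > 0" for m by (simp add: k_def)
  have cs: "Re (of_real c * s) > 1" using s c by (simp add: field_simps)
  let ?f = "\<lambda>m x. Riesz c (x / k m)"
  have i: "mellin_integrable (?f m) (Re (- s))" for m
    using int by (intro mellin_integrable_scale k) simp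
  have summ: "summable (\<lambda>m. \<bar>?f m x\<bar>)" if "x > 0" for x
    unfolding k_def by (rule summable_Riesz_dilate[OF c that])
  have kp: "k m powr (Re (- s)) = real (Suc m) powr (- (c * Re s))" for m
    by (simp add: k_def powr_powr)
  have sm: "summable (\<lambda>m. LINT x:{0<..}|lborel. \<bar>?f m x\<bar> * x powr (Re (- s) - 1))"
    unfolding mellin_abs_integral_scale[OF k, of "Riesz c"] kp using cs
    by (intro summable_mult2 summable_Suc_powr) simp
  have eq: "(\<Sum>m. ?f m x) = x * exp (- x)" if "x > 0" for x
    using Riesz_dilate_sums[OF c that] by (simp add: sums_iff k_def)
  have 1: "(\<lambda>m. mellin (?f m) (- s)) sums mellin (\<lambda>x. x * exp (- x)) (- s)"
    using mellin_sums(1)[OF i summ sm] mellin_cong[OF eq, where s = "- s"] by (simp only:)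
  have 2: "mellin (\<lambda>x. x * exp (- x)) (- s) = Gamma (1 - s)"
    unfolding mellin_shift using s by (subst mellin_exp(1)) (auto simp: add.commute)
  have 3: "mellin (?f m) (- s) = of_nat (Suc m) powr (- (of_real c * s)) * mellin (Riesz c) (- s)" for m
  proof -
    have "of_real (k m) powr (- s) = exp (of_real (c * ln (real (Suc m))) * (- s))"
      using k[of m] by (simp add: powr_def Ln_of_real k_def mult_ac del: of_nat_Suc)
    also have "\<dots> = of_nat (Suc m) powr (- (of_real c * s))"
    proof -
      have "ln (of_nat (Suc m)) = complex_of_real (ln (real (Suc m)))"
        using Ln_of_real[of "real (Suc m)"] by simp
      thus ?thesis by (simp add: powr_def mult_ac del: of_nat_Suc)
    qed
    finally show ?thesis using mellin_scale[OF k, of "Riesz c" m "- s"] by simp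
  qed
  have "(\<lambda>m. of_nat (Suc m) powr (- (of_real c * s)) * mellin (Riesz c) (- s)) sums (zeta (of_real c * s) * mellin (Riesz c) (- s))"
    unfolding zeta_eq_series[OF cs] by (intro sums_mult2 summable_sums summable_nat_powr cs)
  with 1[unfolded 2 3] show ?thesis by (rule sums_unique2)
qed

text \<open>For Re w < c the point s = w / c lies in the strip. A zero of \<open>zeta_reg\<close> at
  w would force Gamma(1 - s) (w - 1) = 0, although Gamma has no zeros and \<open>zeta_reg_1\<close>
  rules out w = 1.\<close>

lemma no_zeros_of_Riesz_bound:
  assumes c: "c > 1"
    and O: "\<And>\<epsilon>. \<epsilon> > 0 \<Longrightarrow> Riesz c \<in> O[at_top](\<lambda>x. x powr (1 / (2 * c) + \<epsilon>))"
    and w: "Re w > 1 / 2"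
  shows "zeta_reg w \<noteq> 0"
proof (cases "Re w < c")
  case False
  thus ?thesis using c by (intro zeta_reg_nonzero) simp
next
  case True
  let ?S = "{s. 1 / (2 * c) < Re s \<and> Re s < 1}"
  let ?U = "{s. 1 / c < Re s \<and> Re s < 1}"
  note int = mellin_integrable_Riesz[OF c O]
  define s where "s = w / of_real c"
  have ws: "w = of_real c * s" using c by (simp add: s_def)
  have s: "s \<in> ?S" using w True c by (simp add: s_def Re_divide_of_real field_simps)
  have "1 / c < 1" using c by simp
  \<comment> \<open>The factor c s - 1 clears the pole of zeta(c s) at s = 1/c, an interior point of
    \<open>?S\<close> on the boundary of \<open>?U\<close>.\<close>
  have "Gamma (1 - s) * (of_real c * s - 1) = zeta_reg (of_real c * s) * mellin (Riesz c) (- s)"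
  proof (rule analytic_continuation_open[where s = ?U and s' = ?S and z = s])
    show "open ?U" "open ?S" by (intro open_Collect_conj open_halfspace_Re_gt open_halfspace_Re_lt)+
    show "connected ?S"
      unfolding Collect_conj_eq by (intro convex_connected convex_Int convex_halfspace_Re_gt convex_halfspace_Re_lt)
    have "of_real ((1 / c + 1) / 2) \<in> ?U" using \<open>1 / c < 1\<close> by simp
    thus "?U \<noteq> {}" by blast
    have "1 / (2 * c) < 1 / c" using c by (simp add: field_simps)
    thus "?U \<subseteq> ?S" by auto
    show "(\<lambda>s. Gamma (1 - s) * (of_real c * s - 1)) holomorphic_on ?S"
      by (intro holomorphic_intros Re_pos_not_nonpos_Int) auto
    have "mellin (Riesz c) holomorphic_on {s. -1 < Re s \<and> Re s < - (1 / (2 * c))}"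
      by (rule mellin_holomorphic) (use int[of "- r" for r] in auto)
    hence "(mellin (Riesz c) \<circ> uminus) holomorphic_on ?S"
      by (rule holomorphic_on_compose_gen[rotated]) (auto intro: holomorphic_intros)
    hence "(\<lambda>s. mellin (Riesz c) (- s)) holomorphic_on ?S" by (simp only: o_def)
    thus "(\<lambda>s. zeta_reg (of_real c * s) * mellin (Riesz c) (- s)) holomorphic_on ?S"
      by (intro holomorphic_intros)
    fix z assume z: "z \<in> ?U"
    hence "Gamma (1 - z) = zeta (of_real c * z) * mellin (Riesz c) (- z)"
      using \<open>?U \<subseteq> ?S\<close> by (intro Gamma_eq_zeta_mellin_Riesz c int) auto
    moreover have "Re (of_real c * z) > 1" using z c by (simp add: field_simps)
    hence "of_real c * z - 1 \<noteq> 0" by (metis Re_complex_of_real complex_Re_of_nat eq_iff_diff_eq_0 less_irrefl of_nat_1)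
    ultimately show "Gamma (1 - z) * (of_real c * z - 1) = zeta_reg (of_real c * z) * mellin (Riesz c) (- z)"
      by (simp add: zeta_eq)
  qed (rule s)
  moreover have "Gamma (1 - s) \<noteq> 0" using s by (intro Gamma_nonzero Re_pos_not_nonpos_Int) simp
  ultimately show ?thesis unfolding ws[symmetric] using zeta_reg_1 by (metis eq_iff_diff_eq_0 mult_eq_0_iff zero_neq_one)
qed


theorem theorem3:
  fixes c :: real
  assumes "c > 1"
  shows "riemann_hypothesis \<longleftrightarrow>
           (\<forall>\<epsilon>>0. Riesz c \<in> O[at_top](\<lambda>x. x powr (1 / (2 * c) + \<epsilon>)))"
proof
  assume RH: riemann_hypothesis
  have nz: "zeta_reg s \<noteq> 0" if s: "Re s > 1/2" for s
  proof
    assume z: "zeta_reg s = 0"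
    \<comment> \<open>As \<open>zeta_reg 1\<close> is 1, a zero of \<open>zeta_reg\<close> is never
      s = 1, where \<open>zeta\<close> vanishes only by convention.\<close>
    hence "s \<noteq> 1" "zeta s = 0" using zeta_reg_1 by (auto simp: zeta_eq)
    moreover have "s \<noteq> - 2 * of_nat (Suc n)" for n :: nat
      using s by (auto simp: complex_eq_iff)
    ultimately have "Re s = 1/2" using RH unfolding riemann_hypothesis_def by blast
    thus False using s by simp
  qed
  show "\<forall>\<epsilon>>0. Riesz c \<in> O[at_top](\<lambda>x. x powr (1 / (2 * c) + \<epsilon>))"
    using Riesz_bound_of_no_zeros[OF assms nz] by blast
next
  assume "\<forall>\<epsilon>>0. Riesz c \<in> O[at_top](\<lambda>x. x powr (1 / (2 * c) + \<epsilon>))"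
  hence nz: "zeta_reg w \<noteq> 0" if "Re w > 1/2" for w
    using that by (intro no_zeros_of_Riesz_bound[OF assms]) auto
  show riemann_hypothesis
    unfolding riemann_hypothesis_def
  proof (intro allI impI)
    fix s assume s: "s \<noteq> 1 \<and> zeta s = 0 \<and> (\<forall>n::nat. s \<noteq> - 2 * of_nat (Suc n))"
    hence z: "zeta_reg s = 0" by (auto simp: zeta_eq)
    have "\<not> Re s > 1/2" using nz z by blast
    moreover have "\<not> Re s < 1/2"
    proof
      assume l: "Re s < 1/2"
      hence "zeta_reg (1 - s) = 0" using z s by (intro zeta_reg_zero_reflect) auto
      moreover have "Re (1 - s) > 1/2" using l by simp
      ultimately show False using nz by blast
    qed
    ultimately show "Re s = 1/2" by linarith
  qed
qed

end
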